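(* Assume the following. (Generator) For every $\theta\in\Theta$, $Q_\theta=(q_{ij}(\theta))_{1\le i,j\le N}$ is a real matrix with $q_{ij}(\theta)\ge0$ for $i\neq j$ and $q_{ii}(\theta)=-\sum_{j\ne i}q_{ij}(\theta)$, and there exists $L_Q>0$ with $\|Q_\theta^*-Q_{\bar\theta}^*\|_{1\to1}\le L_Q|\theta-\bar\theta|$ for all $\theta,\bar\theta\in\Theta$. (Mixing) There exist $C_{\mathrm{mix}}\ge1$ and $\gamma>0$ such that $|e^{tQ_\theta^*}\xi|_1\le C_{\mathrm{mix}}e^{-\gamma t}|\xi|_1$ for all $\theta\in\Theta$, $\xi\in\mathcal{Z}$, $t\ge0$. (Pathwise stability) There exist constants $C_{\mathrm{path}}\ge1$ and $\gamma_{\mathrm{path}}>0$ such that, for every $\delta>0$ and every measurable path $\vartheta:[0,\infty)\to\Theta$, the evolution family $U_\vartheta^\delta(t,s):\mathcal{Z}\to\mathcal{Z}$ of $\delta\dot\xi(t)=Q_{\vartheta(t)}^*\xi(t)$, $\xi(s)=\xi_s\in\mathcal{Z}$, satisfies $|U_\vartheta^\delta(t,s)\xi|_1\le C_{\mathrm{path}}e^{-\gamma_{\mathrm{path}}(t-s)/\delta}|\xi|_1$ for all $\xi\in\mathcal{Z}$, $0\le s\le t$. Then, for every $\delta>0$, the exact semiflow $S_\delta(t)$ possesses a compact global attractor $\mathcal{A}_\delta\subset K$, and $$\operatorname{dist}_X\bigl(\mathcal{A}_\delta,\widehat{\mathcal{A}}_0\bigr)\longrightarrow0\qquad\text{as }\delta\to0,$$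 where $\operatorname{dist}_X(B,C):=\sup_{x\in B}\inf_{y\in C}d_X(x,y)$ and $\widehat{\mathcal{A}}_0=\{(\theta,w,\mu_\theta)\in X:(\theta,w)\in\mathcal{A}_0\}$ is the lift of the global attractor $\mathcal{A}_0$ of the reduced semiflow $\bar S(t)$.
   Context: Fix integers $N,K_0,d,m\ge1$ (number of states, number of actions, actor dimension, critic dimension) and positive constants $R_\theta,\tau,\lambda_c$. Below, $i$ ranges over $\{1,\dots,N\}$ and $a,b$ over $\{1,\dots,K_0\}$ when used as action indices. Fix data $r_{i,a}\in\mathbb{R}$, $\psi_{i,a}\in\mathbb{R}^d$, $\varphi_{i,a}\in\mathbb{R}^m$. Let $$\Theta=[-R_\theta,R_\theta]^d,\qquad \Delta_S=\Bigl\{\mu\in[0,\infty)^N:\sum_i\mu_i=1\Bigr\},\qquad \mathcal{Z}=\Bigl\{\xi\in\mathbb{R}^N:\sum_i\xi_i=0\Bigr\}.$$ Here $R_\theta$ is a constant (the subscript is part of its name). Define $$\pi_\theta(a\mid i)=\frac{\exp(\psi_{i,a}\cdot\theta/\tau)}{\sum_{b=1}^{K_0}\exp(\psi_{i,b}\cdot\theta/\tau)},\qquad \nu_{\theta,\mu}(i,a)=\mu_i\,\pi_\theta(a\mid i),$$ $$b(\theta,\mu)=\sum_{i,a}\nu_{\theta,\mu}(i,a)\,r_{i,a}\,\varphi_{i,a}\in\mathbb{R}^m,\qquad A(\theta,\mu)=\lambda_c I_m+\sum_{i,a}\nu_{\theta,\mu}(i,a)\,\varphi_{i,a}\varphi_{i,a}^\top,$$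 $$\widetilde G(\theta,w,\mu)=\sum_{i,a}\nu_{\theta,\mu}(i,a)\bigl(r_{i,a}+\varphi_{i,a}\cdot w-\tau\log\pi_\theta(a\mid i)\bigr)\nabla_\theta\log\pi_\theta(a\mid i)\in\mathbb{R}^d,$$ $$D(\theta)=\operatorname{diag}(R_\theta^2-\theta_1^2,\dots,R_\theta^2-\theta_d^2),\qquad G(\theta,w,\mu)=D(\theta)\widetilde G(\theta,w,\mu).$$ $Q_\theta^*$ is the transpose of $Q_\theta$, acting on column vectors of $\mathbb{R}^N$; $|\cdot|_1$ is the $\ell^1$-norm on $\mathbb{R}^N$ and $\|\cdot\|_{1\to1}$ the induced operator norm. $|\cdot|$ is the Euclidean norm on $\mathbb{R}^d$ and $\mathbb{R}^m$. The state space $X=\Theta\times\mathbb{R}^m\times\Delta_S$ carries the metric $d_X((\theta,w,\mu),(\bar\theta,\bar w,\bar\mu))=|\theta-\bar\theta|+|w-\bar w|+|\mu-\bar\mu|_1$. Constants: $M_r=\max_{i,a}|r_{i,a}|$, $M_\varphi=\max_{i,a}|\varphi_{i,a}|$, $B_b=M_rM_\varphi$, $R_w=\max\{1,2B_b/\lambda_c\}$, and $K=\Theta\times\overline{B_{R_w}(0)}\times\Delta_S$, where $\overline{B_{R_w}(0)}$ is the closed Euclidean ball in $\mathbb{R}^m$. For $\delta>0$, $S_\delta(t)$, $t\ge0$, denotes the continuous semiflow on $X$ generated by the exact system $$\dot\theta=G(\theta,w,\mu),\qquad \dot w=b(\theta,\mu)-A(\theta,\mu)w,\qquad \delta\dot\mu=Q_\theta^*\mu,$$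 i.e. $S_\delta(t)x_0$ is the value at time $t$ of the unique $X$-valued solution on $[0,\infty)$ starting at $x_0$. Under the mixing hypothesis, $\mu_\theta$ denotes the unique element of $\Delta_S$ with $Q_\theta^*\mu_\theta=0$, and $\bar S(t)$ denotes the continuous semiflow on $Y=\Theta\times\mathbb{R}^m$ generated by the reduced system $$\dot{\bar\theta}=G(\bar\theta,\bar w,\mu_{\bar\theta}),\qquad \dot{\bar w}=b(\bar\theta,\mu_{\bar\theta})-A(\bar\theta,\mu_{\bar\theta})\bar w.$$ $\mathcal{A}_0\subset Y$ is the compact global attractor of $\bar S(t)$, namely $\mathcal{A}_0=\omega(K_Y)=\bigcap_{s\ge0}\overline{\bigcup_{t\ge s}\bar S(t)K_Y}$ with $K_Y=\Theta\times\overline{B_{R_w}(0)}$. A compact global attractor of a semiflow $F(t)$ on a metric space $(Z,d)$ is a nonempty compact set $\mathcal{A}\subset Z$ with $F(t)\mathcal{A}=\mathcal{A}$ for all $t\ge0$ and $\sup_{x\in B}\inf_{y\in\mathcal{A}}d(F(t)x,y)\to0$ as $t\to\infty$ for every bounded $B\subset Z$; it is unique when it exists. Solutions of the non-autonomous linear equation along a measurable path are understood as absolutely continuous functions satisfying the equation almost everywhere (Carathéodory solutions); $U_\vartheta^\delta(t,s)$ maps the value at time $s$ to the value at time $t$. *)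

theory Defs
  imports "HOL-Analysis.Analysis"
begin

definition norm1 :: "real^'n \<Rightarrow> real" where
  "norm1 x = (\<Sum>i\<in>UNIV. \<bar>x $ i\<bar>)"

definition opnorm1 :: "real^'n^'n \<Rightarrow> real" where
  "opnorm1 M = (SUP x\<in>{x. norm1 x \<le> 1}. norm1 (M *v x))"

text \<open>The multiplication \<^term>\<open>(*)\<close> on vectors is componentwise, so the library
  exponential does not apply to square matrices; this is the power series with
  matrix products.\<close>

definition matrix_exp :: "real^'n^'n \<Rightarrow> real^'n^'n" where
  "matrix_exp M = (\<Sum>k. (1 / fact k) *\<^sub>R (((**) M ^^ k) (mat 1)))"

definition gradient :: "('a::real_inner \<Rightarrow> real) \<Rightarrow> 'a \<Rightarrow> 'a" where
  "gradient f x = (THE g. GDERIV f x :> g)"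

text \<open>Solutions are classical; the derivative at time 0 is one-sided.\<close>

definition solution_in :: "'a set \<Rightarrow> ('a::real_normed_vector \<Rightarrow> 'a) \<Rightarrow> (real \<Rightarrow> 'a) \<Rightarrow> bool" where
  "solution_in Z f x \<longleftrightarrow>
     (\<forall>t\<ge>0. x t \<in> Z \<and> (x has_vector_derivative f (x t)) (at t within {0..}))"

text \<open>The description ranges over the value at time \<open>t\<close> and not over the solution itself,
  because a function on the reals is not determined by its restriction to \<open>[0, \<infinity>)\<close>.\<close>

definition semiflow_of :: "'a set \<Rightarrow> ('a::real_normed_vector \<Rightarrow> 'a) \<Rightarrow> real \<Rightarrow> 'a \<Rightarrow> 'a" where
  "semiflow_of Z f t x0 = (THE y. \<exists>x. solution_in Z f x \<and> x 0 = x0 \<and> x t = y)"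

text \<open>Values in \<^typ>\<open>ennreal\<close> give the usual conventions for empty and unbounded sets.\<close>

definition semidist :: "('a \<Rightarrow> 'a \<Rightarrow> real) \<Rightarrow> 'a set \<Rightarrow> 'a set \<Rightarrow> ennreal" where
  "semidist d B C = (SUP x\<in>B. INF y\<in>C. ennreal (d x y))"

definition compact_global_attractor ::
  "'a set \<Rightarrow> ('a \<Rightarrow> 'a \<Rightarrow> real) \<Rightarrow> (real \<Rightarrow> 'a \<Rightarrow> 'a) \<Rightarrow> 'a set \<Rightarrow> bool" where
  "compact_global_attractor Z d F A \<longleftrightarrow>
     A \<noteq> {} \<and> compactin (Metric_space.mtopology Z d) A \<and>
     (\<forall>t\<ge>0. F t ` A = A) \<and>
     (\<forall>B. Metric_space.mbounded Z d B \<longrightarrow> ((\<lambda>t. semidist d (F t ` B) A) \<longlongrightarrow> 0) at_top)"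

text \<open>The closure is taken in the ambient space, which agrees with the closure in the phase
  space whenever the latter is closed.\<close>

definition omega_limit :: "(real \<Rightarrow> 'a \<Rightarrow> 'a) \<Rightarrow> 'a::topological_space set \<Rightarrow> 'a set" where
  "omega_limit F B = (\<Inter>s\<in>{0..}. closure (\<Union>t\<in>{s..}. F t ` B))"

definition absolutely_cont :: "real \<Rightarrow> real \<Rightarrow> (real \<Rightarrow> 'a::real_normed_vector) \<Rightarrow> bool" where
  "absolutely_cont a b f \<longleftrightarrow>
     (\<forall>\<epsilon>>0. \<exists>\<eta>>0. \<forall>I. finite I \<and> (\<forall>(u, v)\<in>I. a \<le> u \<and> u \<le> v \<and> v \<le> b) \<and>
        pairwise (\<lambda>(u, v) (u', v'). {u<..<v} \<inter> {u'<..<v'} = {}) I \<and>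
        (\<Sum>(u, v)\<in>I. v - u) < \<eta> \<longrightarrow>
        (\<Sum>(u, v)\<in>I. norm (f v - f u)) < \<epsilon>)"

text \<open>\<open>evolves Q \<delta> \<eta> s t \<xi>\<^sub>s \<xi>\<^sub>t\<close> is the graph of the evolution operator \<open>U(t, s)\<close>: some
  solution on \<open>[s, t]\<close> of \<open>\<delta> \<xi>' = Q(\<eta>(u))\<^sup>* \<xi>\<close> leads from \<open>\<xi>\<^sub>s\<close> at time \<open>s\<close>
  to \<open>\<xi>\<^sub>t\<close> at time \<open>t\<close>.\<close>

definition evolves ::
  "(real^'d \<Rightarrow> real^'n^'n) \<Rightarrow> real \<Rightarrow> (real \<Rightarrow> real^'d) \<Rightarrow> real \<Rightarrow> real
    \<Rightarrow> real^'n \<Rightarrow> real^'n \<Rightarrow> bool" where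
  "evolves Q \<delta> \<eta> s t \<xi>s \<xi>t \<longleftrightarrow>
     (\<exists>\<xi>. absolutely_cont s t \<xi> \<and> \<xi> s = \<xi>s \<and> \<xi> t = \<xi>t \<and>
       (AE u in lebesgue_on {s..t}. \<exists>\<xi>'. (\<xi> has_vector_derivative \<xi>') (at u) \<and>
          \<delta> *\<^sub>R \<xi>' = transpose (Q (\<eta> u)) *v \<xi> u))"

definition Theta :: "real \<Rightarrow> (real^'d) set" where
  "Theta R = {\<theta>. \<forall>j. - R \<le> \<theta> $ j \<and> \<theta> $ j \<le> R}"

definition prob_simplex :: "(real^'n) set" where
  "prob_simplex = {\<mu>. (\<forall>i. 0 \<le> \<mu> $ i) \<and> (\<Sum>i\<in>UNIV. \<mu> $ i) = 1}"

definition zero_sum :: "(real^'n) set" where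
  "zero_sum = {\<xi>. (\<Sum>i\<in>UNIV. \<xi> $ i) = 0}"

definition policy :: "real \<Rightarrow> ('n \<Rightarrow> 'k::finite \<Rightarrow> real^'d) \<Rightarrow> real^'d \<Rightarrow> 'n \<Rightarrow> 'k \<Rightarrow> real" where
  "policy \<tau> \<psi> \<theta> i a = exp ((\<psi> i a \<bullet> \<theta>) / \<tau>) / (\<Sum>b\<in>UNIV. exp ((\<psi> i b \<bullet> \<theta>) / \<tau>))"

definition occ ::
  "real \<Rightarrow> ('n \<Rightarrow> 'k::finite \<Rightarrow> real^'d) \<Rightarrow> real^'d \<Rightarrow> real^'n \<Rightarrow> 'n \<Rightarrow> 'k \<Rightarrow> real" where
  "occ \<tau> \<psi> \<theta> \<mu> i a = \<mu> $ i * policy \<tau> \<psi> \<theta> i a"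

definition critic_b ::
  "real \<Rightarrow> ('n \<Rightarrow> 'k::finite \<Rightarrow> real) \<Rightarrow> ('n \<Rightarrow> 'k \<Rightarrow> real^'d) \<Rightarrow> ('n \<Rightarrow> 'k \<Rightarrow> real^'m)
    \<Rightarrow> real^'d \<Rightarrow> real^'n \<Rightarrow> real^'m" where
  "critic_b \<tau> r \<psi> \<phi> \<theta> \<mu> =
     (\<Sum>i\<in>UNIV. \<Sum>a\<in>UNIV. (occ \<tau> \<psi> \<theta> \<mu> i a * r i a) *\<^sub>R \<phi> i a)"

definition critic_A ::
  "real \<Rightarrow> real \<Rightarrow> ('n \<Rightarrow> 'k::finite \<Rightarrow> real^'d) \<Rightarrow> ('n \<Rightarrow> 'k \<Rightarrow> real^'m)
    \<Rightarrow> real^'d \<Rightarrow> real^'n \<Rightarrow> real^'m^'m" where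
  "critic_A \<tau> lam \<psi> \<phi> \<theta> \<mu> = lam *\<^sub>R mat 1 +
     (\<Sum>i\<in>UNIV. \<Sum>a\<in>UNIV. occ \<tau> \<psi> \<theta> \<mu> i a *\<^sub>R (\<chi> j k. \<phi> i a $ j * \<phi> i a $ k))"

definition actor_G_tilde ::
  "real \<Rightarrow> ('n \<Rightarrow> 'k::finite \<Rightarrow> real) \<Rightarrow> ('n \<Rightarrow> 'k \<Rightarrow> real^'d) \<Rightarrow> ('n \<Rightarrow> 'k \<Rightarrow> real^'m)
    \<Rightarrow> real^'d \<Rightarrow> real^'m \<Rightarrow> real^'n \<Rightarrow> real^'d" where
  "actor_G_tilde \<tau> r \<psi> \<phi> \<theta> w \<mu> =
     (\<Sum>i\<in>UNIV. \<Sum>a\<in>UNIV.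
        (occ \<tau> \<psi> \<theta> \<mu> i a * (r i a + \<phi> i a \<bullet> w - \<tau> * ln (policy \<tau> \<psi> \<theta> i a))) *\<^sub>R
        gradient (\<lambda>\<theta>'. ln (policy \<tau> \<psi> \<theta>' i a)) \<theta>)"

definition diag_D :: "real \<Rightarrow> real^'d \<Rightarrow> real^'d^'d" where
  "diag_D R \<theta> = (\<chi> j k. if j = k then R\<^sup>2 - (\<theta> $ j)\<^sup>2 else 0)"

definition actor_G ::
  "real \<Rightarrow> real \<Rightarrow> ('n \<Rightarrow> 'k::finite \<Rightarrow> real) \<Rightarrow> ('n \<Rightarrow> 'k \<Rightarrow> real^'d) \<Rightarrow> ('n \<Rightarrow> 'k \<Rightarrow> real^'m)
    \<Rightarrow> real^'d \<Rightarrow> real^'m \<Rightarrow> real^'n \<Rightarrow> real^'d" where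
  "actor_G R \<tau> r \<psi> \<phi> \<theta> w \<mu> = diag_D R \<theta> *v actor_G_tilde \<tau> r \<psi> \<phi> \<theta> w \<mu>"

definition stationary :: "(real^'d \<Rightarrow> real^'n^'n) \<Rightarrow> real^'d \<Rightarrow> real^'n" where
  "stationary Q \<theta> = (THE \<mu>. \<mu> \<in> prob_simplex \<and> transpose (Q \<theta>) *v \<mu> = 0)"

definition state_space :: "real \<Rightarrow> ((real^'d) \<times> (real^'m) \<times> (real^'n)) set" where
  "state_space R = Theta R \<times> UNIV \<times> prob_simplex"

definition dX :: "(real^'d) \<times> (real^'m) \<times> (real^'n) \<Rightarrow> (real^'d) \<times> (real^'m) \<times> (real^'n) \<Rightarrow> real" where
  "dX = (\<lambda>(\<theta>, w, \<mu>) (\<theta>', w', \<mu>'). norm (\<theta> - \<theta>') + norm (w - w') + norm1 (\<mu> - \<mu>'))"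

definition exact_field ::
  "real \<Rightarrow> real \<Rightarrow> real \<Rightarrow> ('n \<Rightarrow> 'k::finite \<Rightarrow> real) \<Rightarrow> ('n \<Rightarrow> 'k \<Rightarrow> real^'d) \<Rightarrow> ('n \<Rightarrow> 'k \<Rightarrow> real^'m)
    \<Rightarrow> (real^'d \<Rightarrow> real^'n^'n) \<Rightarrow> real
    \<Rightarrow> (real^'d) \<times> (real^'m) \<times> (real^'n) \<Rightarrow> (real^'d) \<times> (real^'m) \<times> (real^'n)" where
  "exact_field R \<tau> lam r \<psi> \<phi> Q \<delta> = (\<lambda>(\<theta>, w, \<mu>).
     (actor_G R \<tau> r \<psi> \<phi> \<theta> w \<mu>,
      critic_b \<tau> r \<psi> \<phi> \<theta> \<mu> - critic_A \<tau> lam \<psi> \<phi> \<theta> \<mu> *v w,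
      (1 / \<delta>) *\<^sub>R (transpose (Q \<theta>) *v \<mu>)))"

definition exact_semiflow ::
  "real \<Rightarrow> real \<Rightarrow> real \<Rightarrow> ('n \<Rightarrow> 'k::finite \<Rightarrow> real) \<Rightarrow> ('n \<Rightarrow> 'k \<Rightarrow> real^'d) \<Rightarrow> ('n \<Rightarrow> 'k \<Rightarrow> real^'m)
    \<Rightarrow> (real^'d \<Rightarrow> real^'n^'n) \<Rightarrow> real \<Rightarrow> real
    \<Rightarrow> (real^'d) \<times> (real^'m) \<times> (real^'n) \<Rightarrow> (real^'d) \<times> (real^'m) \<times> (real^'n)" where
  "exact_semiflow R \<tau> lam r \<psi> \<phi> Q \<delta> =
     semiflow_of (state_space R) (exact_field R \<tau> lam r \<psi> \<phi> Q \<delta>)"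

definition reduced_field ::
  "real \<Rightarrow> real \<Rightarrow> real \<Rightarrow> ('n \<Rightarrow> 'k::finite \<Rightarrow> real) \<Rightarrow> ('n \<Rightarrow> 'k \<Rightarrow> real^'d) \<Rightarrow> ('n \<Rightarrow> 'k \<Rightarrow> real^'m)
    \<Rightarrow> (real^'d \<Rightarrow> real^'n^'n) \<Rightarrow> (real^'d) \<times> (real^'m) \<Rightarrow> (real^'d) \<times> (real^'m)" where
  "reduced_field R \<tau> lam r \<psi> \<phi> Q = (\<lambda>(\<theta>, w).
     (actor_G R \<tau> r \<psi> \<phi> \<theta> w (stationary Q \<theta>),
      critic_b \<tau> r \<psi> \<phi> \<theta> (stationary Q \<theta>) - critic_A \<tau> lam \<psi> \<phi> \<theta> (stationary Q \<theta>) *v w))"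

definition reduced_semiflow ::
  "real \<Rightarrow> real \<Rightarrow> real \<Rightarrow> ('n \<Rightarrow> 'k::finite \<Rightarrow> real) \<Rightarrow> ('n \<Rightarrow> 'k \<Rightarrow> real^'d) \<Rightarrow> ('n \<Rightarrow> 'k \<Rightarrow> real^'m)
    \<Rightarrow> (real^'d \<Rightarrow> real^'n^'n) \<Rightarrow> real \<Rightarrow> (real^'d) \<times> (real^'m) \<Rightarrow> (real^'d) \<times> (real^'m)" where
  "reduced_semiflow R \<tau> lam r \<psi> \<phi> Q =
     semiflow_of (Theta R \<times> UNIV) (reduced_field R \<tau> lam r \<psi> \<phi> Q)"

definition radius_w :: "real \<Rightarrow> ('n::finite \<Rightarrow> 'k::finite \<Rightarrow> real) \<Rightarrow> ('n \<Rightarrow> 'k \<Rightarrow> real^'m) \<Rightarrow> real" where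
  "radius_w lam r \<phi> =
     (let M_r = (MAX (i, a)\<in>UNIV. \<bar>r i a\<bar>);
          M_\<phi> = (MAX (i, a)\<in>UNIV. norm (\<phi> i a));
          B_b = M_r * M_\<phi>
      in max 1 (2 * B_b / lam))"

definition set_K ::
  "real \<Rightarrow> real \<Rightarrow> ('n::finite \<Rightarrow> 'k::finite \<Rightarrow> real) \<Rightarrow> ('n \<Rightarrow> 'k \<Rightarrow> real^'m)
    \<Rightarrow> ((real^'d) \<times> (real^'m) \<times> (real^'n)) set" where
  "set_K R lam r \<phi> = Theta R \<times> cball 0 (radius_w lam r \<phi>) \<times> prob_simplex"

definition reduced_attractor ::
  "real \<Rightarrow> real \<Rightarrow> real \<Rightarrow> ('n \<Rightarrow> 'k::finite \<Rightarrow> real) \<Rightarrow> ('n \<Rightarrow> 'k \<Rightarrow> real^'d) \<Rightarrow> ('n \<Rightarrow> 'k \<Rightarrow> real^'m)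
    \<Rightarrow> (real^'d \<Rightarrow> real^'n^'n) \<Rightarrow> ((real^'d) \<times> (real^'m)) set" where
  "reduced_attractor R \<tau> lam r \<psi> \<phi> Q =
     omega_limit (reduced_semiflow R \<tau> lam r \<psi> \<phi> Q) (Theta R \<times> cball 0 (radius_w lam r \<phi>))"

definition lifted_attractor ::
  "real \<Rightarrow> real \<Rightarrow> real \<Rightarrow> ('n \<Rightarrow> 'k::finite \<Rightarrow> real) \<Rightarrow> ('n \<Rightarrow> 'k \<Rightarrow> real^'d) \<Rightarrow> ('n \<Rightarrow> 'k \<Rightarrow> real^'m)
    \<Rightarrow> (real^'d \<Rightarrow> real^'n^'n) \<Rightarrow> ((real^'d) \<times> (real^'m) \<times> (real^'n)) set" where
  "lifted_attractor R \<tau> lam r \<psi> \<phi> Q =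
     {(\<theta>, w, stationary Q \<theta>) | \<theta> w. (\<theta>, w) \<in> reduced_attractor R \<tau> lam r \<psi> \<phi> Q}"

end

theory Submission
  imports Defs
begin

text \<open>Each field is dissipative in \<open>w\<close> and locally Lipschitz, and it points into the convex phase space,
  so the ball of radius \<open>R\<^sub>w\<close> yields a compact absorbing set, whose omega limit set is the global
  attractor. By invariance, a point of the exact attractor is the endpoint of a trajectory of length
  \<open>\<delta> S\<close> inside the attractor. On this time scale \<open>\<theta>\<close> is almost constant, and the stability of the
  equation with frozen \<open>\<theta>\<close> brings \<open>\<mu>\<close> close to the stationary distribution \<open>\<mu>\<^sub>\<theta>\<close>, which depends
  Lipschitz continuously on \<open>\<theta>\<close>. So along the exact attractor \<open>(\<theta>, w)\<close> solves the reduced system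
  up to an error that tends to 0 with \<open>\<delta>\<close>; Gronwall's inequality over a fixed time after which the
  reduced flow is near its attractor gives the claim.\<close>

section \<open>Ordinary differential equations with Lipschitz fields\<close>

text \<open>The obstacle is stiffness: the exact field has a Lipschitz constant of order
  \<open>1 / \<delta>\<close>, so Gronwall's inequality for the whole system over a fixed time would
  only give a factor of order \<open>exp (c / \<delta>)\<close>. Two separate comparisons avoid
  this. In time rescaled by \<open>\<delta>\<close> the equation for \<open>\<mu>\<close> loses its
  factor \<open>1 / \<delta>\<close>; there the horizon \<open>S\<close> is chosen before
  \<open>\<delta>\<close>, so the Gronwall factor is fixed while the drift of
  \<open>\<theta>\<close> is proportional to \<open>\<delta>\<close>. In the original time only
  \<open>(\<theta>, w)\<close> is compared with the reduced system, and the Lipschitz constants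
  involved do not depend on \<open>\<delta>\<close>. A second constraint comes from the semiflows,
  which are definite descriptions: they say something only after global existence and uniqueness on
  the phase space. As \<open>Q\<close> is controlled only on the cube, existence and invariance of
  the phase space have to be obtained together, which is done by projecting onto a convex set on
  which the field is Lipschitz.\<close>

lemma integral_has_vector_derivative_atLeast:
  fixes g :: "real \<Rightarrow> 'a::banach"
  assumes "continuous_on {0..} g" "0 \<le> t"
  shows "((\<lambda>u. integral {0..u} g) has_vector_derivative g t) (at t within {0..})"
proof -
  have "((\<lambda>u. integral {0..u} g) has_vector_derivative g t) (at t within {0..t + 1})"
    by (rule integral_has_vector_derivative) (use assms in \<open>auto intro: continuous_on_subset\<close>)
  moreover have "at t within {0..t + 1} = at t within {0..}"
    by (rule at_within_nhd[where S = "{..<t + 1}"]) auto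
  ultimately show ?thesis by simp
qed

text \<open>This is where the exponential weight pays off: integrating the growth
  \<open>exp (c * u)\<close> reproduces it with a gain of \<open>1 / c\<close>.\<close>

lemma norm_integral_le_exp:
  fixes k :: "real \<Rightarrow> 'a::banach"
  assumes "continuous_on UNIV k" "c > 0" "0 \<le> s" "M \<ge> 0"
    and k: "\<And>u. 0 \<le> u \<Longrightarrow> norm (k u) \<le> M * exp (c * u)"
  shows "norm (integral {0..s} k) \<le> M / c * exp (c * s)"
proof -
  have int: "((\<lambda>u. M * exp (c * u)) has_integral (M / c * exp (c * s) - M / c * exp (c * 0))) {0..s}"
    by (rule fundamental_theorem_of_calculus)
      (use assms in \<open>auto intro!: derivative_eq_intros simp: has_real_derivative_iff_has_vector_derivative[symmetric]\<close>)
  have "norm (integral {0..s} k) \<le> integral {0..s} (\<lambda>u. M * exp (c * u))"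
  proof (rule integral_norm_bound_integral)
    show "k integrable_on {0..s}"
      using assms(1) by (intro integrable_continuous_real) (auto intro: continuous_on_subset)
  qed (use int k in auto)
  also have "\<dots> \<le> M / c * exp (c * s)"
    using integral_unique[OF int] assms by simp
  finally show ?thesis .
qed

text \<open>With the weight \<open>exp (-c t)\<close> and \<open>c > 2 L\<close> the integral operator is a contraction on the
  bounded continuous functions on the whole half line, so no continuation argument is needed.\<close>

lemma lipschitz_global_solution:
  fixes f :: "'a::banach \<Rightarrow> 'a"
  assumes lip: "L-lipschitz_on UNIV f"
  shows "\<exists>x. x 0 = x0 \<and> (\<forall>t\<ge>0. (x has_vector_derivative f (x t)) (at t within {0..}))"
proof -
  \<comment> \<open>The summand 1 keeps \<open>c\<close> positive for \<open>L = 0\<close>; the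
    ratio \<open>L / c\<close> is the contraction constant.\<close>
  define c where "c = 2 * L + 1"
  have L: "L \<ge> 0" using lip lipschitz_on_nonneg by blast
  then have c: "c > 0" "L / c \<le> 1 / 2" by (auto simp: c_def field_simps)
  \<comment> \<open>The unknown \<open>y\<close> stands for
    \<open>exp (- c * t) *\<^sub>R (x t - x0)\<close>, the weighted increment of the solution
    \<open>x\<close> that is sought.\<close>
  define h where "h y u = f (x0 + exp (c * u) *\<^sub>R apply_bcontfun y u)" for y u
  define I where "I y s = integral {0..s} (h y)" for y s
  \<comment> \<open>Bounded continuous functions live here on the whole line; clamping the time at 0
    extends the operator constantly to negative times.\<close>
  define T where "T y t = exp (- c * max 0 t) *\<^sub>R I y (max 0 t)" for y t
  have hcont: "continuous_on S (h y)" for y S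
    unfolding h_def
    by (rule continuous_on_compose2[OF lipschitz_on_continuous_on[OF lip]])
      (auto intro!: continuous_intros)
  have Ider: "(I y has_vector_derivative h y t) (at t within {0..})" if "0 \<le> t" for y t
    unfolding I_def using integral_has_vector_derivative_atLeast[OF hcont that] .
  have Icont: "continuous_on {0..} (I y)" for y
    by (meson Ider atLeast_iff continuous_on_eq_continuous_within has_vector_derivative_continuous)
  have m: "continuous_on UNIV (max 0 :: real \<Rightarrow> real)"
    by (intro continuous_on_max continuous_on_const continuous_on_id)
  have "continuous_on UNIV (\<lambda>t. I y (max 0 t))" for y
    by (rule continuous_on_compose2[OF Icont m]) auto
  then have Tcont: "continuous_on UNIV (T y)" for y
    unfolding T_def by (intro continuous_on_scaleR continuous_on_exp continuous_on_mult m continuous_on_const)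
  have weight: "norm (exp (- c * s) *\<^sub>R v) \<le> M / c"
    if "norm v \<le> M / c * exp (c * s)" for s v M
  proof -
    have "norm (exp (- c * s) *\<^sub>R v) \<le> exp (- c * s) * (M / c * exp (c * s))"
      using mult_left_mono[OF that, of "exp (- c * s)"] by simp
    then show ?thesis by (simp add: exp_minus field_simps)
  qed
  have hbound: "norm (h y u) \<le> (norm (f x0) + L * norm y) * exp (c * u)" if "0 \<le> u" for y u
  proof -
    have "norm (h y u - f x0) \<le> L * norm (exp (c * u) *\<^sub>R apply_bcontfun y u)"
      using lipschitz_on_normD[OF lip, of "x0 + exp (c * u) *\<^sub>R apply_bcontfun y u" x0]
      by (simp add: h_def)
    also have "\<dots> \<le> L * (exp (c * u) * norm y)"
      using L norm_bounded[of y u] by (auto intro!: mult_left_mono)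
    finally have "norm (h y u) \<le> norm (f x0) * 1 + L * norm y * exp (c * u)"
      using norm_triangle_sub[of "h y u" "f x0"] by (simp add: mult_ac)
    also have "\<dots> \<le> norm (f x0) * exp (c * u) + L * norm y * exp (c * u)"
      using that c by (intro add_right_mono mult_left_mono) auto
    finally show ?thesis by (simp add: algebra_simps)
  qed
  have Tb: "T y \<in> bcontfun" for y
  proof (rule bcontfun_normI[OF Tcont])
    show "norm (T y t) \<le> (norm (f x0) + L * norm y) / c" for t
      unfolding T_def I_def using L c hbound
      by (intro weight norm_integral_le_exp hcont) auto
  qed
  have "dist (Bcontfun (T y)) (Bcontfun (T z)) \<le> 1 / 2 * dist y z" for y z
  proof (rule dist_bound)
    fix t
    have le: "norm (h y u - h z u) \<le> (L * dist y z) * exp (c * u)" for u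
    proof -
      have "norm (h y u - h z u) \<le> L * norm (exp (c * u) *\<^sub>R (apply_bcontfun y u - apply_bcontfun z u))"
        using lipschitz_on_normD[OF lip, of "x0 + exp (c * u) *\<^sub>R apply_bcontfun y u" "x0 + exp (c * u) *\<^sub>R apply_bcontfun z u"]
        by (simp add: h_def scaleR_diff_right)
      also have "\<dots> \<le> L * (exp (c * u) * dist y z)"
        using L dist_bounded[of y u z] by (auto intro!: mult_left_mono simp: dist_norm)
      finally show ?thesis by (simp add: mult_ac)
    qed
    have "I y s - I z s = integral {0..s} (\<lambda>u. h y u - h z u)" for s
      unfolding I_def by (subst integral_diff) (auto intro!: integrable_continuous_real hcont)
    moreover have "norm (integral {0..max 0 t} (\<lambda>u. h y u - h z u)) \<le> L * dist y z / c * exp (c * max 0 t)"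
      using L c le by (intro norm_integral_le_exp continuous_on_diff hcont) auto
    ultimately have "norm (T y t - T z t) \<le> (L * dist y z) / c"
      unfolding T_def scaleR_diff_right[symmetric] by (intro weight) simp
    also have "\<dots> \<le> 1 / 2 * dist y z"
      using mult_right_mono[OF c(2), of "dist y z"] by simp
    finally show "dist (apply_bcontfun (Bcontfun (T y)) t) (apply_bcontfun (Bcontfun (T z)) t) \<le> 1 / 2 * dist y z"
      by (simp add: Bcontfun_inverse[OF Tb] dist_norm)
  qed
  then have "\<exists>!y. Bcontfun (T y) = y"
    by (intro banach_fix_type[where c = "1/2"]) auto
  then obtain y where "Bcontfun (T y) = y" by auto
  then have y: "apply_bcontfun y t = T y t" for t
    by (metis Bcontfun_inverse[OF Tb])
  \<comment> \<open>The weight cancels at the fixed point: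
    \<open>exp (c * t) *\<^sub>R apply_bcontfun y t\<close> equals \<open>I y t\<close>, so the
    integrand is the field along \<open>x0 + I y t\<close>.\<close>
  have x: "h y t = f (x0 + I y t)" if "0 \<le> t" for t
    using that unfolding h_def y T_def by (simp add: exp_minus)
  show ?thesis
    by (rule exI[of _ "\<lambda>t. x0 + I y t"])
      (auto simp: x[symmetric] I_def[of y 0] intro!: derivative_eq_intros Ider)
qed

section \<open>Gronwall estimates\<close>

lemma deriv_le_imp_le_exp:
  fixes v :: "real \<Rightarrow> real"
  assumes "0 \<le> T"
    and v: "\<And>t. 0 \<le> t \<Longrightarrow> t \<le> T \<Longrightarrow> (v has_vector_derivative v' t) (at t within {0..T})"
    and le: "\<And>t. 0 \<le> t \<Longrightarrow> t \<le> T \<Longrightarrow> v' t \<le> c * v t"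
  shows "v T \<le> exp (c * T) * v 0"
proof -
  \<comment> \<open>The mean value theorem is applied to \<open>exp (- c * t) * v t\<close>, whose
    derivative is nonpositive. The sign of \<open>c\<close> is free: a negative \<open>c\<close>
    later yields the decay of the critic.\<close>
  have "\<exists>t\<in>{0..T}. exp (- c * T) * v T - exp (- c * 0) * v 0
      = (T - 0) * (exp (- c * t) * (v' t - c * v t))"
    by (rule mvt_very_simple[OF assms(1)])
      (auto intro!: derivative_eq_intros v[unfolded has_vector_derivative_def]
         simp: algebra_simps fun_eq_iff)
  then obtain t where t: "0 \<le> t" "t \<le> T"
      "exp (- c * T) * v T - v 0 = T * (exp (- c * t) * (v' t - c * v t))"
    by auto
  have "T * (exp (- c * t) * (v' t - c * v t)) \<le> 0"
    using le[OF t(1,2)] \<open>0 \<le> T\<close> by (intro mult_nonneg_nonpos) auto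
  then have "exp (- c * T) * v T \<le> v 0" using t(3) by linarith
  then have "exp (c * T) * (exp (- c * T) * v T) \<le> exp (c * T) * v 0"
    by (intro mult_left_mono) auto
  then show ?thesis by (simp add: exp_minus field_simps)
qed

text \<open>The square is used because the norm is not differentiable at 0. The source is absorbed
  by \<open>2 * norm (u t) * e \<le> (norm (u t))\<^sup>2 + e\<^sup>2\<close>, which costs the 1 in
  \<open>2 * L + 1\<close>, and the constant \<open>e\<^sup>2\<close> is carried along as part of
  the unknown.\<close>

lemma gronwall_norm_sq:
  fixes u :: "real \<Rightarrow> 'a::real_inner"
  assumes "0 \<le> T" "0 \<le> L"
    and u: "\<And>t. 0 \<le> t \<Longrightarrow> t \<le> T \<Longrightarrow> (u has_vector_derivative u' t) (at t within {0..T})"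
    and le: "\<And>t. 0 \<le> t \<Longrightarrow> t \<le> T \<Longrightarrow> norm (u' t) \<le> L * norm (u t) + e"
  shows "(norm (u T))\<^sup>2 \<le> exp ((2 * L + 1) * T) * ((norm (u 0))\<^sup>2 + e\<^sup>2)"
proof -
  define c where "c = 2 * L + 1"
  have c: "c \<ge> 1" using assms by (simp add: c_def)
  have le': "2 * (u t \<bullet> u' t) \<le> c * ((norm (u t))\<^sup>2 + e\<^sup>2)" if "0 \<le> t" "t \<le> T" for t
  proof -
    have "u t \<bullet> u' t \<le> norm (u t) * (L * norm (u t) + e)"
      using le[OF that] norm_cauchy_schwarz[of "u t" "u' t"]
      by (meson mult_left_mono norm_ge_zero order_trans)
    moreover have "2 * (norm (u t) * e) \<le> (norm (u t))\<^sup>2 + e\<^sup>2"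
      using sum_squares_bound[of "norm (u t)" e] by simp
    moreover have "1 * e\<^sup>2 \<le> c * e\<^sup>2" using c by (intro mult_right_mono) auto
    ultimately show ?thesis by (simp add: c_def algebra_simps power2_eq_square)
  qed
  have "(norm (u T))\<^sup>2 + e\<^sup>2 \<le> exp (c * T) * ((norm (u 0))\<^sup>2 + e\<^sup>2)"
    by (rule deriv_le_imp_le_exp[where v' = "\<lambda>t. 2 * (u t \<bullet> u' t)", OF \<open>0 \<le> T\<close> _ le'])
      (auto simp: power2_norm_eq_inner has_vector_derivative_def inner_commute
         intro!: derivative_eq_intros u[unfolded has_vector_derivative_def])
  moreover have "0 \<le> e\<^sup>2" by simp
  ultimately show ?thesis unfolding c_def by linarith
qed

text \<open>The projection of each of the points \<open>x\<close> and \<open>y\<close> competes in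
  the minimisation for the other. This bounds the increment from above and from below by its linear
  part up to \<open>norm (y - x)\<close> squared; the lower bound also uses that the projection is
  nonexpansive.\<close>

lemma has_derivative_norm_sq_diff_closest_point:
  fixes C :: "'a::euclidean_space set"
  assumes C: "closed C" "convex C" "C \<noteq> {}"
  shows "((\<lambda>y. (norm (y - closest_point C y))\<^sup>2) has_derivative
    (\<lambda>h. 2 * ((x - closest_point C x) \<bullet> h))) (at x)"
  unfolding has_derivative_within_alt
proof (intro conjI allI impI)
  show "bounded_linear (\<lambda>h. 2 * ((x - closest_point C x) \<bullet> h))"
    by (intro bounded_linear_mult_right[THEN bounded_linear_compose] bounded_linear_inner_right)
  fix e :: real assume e: "0 < e"
  define P where "P = closest_point C"
  have le: "(norm (a - P a))\<^sup>2 \<le> (norm (a - P b))\<^sup>2" for a b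
    using closest_point_le[OF C(1) closest_point_in_set[OF C(1,3)], of a b]
    by (simp add: P_def dist_norm)
  have "\<bar>(norm (y - P y))\<^sup>2 - (norm (x - P x))\<^sup>2 - 2 * ((x - P x) \<bullet> (y - x))\<bar> \<le> (norm (y - x))\<^sup>2" for y
  proof -
    have "(P x - P y) \<bullet> (y - x) \<ge> - (norm (P x - P y) * norm (y - x))"
      using Cauchy_Schwarz_ineq2[of "P x - P y" "y - x"] by linarith
    moreover have "norm (P x - P y) * norm (y - x) \<le> norm (y - x) * norm (y - x)"
      using closest_point_lipschitz[OF C(2,1,3), of x y]
      by (intro mult_right_mono) (auto simp: P_def dist_norm norm_minus_commute)
    ultimately have "(P x - P y) \<bullet> (y - x) \<ge> - (norm (y - x))\<^sup>2" by (simp add: power2_eq_square)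
    then show ?thesis
      using le[of y x] le[of x y]
      unfolding power2_norm_eq_inner by (simp add: inner_diff algebra_simps inner_commute abs_le_iff)
  qed
  then show "\<exists>d>0. \<forall>y\<in>UNIV. norm (y - x) < d \<longrightarrow>
      norm ((norm (y - closest_point C y))\<^sup>2 - (norm (x - closest_point C x))\<^sup>2
        - 2 * ((x - closest_point C x) \<bullet> (y - x))) \<le> e * norm (y - x)"
    unfolding P_def real_norm_def power2_eq_square[of "norm (_ - x)"]
    by (intro exI[of _ e] conjI ballI impI e) (meson less_imp_le mult_right_mono norm_ge_zero order_trans)
qed

text \<open>The squared distance to a closed convex set is differentiable, and the subtangent condition
  makes it nonincreasing along the field precomposed with the projection.\<close>

lemma subtangent_invariant_solution:
  fixes C :: "'a::euclidean_space set"
  assumes C: "closed C" "convex C" and lip: "L-lipschitz_on C f"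
    and sub: "\<And>x. x \<in> C \<Longrightarrow> \<exists>h>0. x + h *\<^sub>R f x \<in> C"
    and x0: "x0 \<in> C"
  shows "\<exists>x. solution_in C f x \<and> x 0 = x0"
proof -
  define P where "P = closest_point C"
  have ne: "C \<noteq> {}" using x0 by auto
  have PC: "P a \<in> C" for a unfolding P_def using closest_point_in_set C ne by blast
  \<comment> \<open>The projection extends the field to a globally Lipschitz one that agrees with
    \<open>f\<close> on \<open>C\<close>, so a solution that stays in \<open>C\<close> solves the
    original equation.\<close>
  have "(L * 1)-lipschitz_on UNIV (f \<circ> P)"
  proof (rule lipschitz_on_compose)
    show "1-lipschitz_on UNIV P"
      unfolding P_def by (rule lipschitz_onI) (use closest_point_lipschitz C ne in auto)
    show "L-lipschitz_on (P ` UNIV) f" using lip by (rule lipschitz_on_subset) (use PC in auto)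
  qed
  from lipschitz_global_solution[OF this, of x0] obtain x where x0: "x 0 = x0"
    and x: "\<And>t. 0 \<le> t \<Longrightarrow> (x has_vector_derivative f (P (x t))) (at t within {0..})"
    by auto
  have xC: "x t \<in> C" if "0 \<le> t" for t
  proof -
    define v where "v s = (norm (x s - P (x s)))\<^sup>2" for s
    have "v t \<le> exp (0 * t) * v 0"
    proof (rule deriv_le_imp_le_exp[OF that, where v' = "\<lambda>s. 2 * ((x s - P (x s)) \<bullet> f (P (x s)))"])
      fix s assume s: "0 \<le> s" "s \<le> t"
      have "(x has_vector_derivative f (P (x s))) (at s within {0..t})"
        using x[OF s(1)] by (rule has_vector_derivative_within_subset) auto
      then show "(v has_vector_derivative 2 * ((x s - P (x s)) \<bullet> f (P (x s)))) (at s within {0..t})"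
        unfolding v_def P_def has_vector_derivative_def
        by (rule has_derivative_eq_rhs[OF has_derivative_compose[OF _
              has_derivative_norm_sq_diff_closest_point[OF C ne]]]) (auto simp: fun_eq_iff)
      obtain h where h: "h > 0" "P (x s) + h *\<^sub>R f (P (x s)) \<in> C" using sub PC by blast
      \<comment> \<open>\<open>x s - P (x s)\<close> is an outer normal of \<open>C\<close> at the
        projected point, and the Euler step from that point lands in \<open>C\<close>.\<close>
      have "h * ((x s - P (x s)) \<bullet> f (P (x s))) \<le> 0"
        using closest_point_dot[OF C(2,1) h(2), of "x s"] by (simp add: P_def)
      then show "2 * ((x s - P (x s)) \<bullet> f (P (x s))) \<le> 0 * v s"
        using h by (simp add: mult_le_0_iff)
    qed
    also have "\<dots> = 0" using \<open>x0 \<in> C\<close> x0 C ne by (simp add: v_def P_def closest_point_self)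
    finally have "x t = P (x t)" by (simp add: v_def)
    then show ?thesis using PC by metis
  qed
  moreover have "P (x t) = x t" if "0 \<le> t" for t
    using xC[OF that] by (simp add: P_def closest_point_self)
  ultimately show ?thesis
    using x x0 unfolding solution_in_def by (intro exI[of _ x]) auto
qed

section \<open>Global attractors of dissipative fields\<close>

lemma tendsto_0_if_le_ennreal:
  fixes g :: "'a \<Rightarrow> ennreal"
  assumes "\<And>e. e > 0 \<Longrightarrow> \<forall>\<^sub>F t in A. g t \<le> ennreal e"
  shows "(g \<longlongrightarrow> 0) A"
proof (rule order_tendstoI)
  fix a :: ennreal assume "0 < a"
  then obtain b where b: "0 < b" "b < a" using dense by blast
  then have "b \<noteq> top" by auto
  then obtain e where e: "b = ennreal e" "e > 0"
    using b by (cases b) auto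
  show "\<forall>\<^sub>F t in A. g t < a"
    using assms[OF e(2)] by eventually_elim (use b e in auto)
qed simp

section \<open>Attractors of semiflows with a compact absorbing set\<close>

locale absorbing_semiflow =
  fixes X K :: "'a::heine_borel set" and F :: "real \<Rightarrow> 'a \<Rightarrow> 'a"
  assumes K: "compact K" "K \<noteq> {}" "K \<subseteq> X"
    and semigroup: "\<And>s t x. 0 \<le> s \<Longrightarrow> 0 \<le> t \<Longrightarrow> x \<in> X \<Longrightarrow> F (s + t) x = F s (F t x)"
    and cont: "\<And>t. 0 \<le> t \<Longrightarrow> continuous_on K (F t)"
    and invariant: "\<And>t. 0 \<le> t \<Longrightarrow> F t ` K \<subseteq> K"
    and absorbing: "\<And>B. bounded B \<Longrightarrow> B \<subseteq> X \<Longrightarrow> \<exists>T\<ge>0. \<forall>t\<ge>T. F t ` B \<subseteq> K"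
begin

lemma image_antimono:
  assumes "0 \<le> s" "s \<le> t"
  shows "F t ` K \<subseteq> F s ` K"
proof -
  have "F t x = F s (F (t - s) x)" if "x \<in> K" for x
    using semigroup[of s "t - s" x] assms that K by auto
  then show ?thesis using invariant[of "t - s"] assms by auto
qed

lemma compact_image: "0 \<le> t \<Longrightarrow> compact (F t ` K)"
  using cont K compact_continuous_image by blast

text \<open>The images of the invariant set \<open>K\<close> decrease in time and are compact, so
  neither the union over later times nor the closure adds a point.\<close>

lemma omega_limit_eq: "omega_limit F K = (\<Inter>t\<in>{0..}. F t ` K)"
proof -
  have "closure (\<Union>t\<in>{s..}. F t ` K) = F s ` K" if "0 \<le> s" for s
  proof -
    have "(\<Union>t\<in>{s..}. F t ` K) = F s ` K"
    proof
      show "(\<Union>t\<in>{s..}. F t ` K) \<subseteq> F s ` K" using image_antimono[OF that] by blast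
    qed auto
    then show ?thesis using compact_image[OF that] by (simp add: compact_imp_closed)
  qed
  then show ?thesis unfolding omega_limit_def by auto
qed

lemma nested_compacts_nonempty:
  assumes "\<And>t. 0 \<le> t \<Longrightarrow> compact (G t)" "\<And>t. 0 \<le> t \<Longrightarrow> G t \<noteq> {}"
    and "\<And>s t. 0 \<le> s \<Longrightarrow> s \<le> t \<Longrightarrow> G t \<subseteq> G s"
  shows "(\<Inter>t\<in>{0::real..}. G t :: 'a set) \<noteq> {}"
proof -
  \<comment> \<open>Clamping the index at 0 makes the family one over all reals and keeps it
    decreasing.\<close>
  have "\<Inter>(range (\<lambda>t. G (max 0 t))) \<noteq> {}"

  proof (rule compact_nest)
    show "G (max 0 t) \<subseteq> G (max 0 s)" if "s \<le> t" for s t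
      using that by (intro assms(3)) auto
  qed (use assms(1,2) in auto)
  moreover have "\<Inter>(range (\<lambda>t. G (max 0 t))) \<subseteq> (\<Inter>t\<in>{0..}. G t)"
    by (auto simp: max_def split: if_splits)
  ultimately show ?thesis by auto
qed

lemma omega_limit_nonempty: "omega_limit F K \<noteq> {}"
  unfolding omega_limit_eq
  by (rule nested_compacts_nonempty) (use compact_image K image_antimono in auto)

lemma omega_limit_subset: "omega_limit F K \<subseteq> K"
  unfolding omega_limit_eq using invariant[of 0] by fastforce

lemma compact_omega_limit: "compact (omega_limit F K)"
  unfolding omega_limit_eq by (rule compact_Inter) (auto intro: compact_image)

lemma omega_limit_invariant:
  assumes t: "0 \<le> t"
  shows "F t ` omega_limit F K = omega_limit F K"
proof
  show "F t ` omega_limit F K \<subseteq> omega_limit F K"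
    unfolding omega_limit_eq
  proof clarify
    fix x s assume x: "x \<in> (\<Inter>t\<in>{0..}. F t ` K)" and s: "0 \<le> (s::real)"
    from x s obtain y where y: "y \<in> K" "x = F s y" by auto
    have "F t x = F s (F t y)"
      using semigroup[of t s y] semigroup[of s t y] y s t K by (auto simp: add.commute)
    then show "F t x \<in> F s ` K" using y invariant[OF t] by auto
  qed
  show "omega_limit F K \<subseteq> F t ` omega_limit F K"
  proof
    fix y assume y: "y \<in> omega_limit F K"
    have cl: "closed (F s ` K \<inter> F t -` {y})" if "0 \<le> s" for s
      using that image_antimono[of 0 s] invariant[of 0]
      by (intro continuous_closed_preimage compact_imp_closed compact_image
          continuous_on_subset[OF cont[OF t]]) auto
    \<comment> \<open>A preimage of \<open>y\<close> inside the omega limit set is a common point of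
      these nested compact sets; each is nonempty because \<open>y\<close> also lies in the image of
      \<open>K\<close> at time \<open>t + s\<close>.\<close>
    have "(\<Inter>s\<in>{0..}. F s ` K \<inter> F t -` {y}) \<noteq> {}"
    proof (rule nested_compacts_nonempty)
      fix s :: real assume s: "0 \<le> s"
      have "compact (F s ` K \<inter> (F s ` K \<inter> F t -` {y}))"
        by (rule compact_Int_closed[OF compact_image[OF s] cl[OF s]])
      then show "compact (F s ` K \<inter> F t -` {y})" by (simp add: Int_assoc[symmetric])
      have "y \<in> F (t + s) ` K" using y s t unfolding omega_limit_eq by auto
      then obtain z where "z \<in> K" "y = F t (F s z)"
        using semigroup[OF t s] K by auto
      then show "F s ` K \<inter> F t -` {y} \<noteq> {}" by auto
    qed (use image_antimono in blast)
    then show "y \<in> F t ` omega_limit F K" unfolding omega_limit_eq by blast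
  qed
qed

text \<open>If no image of \<open>K\<close> entered the open \<open>e\<close>-neighbourhood of the
  omega limit set, the parts outside it would be nonempty nested compact sets, and a common point
  would be a point of the omega limit set outside its own neighbourhood.\<close>

lemma omega_limit_attracts:
  assumes e: "e > 0"
  shows "\<exists>T\<ge>0. \<forall>t\<ge>T. \<forall>x\<in>K. \<exists>y\<in>omega_limit F K. dist (F t x) y < e"
proof -
  define U where "U = (\<Union>y\<in>omega_limit F K. ball y e)"
  have "\<exists>T\<ge>0. F T ` K \<subseteq> U"
  proof (rule ccontr)
    assume "\<not> ?thesis"
    moreover have "F t ` K - U \<subseteq> F s ` K - U" if "0 \<le> s" "s \<le> t" for s t
      using image_antimono[OF that] by blast
    ultimately have "(\<Inter>t\<in>{0..}. F t ` K - U) \<noteq> {}"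
      by (intro nested_compacts_nonempty compact_diff compact_image) (auto simp: U_def)
    moreover have "omega_limit F K \<subseteq> U" using e by (auto simp: U_def)
    ultimately show False unfolding omega_limit_eq by blast
  qed
  then obtain T where T: "T \<ge> 0" "F T ` K \<subseteq> U" by blast
  have "F t ` K \<subseteq> U" if "t \<ge> T" for t using image_antimono[OF T(1) that] T by auto
  then show ?thesis using T(1)
    by (intro exI[of _ T]) (force simp: U_def dist_commute image_subset_iff)
qed

text \<open>The attractor is defined through \<open>d\<close>, whereas the preceding facts concern
  the ambient metric. The domination of \<open>d\<close> by \<open>dist\<close> transfers
  compactness and attraction; the last assumption turns sets bounded for \<open>d\<close> into sets
  that \<open>K\<close> absorbs.\<close>

lemma compact_global_attractor_omega_limit:
  assumes d: "Metric_space X d" and dle: "\<And>x y. x \<in> X \<Longrightarrow> y \<in> X \<Longrightarrow> d x y \<le> c * dist x y"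
    and bd: "\<And>B. Metric_space.mbounded X d B \<Longrightarrow> bounded B"
  shows "compact_global_attractor X d F (omega_limit F K)"
proof -
  interpret M: Metric_space X d by fact
  \<comment> \<open>The maximum makes the factor positive, so that radii can be divided by
    it.\<close>
  define C where "C = max c 1"
  have C: "C > 0" "\<And>x y. x \<in> X \<Longrightarrow> y \<in> X \<Longrightarrow> d x y \<le> C * dist x y"
    using order_trans[OF dle mult_right_mono[of c C]] by (auto simp: C_def)
  have AX: "omega_limit F K \<subseteq> X" using omega_limit_subset K by auto
  have comp: "compactin M.mtopology (omega_limit F K)"
  proof -
    have "openin (top_of_set X) {x \<in> X. x \<in> U}" if U: "openin M.mtopology U" for U
      unfolding openin_euclidean_subtopology_iff
    proof (intro conjI ballI)
      fix x assume x: "x \<in> {x \<in> X. x \<in> U}"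
      obtain r where r: "r > 0" "M.mball x r \<subseteq> U" using U x unfolding M.openin_mtopology by auto
      show "\<exists>e>0. \<forall>x'\<in>X. dist x' x < e \<longrightarrow> x' \<in> {x \<in> X. x \<in> U}"
      proof (intro exI[of _ "r / C"] conjI ballI impI)
        show "0 < r / C" using r C by simp
        fix x' assume x': "x' \<in> X" "dist x' x < r / C"
        then have "d x x' < r"
          using C(2)[of x x'] x C(1) by (simp add: field_simps dist_commute)
        then show "x' \<in> {x \<in> X. x \<in> U}" using x x' r by (auto simp: M.in_mball)
      qed
    qed auto
    then have "continuous_map (top_of_set X) M.mtopology (\<lambda>x. x)"
      by (auto simp: continuous_map_def)
    moreover have "compactin (top_of_set X) (omega_limit F K)"
      using compact_omega_limit AX by (simp add: compactin_subtopology)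
    ultimately show ?thesis using image_compactin by fastforce
  qed
  have att: "((\<lambda>t. semidist d (F t ` B) (omega_limit F K)) \<longlongrightarrow> 0) at_top"
    if B: "M.mbounded B" for B
  proof (rule tendsto_0_if_le_ennreal)
    fix e :: real assume e: "e > 0"
    have BX: "B \<subseteq> X" using B M.mbounded_subset_mspace by blast
    obtain T where T: "T \<ge> 0" "F T ` B \<subseteq> K" using absorbing[OF bd[OF B] BX] by auto
    obtain T' where T': "T' \<ge> 0" "\<forall>t\<ge>T'. \<forall>x\<in>K. \<exists>y\<in>omega_limit F K. dist (F t x) y < e / C"
      using omega_limit_attracts[of "e / C"] e C by auto
    have "semidist d (F t ` B) (omega_limit F K) \<le> ennreal e" if t: "t \<ge> T' + T" for t
      unfolding semidist_def
    proof (rule SUP_least)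
      fix z assume "z \<in> F t ` B"
      then obtain x where x: "x \<in> B" "z = F t x" by auto
      then have z: "z = F (t - T) (F T x)" "F T x \<in> K"
        using semigroup[of "t - T" T x] T T' t BX by auto
      then obtain y where y: "y \<in> omega_limit F K" "dist z y < e / C" using T'(2)[rule_format, of "t - T" "F T x"] t by auto
      have "z \<in> X" using z invariant[of "t - T"] t T' K by auto
      then have "d z y \<le> C * dist z y" using C y AX by auto
      then have "d z y \<le> e" using y(2) C(1) by (simp add: field_simps)
      then show "(INF y\<in>omega_limit F K. ennreal (d z y)) \<le> ennreal e"
        using y(1) by (intro INF_lower2) (auto intro: ennreal_leI)
    qed
    then show "\<forall>\<^sub>F t in at_top. semidist d (F t ` B) (omega_limit F K) \<le> ennreal e"
      unfolding eventually_at_top_linorder by blast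
  qed
  show ?thesis
    unfolding compact_global_attractor_def
    using omega_limit_nonempty comp omega_limit_invariant att by auto
qed

end

text \<open>\<open>V\<close> extracts the unbounded component, here the critic weight, so that
  bounding \<open>norm (V x)\<close> cuts out a compact set. The strict inequality
  \<open>B / lam < R0\<close> makes the field point strictly inward along \<open>V\<close> on the
  boundary of every such set of radius at least \<open>R0\<close>, and it lets bounded sets reach
  radius \<open>R0\<close> in finite time.\<close>

locale dissipative_field =
  fixes X :: "'a::euclidean_space set" and f :: "'a \<Rightarrow> 'a" and V :: "'a \<Rightarrow> 'b::real_inner"
    and B lam R0 :: real
  assumes closed_X: "closed X" and convex_X: "convex X" and V: "bounded_linear V"
    and bounded_slice: "\<And>R. bounded {x \<in> X. norm (V x) \<le> R}"
    and lip: "\<And>R. \<exists>L. L-lipschitz_on {x \<in> X. norm (V x) \<le> R} f"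
    and subtangent: "\<And>x. x \<in> X \<Longrightarrow> \<exists>h>0. x + h *\<^sub>R f x \<in> X"
    and dissipative: "\<And>x. x \<in> X \<Longrightarrow> V x \<bullet> V (f x) \<le> B * norm (V x) - lam * (norm (V x))\<^sup>2"
    and lam: "lam > 0" and B: "B \<ge> 0" and R0: "B / lam < R0"
    and nonempty: "{x \<in> X. norm (V x) \<le> R0} \<noteq> {}"
begin

definition slice :: "real \<Rightarrow> 'a set" where
  "slice R = {x \<in> X. norm (V x) \<le> R}"

lemma R0_pos: "0 < R0"
  using R0 B lam by (meson divide_nonneg_pos le_less_trans)

lemma continuous_V: "continuous_on S V"
  using V linear_continuous_on by blast

lemma slice_eq: "slice R = X \<inter> V -` cball 0 R"
  by (auto simp: slice_def)

lemma closed_slice: "closed (slice R)"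
  unfolding slice_eq
  using closed_X continuous_closed_preimage[OF continuous_V closed_X closed_cball] by blast

lemma compact_slice: "compact (slice R)"
  using closed_slice bounded_slice by (simp add: compact_eq_bounded_closed slice_def)

lemma convex_slice: "convex (slice R)"
  unfolding slice_eq
  by (intro convex_Int convex_X convex_linear_vimage convex_cball bounded_linear.linear[OF V])

lemma solution_slice_bound:
  assumes x: "solution_in X f x" and "0 \<le> T"
  shows "(norm (V (x T)))\<^sup>2
    \<le> exp (- lam * T) * (norm (V (x 0)))\<^sup>2 + (1 - exp (- lam * T)) * (B / lam)\<^sup>2"
proof -
  have "(norm (V (x T)))\<^sup>2 - (B / lam)\<^sup>2 \<le> exp (- lam * T) * ((norm (V (x 0)))\<^sup>2 - (B / lam)\<^sup>2)"
  proof (rule deriv_le_imp_le_exp[OF \<open>0 \<le> T\<close>, where v' = "\<lambda>t. 2 * (V (x t) \<bullet> V (f (x t)))"])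
    fix t assume t: "0 \<le> t" "t \<le> T"
    have "(x has_vector_derivative f (x t)) (at t within {0..T})"
      using x t unfolding solution_in_def by (meson Icc_subset_Ici_iff has_vector_derivative_within_subset order_refl)
    then have "((\<lambda>t. V (x t)) has_vector_derivative V (f (x t))) (at t within {0..T})"
      by (rule bounded_linear.has_vector_derivative[OF V])
    then show "((\<lambda>t. (norm (V (x t)))\<^sup>2 - (B / lam)\<^sup>2) has_vector_derivative
        2 * (V (x t) \<bullet> V (f (x t)))) (at t within {0..T})"
      by (auto simp: power2_norm_eq_inner has_vector_derivative_def inner_commute
        intro!: derivative_eq_intros)
    define n where "n = norm (V (x t))"
    \<comment> \<open>Completing the square spends half of the damping on the linear term:
      \<open>2 * B * n \<le> lam * n\<^sup>2 + B\<^sup>2 / lam\<close>.\<close>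
    have "0 \<le> (lam * n - B)\<^sup>2 / lam" using lam by simp
    also have "(lam * n - B)\<^sup>2 / lam = lam * n\<^sup>2 - 2 * (B * n) + lam * (B / lam)\<^sup>2"
      using lam by (simp add: power2_eq_square field_simps)
    finally show "2 * (V (x t) \<bullet> V (f (x t))) \<le> - lam * ((norm (V (x t)))\<^sup>2 - (B / lam)\<^sup>2)"
      using dissipative[of "x t"] x t unfolding solution_in_def n_def by (force simp: algebra_simps)
  qed
  then show ?thesis by (simp add: algebra_simps)
qed

lemma solution_in_slice:
  assumes x: "solution_in X f x" and "R0 \<le> R" "x 0 \<in> slice R" "0 \<le> t"
  shows "x t \<in> slice R"
proof -
  define e where "e = exp (- lam * t)"
  have e: "0 \<le> e" "e \<le> 1" using lam \<open>0 \<le> t\<close> by (auto simp: e_def)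
  have R: "R > 0" using R0_pos assms by simp
  have "(norm (V (x t)))\<^sup>2 \<le> e * (norm (V (x 0)))\<^sup>2 + (1 - e) * (B / lam)\<^sup>2"
    using solution_slice_bound[OF x \<open>0 \<le> t\<close>] unfolding e_def .
  also have "\<dots> \<le> e * R\<^sup>2 + (1 - e) * R\<^sup>2"
    using assms R0 B lam e by (intro add_mono mult_left_mono power_mono) (auto simp: slice_def)
  finally have "(norm (V (x t)))\<^sup>2 \<le> R\<^sup>2" by (simp add: algebra_simps)
  then show ?thesis
    using R x \<open>0 \<le> t\<close> by (simp add: slice_def solution_in_def power2_le_iff_abs_le)
qed

text \<open>Existence is obtained on slices, because there the field is Lipschitz. Inside the ball
  every short step is harmless. On its boundary \<open>V x \<bullet> V (f x)\<close> is strictly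
  negative, and this first order gain in \<open>h\<close> beats the second order term.\<close>

lemma subtangent_slice:
  assumes "R0 \<le> R" and x: "x \<in> slice R"
  shows "\<exists>h>0. x + h *\<^sub>R f x \<in> slice R"
proof -
  have xX: "x \<in> X" and xR: "norm (V x) \<le> R" using x by (auto simp: slice_def)
  obtain h0 where h0: "h0 > 0" "x + h0 *\<^sub>R f x \<in> X" using subtangent[OF xX] by auto
  have R: "R > 0" "B < lam * R"
    using R0_pos R0 assms lam by (auto simp: field_simps intro: less_le_trans mult_right_mono)
  have XI: "x + h *\<^sub>R f x \<in> X" if "0 < h" "h \<le> h0" for h
  proof -
    have "(1 - h / h0) *\<^sub>R x + (h / h0) *\<^sub>R (x + h0 *\<^sub>R f x) \<in> X"
      using that h0 xX by (intro convexD_alt[OF convex_X]) auto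
    then show ?thesis using h0 by (simp add: algebra_simps)
  qed
  define W where "W = V (f x)"
  have VR: "V (x + h *\<^sub>R f x) = V x + h *\<^sub>R W" for h
    using bounded_linear.linear[OF V] by (simp add: W_def linear_add linear_scale)
  have "\<exists>h1>0. \<forall>h. 0 < h \<and> h \<le> h1 \<longrightarrow> norm (V x + h *\<^sub>R W) \<le> R"
  proof (cases "norm (V x) < R")
    case True
    have "norm (V x + h *\<^sub>R W) \<le> R" if "0 < h" "h \<le> (R - norm (V x)) / (norm W + 1)" for h
    proof -
      have "h * norm W \<le> h * (norm W + 1)" using that by simp
      also have "\<dots> \<le> R - norm (V x)"
        using that by (simp add: pos_le_divide_eq add_nonneg_pos)
      finally show ?thesis using norm_triangle_ineq[of "V x" "h *\<^sub>R W"] that by simp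
    qed
    then show ?thesis using True
      by (intro exI[of _ "(R - norm (V x)) / (norm W + 1)"]) (auto intro!: divide_pos_pos add_nonneg_pos)
  next
    case False
    then have eq: "norm (V x) = R" using xR by simp
    define q where "q = - (V x \<bullet> W)"
    have "q \<ge> R * (lam * R - B)"
      using dissipative[OF xX] eq by (simp add: q_def W_def algebra_simps power2_eq_square)
    then have q: "q > 0" using R by (smt (verit) mult_pos_pos)
    have "norm (V x + h *\<^sub>R W) \<le> R" if "0 < h" "h \<le> q / ((norm W)\<^sup>2 + 1)" for h
    proof -
      have "h * (norm W)\<^sup>2 \<le> h * ((norm W)\<^sup>2 + 1)" using that by simp
      also have "\<dots> \<le> q" using that by (simp add: pos_le_divide_eq add_nonneg_pos)
      finally have "h * (h * (norm W)\<^sup>2) \<le> h * (2 * q)" using that q by (intro mult_left_mono) auto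
      moreover have "(norm (V x + h *\<^sub>R W))\<^sup>2 = R\<^sup>2 - h * (2 * q) + h * (h * (norm W)\<^sup>2)"
        unfolding eq[symmetric] power2_norm_eq_inner q_def
        by (simp add: inner_add inner_commute algebra_simps)
      ultimately have "(norm (V x + h *\<^sub>R W))\<^sup>2 \<le> R\<^sup>2" by linarith
      then show ?thesis using R by (simp add: power2_le_iff_abs_le)
    qed
    then show ?thesis using q
      by (intro exI[of _ "q / ((norm W)\<^sup>2 + 1)"]) (auto intro!: divide_pos_pos add_nonneg_pos)
  qed
  then obtain h1 where "h1 > 0" "\<And>h. 0 < h \<Longrightarrow> h \<le> h1 \<Longrightarrow> norm (V x + h *\<^sub>R W) \<le> R" by blast
  then show ?thesis using h0 XI
    by (intro exI[of _ "min h0 h1"]) (auto simp: slice_def VR)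
qed

lemma solution_exists:
  assumes "x0 \<in> X"
  shows "\<exists>x. solution_in X f x \<and> x 0 = x0"
proof -
  \<comment> \<open>The slice has to contain the initial value, and it needs radius at least
    \<open>R0\<close> for the field to point inward.\<close>
  define R where "R = max R0 (norm (V x0))"
  obtain L where "L-lipschitz_on (slice R) f" using lip by (auto simp: slice_def)
  moreover have "x0 \<in> slice R" "R0 \<le> R" using assms by (auto simp: R_def slice_def)
  ultimately obtain x where "solution_in (slice R) f x" "x 0 = x0"
    using subtangent_invariant_solution[OF closed_slice convex_slice _ subtangent_slice] by blast
  then show ?thesis unfolding solution_in_def slice_def by blast
qed

text \<open>A common invariant slice supplies one Lipschitz constant along both trajectories. This
  gives uniqueness as well as continuity in the initial value.\<close>

lemma solutions_dist_bound:
  assumes x: "solution_in X f x" and y: "solution_in X f y"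
    and R: "R0 \<le> R" "x 0 \<in> slice R" "y 0 \<in> slice R" and L: "L-lipschitz_on (slice R) f"
    and t: "0 \<le> t"
  shows "(dist (x t) (y t))\<^sup>2 \<le> exp ((2 * L + 1) * t) * (dist (x 0) (y 0))\<^sup>2"
proof -
  have "(norm (x t - y t))\<^sup>2 \<le> exp ((2 * L + 1) * t) * ((norm (x 0 - y 0))\<^sup>2 + 0\<^sup>2)"
  proof (rule gronwall_norm_sq[OF t lipschitz_on_nonneg[OF L]])
    fix s assume s: "0 \<le> s" "s \<le> t"
    show "((\<lambda>s. x s - y s) has_vector_derivative f (x s) - f (y s)) (at s within {0..t})"
      using x y s unfolding solution_in_def
      by (intro has_vector_derivative_diff)
        (meson Icc_subset_Ici_iff has_vector_derivative_within_subset order_refl)+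
    show "norm (f (x s) - f (y s)) \<le> L * norm (x s - y s) + 0"
      using lipschitz_on_normD[OF L] solution_in_slice[OF x R(1,2) s(1)]
        solution_in_slice[OF y R(1,3) s(1)] by simp
  qed
  then show ?thesis by (simp add: dist_norm)
qed

lemma solution_unique:
  assumes "solution_in X f x" "solution_in X f y" "x 0 = y 0" "0 \<le> t"
  shows "x t = y t"
proof -
  define R where "R = max R0 (norm (V (x 0)))"
  obtain L where "L-lipschitz_on (slice R) f" using lip by (auto simp: slice_def)
  moreover have "x 0 \<in> slice R" using assms(1) by (simp add: slice_def R_def solution_in_def)
  ultimately show ?thesis
    using solutions_dist_bound[OF assms(1,2), of R L t] assms(3,4) by (simp add: R_def)
qed

lemma semiflow_of_solution:
  assumes "solution_in X f x" "0 \<le> t"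
  shows "semiflow_of X f t (x 0) = x t"
  unfolding semiflow_of_def
proof (rule the_equality)
  show "\<exists>y. solution_in X f y \<and> y 0 = x 0 \<and> y t = x t" using assms by blast
qed (use solution_unique assms in blast)

lemma solution_semiflow_of:
  assumes "x0 \<in> X"
  shows "solution_in X f (\<lambda>t. semiflow_of X f t x0)" "semiflow_of X f 0 x0 = x0"
proof -
  obtain x where x: "solution_in X f x" "x 0 = x0" using solution_exists assms by blast
  have eq: "semiflow_of X f t x0 = x t" if "0 \<le> t" for t
    using semiflow_of_solution[OF x(1) that] x(2) by simp
  show "semiflow_of X f 0 x0 = x0" using eq x by simp
  show "solution_in X f (\<lambda>t. semiflow_of X f t x0)"
    unfolding solution_in_def
  proof (intro allI impI conjI)
    fix t :: real assume t: "0 \<le> t"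
    show "semiflow_of X f t x0 \<in> X" using eq t x by (simp add: solution_in_def)
    have "(x has_vector_derivative f (x t)) (at t within {0..})"
      using x t by (simp add: solution_in_def)
    then show "((\<lambda>t. semiflow_of X f t x0) has_vector_derivative f (semiflow_of X f t x0)) (at t within {0..})"
      unfolding eq[OF t] by (rule has_vector_derivative_transform[rotated 2]) (use eq t in auto)
  qed
qed

lemma semiflow_of_slice:
  assumes "R0 \<le> R" "x \<in> slice R" "0 \<le> t"
  shows "semiflow_of X f t x \<in> slice R"
proof -
  have "x \<in> X" using assms by (simp add: slice_def)
  from solution_in_slice[OF solution_semiflow_of(1)[OF this] assms(1) _ assms(3)]
  show ?thesis using solution_semiflow_of(2)[OF \<open>x \<in> X\<close>] assms by simp
qed

lemma semiflow_of_add: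
  assumes "0 \<le> s" "0 \<le> t" "x \<in> X"
  shows "semiflow_of X f (s + t) x = semiflow_of X f s (semiflow_of X f t x)"
proof -
  let ?x = "\<lambda>t. semiflow_of X f t x"
  have sol: "solution_in X f ?x" by (rule solution_semiflow_of[OF assms(3)])
  \<comment> \<open>The equation is autonomous, so the shifted trajectory is the solution from its
    new initial value, and uniqueness identifies it with the semiflow.\<close>
  have "solution_in X f (\<lambda>s. ?x (s + t))"
    unfolding solution_in_def
  proof (intro allI impI conjI)
    fix u :: real assume u: "0 \<le> u"
    show "?x (u + t) \<in> X" using sol u assms by (simp add: solution_in_def)
    have "(?x has_vector_derivative f (?x (u + t))) (at (u + t) within (\<lambda>u. u + t) ` {0..})"
      using sol[unfolded solution_in_def, rule_format, of "u + t"] u assms(2)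
      by (auto intro: has_vector_derivative_within_subset)
    then have "(?x \<circ> (\<lambda>u. u + t) has_vector_derivative 1 *\<^sub>R f (?x (u + t))) (at u within {0..})"
      by (intro vector_diff_chain_within) (auto intro!: derivative_eq_intros)
    then show "((\<lambda>s. ?x (s + t)) has_vector_derivative f (?x (u + t))) (at u within {0..})"
      by (simp add: o_def)
  qed
  from semiflow_of_solution[OF this assms(1)] show ?thesis by simp
qed

lemma continuous_on_semiflow_of:
  assumes R: "R0 \<le> R" and t: "0 \<le> t"
  shows "continuous_on (slice R) (semiflow_of X f t)"
proof -
  obtain L where L: "L-lipschitz_on (slice R) f" using lip by (auto simp: slice_def)
  have "(exp ((2 * L + 1) * t / 2))-lipschitz_on (slice R) (semiflow_of X f t)"
  proof (rule lipschitz_onI)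
    fix x y assume xy: "x \<in> slice R" "y \<in> slice R"
    then have X: "x \<in> X" "y \<in> X" by (auto simp: slice_def)
    have "(dist (semiflow_of X f t x) (semiflow_of X f t y))\<^sup>2 \<le> exp ((2 * L + 1) * t) * (dist x y)\<^sup>2"
      using solutions_dist_bound[OF solution_semiflow_of(1)[OF X(1)] solution_semiflow_of(1)[OF X(2)] R _ _ L t]
        solution_semiflow_of(2)[OF X(1)] solution_semiflow_of(2)[OF X(2)] xy by simp
    also have "\<dots> = (exp ((2 * L + 1) * t / 2) * dist x y)\<^sup>2"
      by (simp add: power_mult_distrib exp_double[symmetric])
    finally show "dist (semiflow_of X f t x) (semiflow_of X f t y) \<le> exp ((2 * L + 1) * t / 2) * dist x y"
      by (rule power2_le_imp_le) simp
  qed simp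
  then show ?thesis by (rule lipschitz_on_continuous_on)
qed

lemma semiflow_of_absorbing:
  assumes "bounded S" "S \<subseteq> X"
  shows "\<exists>T\<ge>0. \<forall>t\<ge>T. semiflow_of X f t ` S \<subseteq> slice R0"
proof -
  have "bounded (V ` S)" using bounded_linear_image[OF assms(1) V] .
  then obtain r where r: "r > 0" "\<And>x. x \<in> S \<Longrightarrow> norm (V x) \<le> r"
    unfolding bounded_pos by auto
  have "(B / lam)\<^sup>2 < R0\<^sup>2" using R0 B lam by (intro power_strict_mono) auto
  \<comment> \<open>Once the exponential factor is at most \<open>g\<close>, the remaining share of
    the initial value, at most \<open>g * r\<^sup>2\<close>, fits into the gap between
    \<open>(B / lam)\<^sup>2\<close> and \<open>R0\<^sup>2\<close>. The time \<open>T\<close> solves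
    \<open>exp (- lam * T) = g\<close>, clamped at 0.\<close>
  define g where "g = (R0\<^sup>2 - (B / lam)\<^sup>2) / r\<^sup>2"
  have g: "g > 0" using \<open>(B / lam)\<^sup>2 < R0\<^sup>2\<close> r by (simp add: g_def)
  define T where "T = max 0 (- ln g / lam)"
  have "semiflow_of X f t x \<in> slice R0" if "t \<ge> T" "x \<in> S" for t x
  proof -
    have t: "0 \<le> t" "- ln g / lam \<le> t" using that by (auto simp: T_def)
    have xX: "x \<in> X" using that assms by auto
    have "- lam * t \<le> ln g" using t lam by (simp add: field_simps)
    then have "exp (- lam * t) \<le> g" using g by (simp add: ln_ge_iff)
    then have "exp (- lam * t) * (norm (V x))\<^sup>2 \<le> g * r\<^sup>2"
      using r(2)[OF that(2)] g by (intro mult_mono power_mono) auto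
    also have "\<dots> = R0\<^sup>2 - (B / lam)\<^sup>2" using r by (simp add: g_def)
    finally have "exp (- lam * t) * (norm (V x))\<^sup>2 \<le> R0\<^sup>2 - (B / lam)\<^sup>2" .
    moreover have "0 \<le> exp (- lam * t) * (B / lam)\<^sup>2" by simp
    ultimately have "exp (- lam * t) * (norm (V x))\<^sup>2 + (1 - exp (- lam * t)) * (B / lam)\<^sup>2 \<le> R0\<^sup>2"
      unfolding left_diff_distrib mult_1 by linarith
    then have "(norm (V (semiflow_of X f t x)))\<^sup>2 \<le> R0\<^sup>2"
      using solution_slice_bound[OF solution_semiflow_of(1)[OF xX] t(1)] solution_semiflow_of(2)[OF xX]
      by simp
    then show ?thesis
      using R0_pos solution_semiflow_of(1)[OF xX] t
      by (simp add: slice_def solution_in_def power2_le_iff_abs_le)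
  qed
  then show ?thesis by (intro exI[of _ T]) (auto simp: T_def)
qed

sublocale absorbing_semiflow X "slice R0" "semiflow_of X f"
proof
  show "slice R0 \<noteq> {}" using nonempty by (simp add: slice_def)
  show "slice R0 \<subseteq> X" by (auto simp: slice_def)
qed (use compact_slice semiflow_of_add continuous_on_semiflow_of semiflow_of_slice
    semiflow_of_absorbing in auto)

end

section \<open>Bounded Lipschitz functions\<close>

text \<open>Boundedness is bundled in because a product of Lipschitz functions is Lipschitz only
  with bounded factors. The bundle is closed under all operations that build the fields, and no
  constants have to be tracked.\<close>

definition bounded_lipschitz :: "'a::metric_space set \<Rightarrow> ('a \<Rightarrow> 'b::real_normed_vector) \<Rightarrow> bool" where
  "bounded_lipschitz S f \<longleftrightarrow> bounded (f ` S) \<and> (\<exists>L. L-lipschitz_on S f)"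

lemma bounded_lipschitz_lipschitz: "bounded_lipschitz S f \<Longrightarrow> \<exists>L. L-lipschitz_on S f"
  by (simp add: bounded_lipschitz_def)

lemma bounded_lipschitz_continuous_on: "bounded_lipschitz S f \<Longrightarrow> continuous_on S f"
  using lipschitz_on_continuous_on by (auto simp: bounded_lipschitz_def)

lemma bounded_lipschitz_bound:
  assumes "bounded_lipschitz S f"
  obtains M where "M > 0" "\<And>x. x \<in> S \<Longrightarrow> norm (f x) \<le> M"
  using assms unfolding bounded_lipschitz_def bounded_pos by auto

lemma bounded_lipschitz_cong:
  "bounded_lipschitz S f \<Longrightarrow> (\<And>x. x \<in> S \<Longrightarrow> f x = g x) \<Longrightarrow> bounded_lipschitz S g"
  unfolding bounded_lipschitz_def using lipschitz_on_cong by (metis image_cong)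

lemma bounded_lipschitz_of_bounded:
  assumes "bounded S" "L-lipschitz_on S f"
  shows "bounded_lipschitz S f"
proof (cases "S = {}")
  case False
  then obtain a where a: "a \<in> S" by blast
  obtain e where "\<And>x. x \<in> S \<Longrightarrow> dist a x \<le> e"
    using assms(1) unfolding bounded_any_center[where a = a] by auto
  then have "dist (f a) (f x) \<le> L * e" if "x \<in> S" for x
    using lipschitz_onD[OF assms(2) a that] that lipschitz_on_nonneg[OF assms(2)]
    by (meson mult_left_mono order_trans)
  then have "bounded (f ` S)" unfolding bounded_def by auto
  then show ?thesis using assms by (auto simp: bounded_lipschitz_def)
qed (auto simp: bounded_lipschitz_def)

lemma bounded_lipschitz_ident: "bounded S \<Longrightarrow> bounded_lipschitz S (\<lambda>x. x)"
  by (rule bounded_lipschitz_of_bounded[OF _ lipschitz_on_id])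

lemma bounded_lipschitz_const: "bounded_lipschitz S (\<lambda>_. c)"
  by (auto simp: bounded_lipschitz_def image_constant_conv intro: lipschitz_on_constant)

lemma bounded_lipschitz_add:
  assumes "bounded_lipschitz S f" "bounded_lipschitz S g"
  shows "bounded_lipschitz S (\<lambda>x. f x + g x)"
  using assms lipschitz_on_add bounded_plus_comp unfolding bounded_lipschitz_def by blast

lemma bounded_lipschitz_linear:
  assumes "bounded_linear h" "bounded_lipschitz S f"
  shows "bounded_lipschitz S (\<lambda>x. h (f x))"
proof -
  obtain L where L: "L-lipschitz_on S f" using assms by (auto simp: bounded_lipschitz_def)
  obtain K where K: "K-lipschitz_on UNIV h"
    using bounded_linear.lipschitz_boundE[OF assms(1)] .
  have "(K * L)-lipschitz_on S (h \<circ> f)"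
    by (rule lipschitz_on_compose[OF L lipschitz_on_subset[OF K]]) auto
  moreover have "bounded ((\<lambda>x. h (f x)) ` S)"
    using bounded_linear_image[OF _ assms(1), of "f ` S"] assms(2)
    by (simp add: bounded_lipschitz_def image_image)
  ultimately show ?thesis by (auto simp: bounded_lipschitz_def o_def)
qed

lemma bounded_lipschitz_fst_snd:
  assumes "bounded S"
  shows "bounded_lipschitz S fst" "bounded_lipschitz S snd"
  using bounded_lipschitz_linear[OF bounded_linear_fst bounded_lipschitz_ident[OF assms]]
    bounded_lipschitz_linear[OF bounded_linear_snd bounded_lipschitz_ident[OF assms]] by auto

lemma bounded_lipschitz_uminus:
  "bounded_lipschitz S f \<Longrightarrow> bounded_lipschitz S (\<lambda>x. - f x)"
  by (rule bounded_lipschitz_linear[OF bounded_linear_minus[OF bounded_linear_ident]])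

lemma bounded_lipschitz_diff:
  assumes "bounded_lipschitz S f" "bounded_lipschitz S g"
  shows "bounded_lipschitz S (\<lambda>x. f x - g x)"
  using bounded_lipschitz_add[OF assms(1) bounded_lipschitz_uminus[OF assms(2)]] by simp

lemma bounded_lipschitz_sum:
  assumes "\<And>i. i \<in> I \<Longrightarrow> bounded_lipschitz S (f i)"
  shows "bounded_lipschitz S (\<lambda>x. \<Sum>i\<in>I. f i x)"
  using assms
  by (induction I rule: infinite_finite_induct) (auto intro: bounded_lipschitz_const bounded_lipschitz_add)

lemma bounded_lipschitz_bilinear:
  assumes h: "bounded_bilinear h" and f: "bounded_lipschitz S f" and g: "bounded_lipschitz S g"
  shows "bounded_lipschitz S (\<lambda>x. h (f x) (g x))"
proof -
  interpret bounded_bilinear h by fact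
  obtain K where K: "K > 0" "\<And>a b. norm (h a b) \<le> norm a * norm b * K"
    using pos_bounded by blast
  obtain F where F: "F > 0" "\<And>x. x \<in> S \<Longrightarrow> norm (f x) \<le> F" using f by (rule bounded_lipschitz_bound) blast
  obtain G where G: "G > 0" "\<And>x. x \<in> S \<Longrightarrow> norm (g x) \<le> G" using g by (rule bounded_lipschitz_bound) blast
  obtain L where L: "L-lipschitz_on S f" using f by (auto simp: bounded_lipschitz_def)
  obtain M where M: "M-lipschitz_on S g" using g by (auto simp: bounded_lipschitz_def)
  have "norm (h (f x) (g x)) \<le> F * G * K" if "x \<in> S" for x
    using K F G that by (intro order_trans[OF K(2)] mult_mono) auto
  then have "bounded ((\<lambda>x. h (f x) (g x)) ` S)" by (intro boundedI) auto
  moreover have "((F * M + L * G) * K)-lipschitz_on S (\<lambda>x. h (f x) (g x))"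
  proof (rule lipschitz_onI)
    fix x y assume xy: "x \<in> S" "y \<in> S"
    have "h (f x) (g x) - h (f y) (g y) = h (f x) (g x - g y) + h (f x - f y) (g y)"
      by (simp add: diff_left diff_right)
    then have "norm (h (f x) (g x) - h (f y) (g y))
        \<le> norm (f x) * norm (g x - g y) * K + norm (f x - f y) * norm (g y) * K"
      using norm_triangle_mono[OF K(2)[of "f x" "g x - g y"] K(2)[of "f x - f y" "g y"]] by simp
    also have "\<dots> \<le> F * (M * dist x y) * K + (L * dist x y) * G * K"
      using lipschitz_onD[OF L xy] lipschitz_onD[OF M xy] F G K xy
        lipschitz_on_nonneg[OF L] lipschitz_on_nonneg[OF M]
      by (intro add_mono mult_mono) (auto simp: dist_norm)
    finally show "dist (h (f x) (g x)) (h (f y) (g y)) \<le> (F * M + L * G) * K * dist x y"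
      by (simp add: dist_norm algebra_simps)
  qed (use F G K lipschitz_on_nonneg[OF L] lipschitz_on_nonneg[OF M] in auto)
  ultimately show ?thesis by (auto simp: bounded_lipschitz_def)
qed

lemmas bounded_lipschitz_mult =
  bounded_lipschitz_bilinear[OF bounded_bilinear_mult]
lemmas bounded_lipschitz_scaleR =
  bounded_lipschitz_bilinear[OF bounded_bilinear_scaleR]
lemmas bounded_lipschitz_inner =
  bounded_lipschitz_bilinear[OF bounded_bilinear_inner]

lemma bounded_lipschitz_compose:
  assumes g: "bounded_lipschitz T g" and f: "bounded_lipschitz S f" and "f ` S \<subseteq> T"
  shows "bounded_lipschitz S (\<lambda>x. g (f x))"
proof -
  obtain L where L: "L-lipschitz_on S f" using f by (auto simp: bounded_lipschitz_def)
  obtain M where M: "M-lipschitz_on T g" using g by (auto simp: bounded_lipschitz_def)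
  have "(M * L)-lipschitz_on S (g \<circ> f)"
    by (rule lipschitz_on_compose[OF L lipschitz_on_subset[OF M assms(3)]])
  moreover have "bounded ((\<lambda>x. g (f x)) ` S)"
    using g assms(3) bounded_subset[of "g ` T" "(\<lambda>x. g (f x)) ` S"] by (auto simp: bounded_lipschitz_def)
  ultimately show ?thesis by (auto simp: bounded_lipschitz_def o_def)
qed

lemma bounded_lipschitz_Pair:
  assumes "bounded_lipschitz S f" "bounded_lipschitz S g"
  shows "bounded_lipschitz S (\<lambda>x. (f x, g x))"
proof -
  have "bounded ((\<lambda>x. (f x, g x)) ` S)"
    using assms bounded_Times[of "f ` S" "g ` S"] unfolding bounded_lipschitz_def
    by (auto intro: bounded_subset)
  then show ?thesis
    using assms lipschitz_on_Pair unfolding bounded_lipschitz_def by blast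
qed

lemma bounded_lipschitz_vec:
  fixes f :: "'a::metric_space \<Rightarrow> real^'n"
  assumes "\<And>i. bounded_lipschitz S (\<lambda>x. f x $ i)"
  shows "bounded_lipschitz S f"
proof -
  have "bounded_lipschitz S (\<lambda>x. \<Sum>i\<in>UNIV. f x $ i *\<^sub>R axis i 1)"
    by (intro bounded_lipschitz_sum bounded_lipschitz_scaleR assms bounded_lipschitz_const)
  moreover have "(\<Sum>i\<in>UNIV. f x $ i *\<^sub>R axis i 1) = f x" for x
    using basis_expansion[of "f x"] by (simp add: scalar_mult_eq_scaleR)
  ultimately show ?thesis by (rule bounded_lipschitz_cong)
qed

lemma bounded_lipschitz_vec_nth:
  "bounded_lipschitz S f \<Longrightarrow> bounded_lipschitz S (\<lambda>x. f x $ i)"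
  by (rule bounded_lipschitz_linear[OF bounded_linear_vec_nth])

text \<open>This one form covers \<open>exp\<close> below a bound as well as \<open>ln\<close> and
  \<open>inverse\<close> away from 0: the derivative has to be bounded only on a convex set
  containing the range.\<close>

lemma bounded_lipschitz_deriv_compose:
  fixes g :: "real \<Rightarrow> real"
  assumes f: "bounded_lipschitz S f" and I: "convex I" "f ` S \<subseteq> I"
    and g: "\<And>z. z \<in> I \<Longrightarrow> (g has_real_derivative g' z) (at z)" "\<And>z. z \<in> I \<Longrightarrow> \<bar>g' z\<bar> \<le> M"
  shows "bounded_lipschitz S (\<lambda>x. g (f x))"
proof (rule bounded_lipschitz_compose[of "f ` S", OF _ f])
  have "norm (g x - g y) \<le> max M 0 * norm (x - y)" if "x \<in> I" "y \<in> I" for x y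
    by (rule field_differentiable_bound[OF I(1), of g g' "max M 0"])
      (use g that in \<open>force intro: has_field_derivative_at_within\<close>)+
  then have "(max M 0)-lipschitz_on (f ` S) g"
    using I(2) by (intro lipschitz_onI) (auto simp: dist_norm)
  then show "bounded_lipschitz (f ` S) g"
    using f by (intro bounded_lipschitz_of_bounded) (auto simp: bounded_lipschitz_def)
qed simp

lemma bounded_lipschitz_exp:
  fixes f :: "'a::metric_space \<Rightarrow> real"
  assumes f: "bounded_lipschitz S f"
  shows "bounded_lipschitz S (\<lambda>x. exp (f x))"
proof -
  obtain M where M: "\<And>x. x \<in> S \<Longrightarrow> norm (f x) \<le> M" using f by (rule bounded_lipschitz_bound) blast
  then have sub: "f ` S \<subseteq> {..M}" by force
  show ?thesis
    by (rule bounded_lipschitz_deriv_compose[OF f _ sub, of exp exp "exp M"])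
      (auto intro!: derivative_eq_intros)
qed

lemma bounded_lipschitz_ln:
  fixes f :: "'a::metric_space \<Rightarrow> real"
  assumes f: "bounded_lipschitz S f" and "c > 0" and sub: "\<And>x. x \<in> S \<Longrightarrow> c \<le> f x"
  shows "bounded_lipschitz S (\<lambda>x. ln (f x))"
  by (rule bounded_lipschitz_deriv_compose[OF f, of "{c..}" ln inverse "inverse c"])
    (use assms in \<open>auto intro!: derivative_eq_intros simp: divide_inverse le_imp_inverse_le\<close>)

lemma bounded_lipschitz_inverse:
  fixes f :: "'a::metric_space \<Rightarrow> real"
  assumes f: "bounded_lipschitz S f" and "c > 0" and sub: "\<And>x. x \<in> S \<Longrightarrow> c \<le> f x"
  shows "bounded_lipschitz S (\<lambda>x. inverse (f x))"
  by (rule bounded_lipschitz_deriv_compose[OF f, of "{c..}" inverse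
        "\<lambda>z. - (inverse z * inverse z)" "inverse c * inverse c"])
    (use assms in \<open>auto intro!: derivative_eq_intros mult_mono le_imp_inverse_le simp: abs_mult\<close>)

lemmas bounded_lipschitz_intros = bounded_lipschitz_const bounded_lipschitz_add bounded_lipschitz_diff
  bounded_lipschitz_sum bounded_lipschitz_mult bounded_lipschitz_scaleR bounded_lipschitz_inner

section \<open>Regularity of the actor-critic fields\<close>

lemma policy_pos: "policy \<tau> \<psi> \<theta> i a > 0"
  unfolding policy_def by (intro divide_pos_pos sum_pos) auto

lemma sum_policy: "(\<Sum>a\<in>UNIV. policy \<tau> \<psi> \<theta> i a) = 1"
proof -
  have "(\<Sum>b\<in>UNIV. exp ((\<psi> i b \<bullet> \<theta>) / \<tau>)) > 0" by (intro sum_pos) auto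
  then show ?thesis unfolding policy_def by (simp add: sum_divide_distrib[symmetric])
qed

lemma ln_policy:
  "ln (policy \<tau> \<psi> \<theta> i a) = (\<psi> i a \<bullet> \<theta>) / \<tau> - ln (\<Sum>b\<in>UNIV. exp ((\<psi> i b \<bullet> \<theta>) / \<tau>))"
proof -
  have "(\<Sum>b\<in>UNIV. exp ((\<psi> i b \<bullet> \<theta>) / \<tau>)) > 0" by (intro sum_pos) auto
  then show ?thesis unfolding policy_def by (simp add: ln_div)
qed

lemma gderiv_unique:
  assumes "GDERIV f x :> D" "GDERIV f x :> D'"
  shows "D = D'"
proof -
  have "(\<lambda>h. h \<bullet> D) = (\<lambda>h. h \<bullet> D')"
    using assms unfolding gderiv_def by (rule has_derivative_unique)
  then show ?thesis by (simp add: fun_eq_iff vector_eq_ldot)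
qed

text \<open>The logarithm of a softmax is linear minus the logarithm of the normaliser, whose
  gradient is the policy average of the features up to \<open>1 / \<tau>\<close>. The closed form
  removes the definite description, after which regularity follows by composition.\<close>

lemma gradient_ln_policy:
  "gradient (\<lambda>\<theta>'. ln (policy \<tau> \<psi> \<theta>' i a)) \<theta>
    = (1 / \<tau>) *\<^sub>R (\<psi> i a - (\<Sum>b\<in>UNIV. policy \<tau> \<psi> \<theta> i b *\<^sub>R \<psi> i b))"
proof -
  define Z where "Z \<theta> = (\<Sum>b\<in>UNIV. exp ((\<psi> i b \<bullet> \<theta>) / \<tau>))" for \<theta>
  have Z: "Z \<theta> > 0" for \<theta> unfolding Z_def by (intro sum_pos) auto
  have dZ: "(Z has_derivative (\<lambda>h. \<Sum>b\<in>UNIV. exp ((\<psi> i b \<bullet> \<theta>) / \<tau>) * ((\<psi> i b \<bullet> h) / \<tau>))) (at \<theta>)"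
    unfolding Z_def by (auto intro!: derivative_eq_intros sum.cong simp: fun_eq_iff divide_inverse)
  have "((\<lambda>\<theta>'. (\<psi> i a \<bullet> \<theta>') / \<tau> - ln (Z \<theta>')) has_derivative
     (\<lambda>h. (\<psi> i a \<bullet> h) / \<tau> - (\<Sum>b\<in>UNIV. exp ((\<psi> i b \<bullet> \<theta>) / \<tau>) * ((\<psi> i b \<bullet> h) / \<tau>)) / Z \<theta>)) (at \<theta>)"
    using Z[of \<theta>] by (auto intro!: derivative_eq_intros dZ simp: divide_inverse)
  then have "GDERIV (\<lambda>\<theta>'. ln (policy \<tau> \<psi> \<theta>' i a)) \<theta>
    :> (1 / \<tau>) *\<^sub>R (\<psi> i a - (\<Sum>b\<in>UNIV. policy \<tau> \<psi> \<theta> i b *\<^sub>R \<psi> i b))"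
    unfolding gderiv_def ln_policy Z_def[symmetric]
  proof (rule has_derivative_eq_rhs, intro ext)
    fix h
    have "policy \<tau> \<psi> \<theta> i b = exp ((\<psi> i b \<bullet> \<theta>) / \<tau>) / Z \<theta>" for b
      by (simp add: policy_def Z_def)
    then show "(\<psi> i a \<bullet> h) / \<tau> - (\<Sum>b\<in>UNIV. exp ((\<psi> i b \<bullet> \<theta>) / \<tau>) * ((\<psi> i b \<bullet> h) / \<tau>)) / Z \<theta>
      = h \<bullet> ((1 / \<tau>) *\<^sub>R (\<psi> i a - (\<Sum>b\<in>UNIV. policy \<tau> \<psi> \<theta> i b *\<^sub>R \<psi> i b)))"
      by (simp add: inner_diff_right inner_sum_right inner_commute[of h] sum_divide_distrib
        diff_divide_distrib mult_ac)
  qed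
  then show ?thesis
    unfolding gradient_def by (blast intro: gderiv_unique)
qed

lemma bounded_lipschitz_softmax_denominator:
  fixes \<psi> :: "'n \<Rightarrow> 'k::finite \<Rightarrow> real^'d"
  assumes "bounded_lipschitz S \<theta>"
  shows "\<exists>c>0. \<forall>x\<in>S. c \<le> (\<Sum>b\<in>UNIV. exp ((\<psi> i b \<bullet> \<theta> x) / \<tau>))"
    and "bounded_lipschitz S (\<lambda>x. \<Sum>b\<in>UNIV. exp ((\<psi> i b \<bullet> \<theta> x) / \<tau>))"
    and "bounded_lipschitz S (\<lambda>x. (\<psi> i b \<bullet> \<theta> x) / \<tau>)"
proof -
  show e: "bounded_lipschitz S (\<lambda>x. (\<psi> i b \<bullet> \<theta> x) / \<tau>)" for b
    unfolding divide_inverse by (intro bounded_lipschitz_intros assms)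
  show "bounded_lipschitz S (\<lambda>x. \<Sum>b\<in>UNIV. exp ((\<psi> i b \<bullet> \<theta> x) / \<tau>))"
    by (intro bounded_lipschitz_sum bounded_lipschitz_exp e)
  \<comment> \<open>A single summand already bounds the denominator away from 0;
    \<open>undefined\<close> serves as an arbitrary action.\<close>
  obtain M where M: "\<And>x. x \<in> S \<Longrightarrow> norm ((\<psi> i undefined \<bullet> \<theta> x) / \<tau>) \<le> M"
    using e by (rule bounded_lipschitz_bound) blast
  have "exp (- M) \<le> (\<Sum>b\<in>UNIV. exp ((\<psi> i b \<bullet> \<theta> x) / \<tau>))" if "x \<in> S" for x
  proof -
    have "exp (- M) \<le> exp ((\<psi> i undefined \<bullet> \<theta> x) / \<tau>)" using M[OF that] unfolding exp_le_cancel_iff real_norm_def by linarith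
    also have "\<dots> \<le> (\<Sum>b\<in>UNIV. exp ((\<psi> i b \<bullet> \<theta> x) / \<tau>))"
      by (rule member_le_sum) auto
    finally show ?thesis .
  qed
  then show "\<exists>c>0. \<forall>x\<in>S. c \<le> (\<Sum>b\<in>UNIV. exp ((\<psi> i b \<bullet> \<theta> x) / \<tau>))"
    by (intro exI[of _ "exp (- M)"]) auto
qed

lemma bounded_lipschitz_policy:
  assumes "bounded_lipschitz S \<theta>"
  shows "bounded_lipschitz S (\<lambda>x. policy \<tau> \<psi> (\<theta> x) i a)"
    and "bounded_lipschitz S (\<lambda>x. ln (policy \<tau> \<psi> (\<theta> x) i a))"
proof -
  obtain c where c: "c > 0" "\<And>x. x \<in> S \<Longrightarrow> c \<le> (\<Sum>b\<in>UNIV. exp ((\<psi> i b \<bullet> \<theta> x) / \<tau>))"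
    using bounded_lipschitz_softmax_denominator(1)[OF assms] by metis
  show "bounded_lipschitz S (\<lambda>x. policy \<tau> \<psi> (\<theta> x) i a)"
    unfolding policy_def divide_inverse[of "exp _"]
    by (intro bounded_lipschitz_mult bounded_lipschitz_exp bounded_lipschitz_softmax_denominator assms
        bounded_lipschitz_inverse[OF _ c])
  show "bounded_lipschitz S (\<lambda>x. ln (policy \<tau> \<psi> (\<theta> x) i a))"
    unfolding ln_policy
    by (intro bounded_lipschitz_diff bounded_lipschitz_softmax_denominator assms
        bounded_lipschitz_ln[OF _ c])
qed

lemma sum_matrix_vector_mult: "(\<Sum>i\<in>A. M i) *v v = (\<Sum>i\<in>A. M i *v v)"
  for M :: "'c \<Rightarrow> real^'m^'m"
  by (induction A rule: infinite_finite_induct) (auto simp: matrix_vector_mult_add_rdistrib)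

text \<open>Each feature matrix has rank one and sends \<open>v\<close> to
  \<open>(p \<bullet> v) *\<^sub>R p\<close>. In this form the regularity and the sign of the
  quadratic form are visible without matrices.\<close>

lemma critic_A_mult:
  fixes \<phi> :: "'n::finite \<Rightarrow> 'k::finite \<Rightarrow> real^'m"
  shows "critic_A \<tau> lam \<psi> \<phi> \<theta>' \<mu>' *v v
    = lam *\<^sub>R v + (\<Sum>i\<in>UNIV. \<Sum>a\<in>UNIV. (occ \<tau> \<psi> \<theta>' \<mu>' i a * (\<phi> i a \<bullet> v)) *\<^sub>R \<phi> i a)"
proof -
  have "(\<chi> j k. p $ j * p $ k) *v v = (p \<bullet> v) *\<^sub>R p" for p :: "real^'m"
    by (simp add: vec_eq_iff matrix_vector_mult_def inner_vec_def sum_distrib_left sum_distrib_right mult_ac)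
  then show ?thesis
    by (simp add: critic_A_def matrix_vector_mult_add_rdistrib sum_matrix_vector_mult
       scaleR_matrix_vector_assoc[symmetric])
qed

lemma actor_G_nth:
  "actor_G R \<tau> r \<psi> \<phi> \<theta> w \<mu> $ j = (R\<^sup>2 - (\<theta> $ j)\<^sup>2) * actor_G_tilde \<tau> r \<psi> \<phi> \<theta> w \<mu> $ j"
  by (simp add: actor_G_def diag_D_def matrix_vector_mult_def if_distrib[of "\<lambda>a. a * _"] cong: if_cong)

context
  fixes S :: "'a::metric_space set" and \<theta> :: "'a \<Rightarrow> real^'d" and w :: "'a \<Rightarrow> real^'m"
    and \<mu> :: "'a \<Rightarrow> real^'n"
  assumes components: "bounded_lipschitz S \<theta>" "bounded_lipschitz S w" "bounded_lipschitz S \<mu>"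
begin

lemma bounded_lipschitz_occ: "bounded_lipschitz S (\<lambda>x. occ \<tau> \<psi> (\<theta> x) (\<mu> x) i a)"
  unfolding occ_def
  by (intro bounded_lipschitz_mult bounded_lipschitz_vec_nth bounded_lipschitz_policy components)

lemma bounded_lipschitz_actor_G:
  "bounded_lipschitz S (\<lambda>x. actor_G R \<tau> r \<psi> \<phi> (\<theta> x) (w x) (\<mu> x))"
proof -
  have G: "bounded_lipschitz S (\<lambda>x. actor_G_tilde \<tau> r \<psi> \<phi> (\<theta> x) (w x) (\<mu> x))"
    unfolding actor_G_tilde_def gradient_ln_policy
    by (intro bounded_lipschitz_intros bounded_lipschitz_occ bounded_lipschitz_policy components)
  have eq: "actor_G R \<tau> r \<psi> \<phi> (\<theta> x) (w x) (\<mu> x) $ j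
      = (R\<^sup>2 - \<theta> x $ j * \<theta> x $ j) * actor_G_tilde \<tau> r \<psi> \<phi> (\<theta> x) (w x) (\<mu> x) $ j" for x j
    by (simp add: actor_G_nth power2_eq_square)
  show ?thesis
    by (rule bounded_lipschitz_vec, unfold eq)
      (intro bounded_lipschitz_intros bounded_lipschitz_vec_nth G components)
qed

lemma bounded_lipschitz_critic:
  "bounded_lipschitz S (\<lambda>x. critic_b \<tau> r \<psi> \<phi> (\<theta> x) (\<mu> x) - critic_A \<tau> lam \<psi> \<phi> (\<theta> x) (\<mu> x) *v w x)"
  unfolding critic_b_def critic_A_mult
  by (intro bounded_lipschitz_intros bounded_lipschitz_occ components)

end

section \<open>Norms, simplex and metric\<close>

lemma norm_le_norm1: "norm x \<le> norm1 x"
  unfolding norm1_def using norm_le_l1_cart .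

lemma norm1_le_norm: "norm1 (x :: real^'n) \<le> CARD('n) * norm x"
  unfolding norm1_def
  using sum_bounded_above[of UNIV "\<lambda>i. \<bar>x $ i\<bar>" "norm x"] component_le_norm_cart by fastforce

text \<open>The components \<open>\<theta>\<close> and \<open>w\<close> contribute 1 each, and
  passing to \<open>norm1\<close> costs \<open>CARD('n)\<close>. Together with
  \<open>dist_le_dX\<close> this makes the metrics equivalent, so that the analysis can be done in
  the Euclidean one.\<close>

lemma dX_le_dist:
  "dX (x :: (real^'d) \<times> (real^'m) \<times> (real^'n)) y \<le> (2 + real CARD('n)) * dist x y"
proof -
  obtain \<theta> w \<mu> \<theta>' w' \<mu>' where xy: "x = (\<theta>, w, \<mu>)" "y = (\<theta>', w', \<mu>')" by (metis prod.exhaust)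
  have "dist \<theta> \<theta>' \<le> dist x y" "dist (w, \<mu>) (w', \<mu>') \<le> dist x y"
    using dist_fst_le[of x y] dist_snd_le[of x y] xy by auto
  moreover have "dist w w' \<le> dist (w, \<mu>) (w', \<mu>')" "dist \<mu> \<mu>' \<le> dist (w, \<mu>) (w', \<mu>')"
    using dist_fst_le[of "(w, \<mu>)" "(w', \<mu>')"] dist_snd_le[of "(w, \<mu>)" "(w', \<mu>')"] by auto
  ultimately have "dist \<theta> \<theta>' \<le> dist x y" "dist w w' \<le> dist x y" "dist \<mu> \<mu>' \<le> dist x y"
    by linarith+
  moreover have "norm1 (\<mu> - \<mu>') \<le> CARD('n) * dist x y"
    using \<open>dist \<mu> \<mu>' \<le> dist x y\<close>
    by (intro order_trans[OF norm1_le_norm] mult_left_mono) (auto simp: dist_norm)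
  ultimately show ?thesis by (simp add: dX_def xy dist_norm algebra_simps)
qed

lemma dist_le_dX: "dist x y \<le> dX x y"
proof -
  obtain \<theta> w \<mu> \<theta>' w' \<mu>' where xy: "x = (\<theta>, w, \<mu>)" "y = (\<theta>', w', \<mu>')" by (metis prod.exhaust)
  have "norm (\<theta> - \<theta>', w - w', \<mu> - \<mu>') \<le> norm (\<theta> - \<theta>') + (norm (w - w') + norm (\<mu> - \<mu>'))"
    using norm_Pair_le[of "\<theta> - \<theta>'" "(w - w', \<mu> - \<mu>')"] norm_Pair_le[of "w - w'" "\<mu> - \<mu>'"] by linarith
  then show ?thesis using norm_le_norm1[of "\<mu> - \<mu>'"] by (simp add: dX_def xy dist_norm)
qed

lemma Metric_space_dX: "Metric_space X dX"
proof
  fix x y z :: "(real^'d) \<times> (real^'m) \<times> (real^'n)"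
  show "0 \<le> dX x y" using dist_le_dX[of x y] zero_le_dist[of x y] by linarith
  have "norm1 (a - b) = norm1 (b - a)" for a b :: "real^'n" by (simp add: norm1_def abs_minus_commute)
  then show "dX x y = dX y x" by (auto simp: dX_def norm_minus_commute split: prod.splits)
  show "dX x y = 0 \<longleftrightarrow> x = y"
    using dist_le_dX[of x y] dX_le_dist[of x y] zero_le_dist[of x y] by (metis dist_eq_0_iff mult_zero_right order_antisym)
  have "norm1 (a - c) \<le> norm1 (a - b) + norm1 (b - c)" for a b c :: "real^'n"
    unfolding norm1_def sum.distrib[symmetric] by (intro sum_mono) auto
  from this[of "snd (snd x)" "snd (snd z)" "snd (snd y)"]
  show "dX x z \<le> dX x y + dX y z"
    using dist_triangle[of "fst x" "fst z" "fst y"] dist_triangle[of "fst (snd x)" "fst (snd z)" "fst (snd y)"]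
    unfolding dX_def dist_norm by (auto split: prod.splits)
qed

lemma mbounded_dX: "Metric_space.mbounded X dX B \<Longrightarrow> bounded B"
proof -
  assume B: "Metric_space.mbounded X dX B"
  interpret Metric_space X dX by (rule Metric_space_dX)
  obtain a b where "B \<subseteq> mcball a b" using B unfolding mbounded_def by blast
  have "B \<subseteq> cball a b"
  proof
    fix y assume "y \<in> B"
    then have "dX a y \<le> b" using \<open>B \<subseteq> mcball a b\<close> by (auto simp: in_mcball)
    then show "y \<in> cball a b" using dist_le_dX[of a y] by simp
  qed
  then show ?thesis using bounded_cball bounded_subset by blast
qed

section \<open>The parameter cube, the simplex and the operator norm\<close>

lemma Theta_eq_cbox: "Theta R = cbox (\<chi> j. - R) (\<chi> j. R)"
  by (auto simp: Theta_def mem_box_cart)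

lemma compact_Theta: "compact (Theta R)" and convex_Theta: "convex (Theta R)"
  by (auto simp: Theta_eq_cbox)

lemma norm1_prob_simplex: "\<mu> \<in> prob_simplex \<Longrightarrow> norm1 \<mu> = 1"
  by (auto simp: prob_simplex_def norm1_def)

lemma prob_simplex_eq:
  "(prob_simplex :: (real^'n) set) = (\<Inter>i. {\<mu>. 0 \<le> \<mu> $ i}) \<inter> {\<mu>. (\<Sum>i\<in>UNIV. \<mu> $ i) = 1}"
  by (auto simp: prob_simplex_def)

lemma compact_prob_simplex: "compact (prob_simplex :: (real^'n) set)"
proof -
  have "closed (prob_simplex :: (real^'n) set)"
    unfolding prob_simplex_eq
    by (intro closed_Int closed_INT ballI closed_Collect_le closed_Collect_eq continuous_intros)
  moreover have "bounded (prob_simplex :: (real^'n) set)"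
    by (rule boundedI[where B = 1]) (metis norm_le_norm1 norm1_prob_simplex)
  ultimately show ?thesis by (simp add: compact_eq_bounded_closed)
qed

lemma convex_prob_simplex: "convex (prob_simplex :: (real^'n) set)"
  by (rule convexI) (auto simp: prob_simplex_def sum.distrib sum_distrib_left[symmetric])

lemma prob_simplex_nonempty: "(prob_simplex :: (real^'n) set) \<noteq> {}"
proof -
  have "(\<chi> i. 1 / CARD('n)) \<in> (prob_simplex :: (real^'n) set)" by (simp add: prob_simplex_def)
  then show ?thesis by blast
qed

lemma diff_prob_simplex:
  assumes "\<mu> \<in> prob_simplex" "\<mu>' \<in> prob_simplex"
  shows "\<mu> - \<mu>' \<in> zero_sum" "norm1 (\<mu> - \<mu>') \<le> 2"
proof -
  show "\<mu> - \<mu>' \<in> zero_sum" using assms by (auto simp: prob_simplex_def zero_sum_def sum_subtractf)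
  have "norm1 (\<mu> - \<mu>') \<le> norm1 \<mu> + norm1 \<mu>'"
    unfolding norm1_def sum.distrib[symmetric] by (intro sum_mono) auto
  then show "norm1 (\<mu> - \<mu>') \<le> 2" using assms[THEN norm1_prob_simplex] by linarith
qed

text \<open>The unit vector \<open>axis j 1\<close> has \<open>norm1\<close> equal to 1 and is sent
  to the column \<open>j\<close>. The supremum in \<open>opnorm1\<close> dominates its value only
  because the values are bounded above, which is checked first. This turns the Lipschitz hypothesis
  on the generator into one on its entries.\<close>

lemma abs_nth_le_opnorm1: "\<bar>(M :: real^'n^'n) $ i $ j\<bar> \<le> opnorm1 M"
proof -
  have "bdd_above ((\<lambda>x. norm1 (M *v x)) ` {x. norm1 x \<le> 1})"
  proof (rule bdd_aboveI2)
    fix x :: "real^'n" assume "x \<in> {x. norm1 x \<le> 1}"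
    then have "norm x \<le> 1" using norm_le_norm1[of x] by auto
    have "norm (M *v x) \<le> onorm ((*v) M) * norm x"
      by (rule onorm) (rule matrix_vector_mul_bounded_linear)
    also have "\<dots> \<le> onorm ((*v) M) * 1"
      using \<open>norm x \<le> 1\<close> by (intro mult_left_mono onorm_pos_le matrix_vector_mul_bounded_linear)
    finally show "norm1 (M *v x) \<le> CARD('n) * (onorm ((*v) M))"
      using norm1_le_norm[of "M *v x"] by (simp add: mult_left_mono order_trans)
  qed
  moreover have "norm1 (axis j 1 :: real^'n) \<le> 1" by (simp add: norm1_def axis_def if_distrib cong: if_cong)
  ultimately have "norm1 (M *v axis j 1) \<le> opnorm1 M"
    unfolding opnorm1_def by (intro cSUP_upper) auto
  moreover have "\<bar>M $ i $ j\<bar> \<le> norm1 (M *v axis j 1)"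
    unfolding norm1_def
    by (rule order_trans[OF _ member_le_sum[of i]])
      (auto simp: matrix_vector_mult_basis column_def)
  ultimately show ?thesis by linarith
qed

section \<open>Absolute continuity and the evolution with a frozen parameter\<close>

lemma absolutely_cont_lipschitz:
  assumes "M-lipschitz_on {a..b} f"
  shows "absolutely_cont a b f"
  unfolding absolutely_cont_def
proof (intro allI impI)
  fix e :: real assume e: "e > 0"
  have M: "M \<ge> 0" using assms lipschitz_on_nonneg by blast
  show "\<exists>\<eta>>0. \<forall>I. finite I \<and> (\<forall>(u, v)\<in>I. a \<le> u \<and> u \<le> v \<and> v \<le> b) \<and>
        pairwise (\<lambda>(u, v) (u', v'). {u<..<v} \<inter> {u'<..<v'} = {}) I \<and>
        (\<Sum>(u, v)\<in>I. v - u) < \<eta> \<longrightarrow> (\<Sum>(u, v)\<in>I. norm (f v - f u)) < e"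
  proof (intro exI[of _ "e / (M + 1)"] conjI allI impI)
    show "0 < e / (M + 1)" using e M by simp
    fix I :: "(real \<times> real) set"
    assume I: "finite I \<and> (\<forall>(u, v)\<in>I. a \<le> u \<and> u \<le> v \<and> v \<le> b) \<and>
        pairwise (\<lambda>(u, v) (u', v'). {u<..<v} \<inter> {u'<..<v'} = {}) I \<and>
        (\<Sum>(u, v)\<in>I. v - u) < e / (M + 1)"
    have "(\<Sum>(u, v)\<in>I. norm (f v - f u)) \<le> (\<Sum>(u, v)\<in>I. M * (v - u))"
    proof (rule sum_mono, clarify)
      fix u v assume "(u, v) \<in> I"
      then have "a \<le> u" "u \<le> v" "v \<le> b" using I by auto
      then show "norm (f v - f u) \<le> M * (v - u)"
        using lipschitz_on_normD[OF assms, of v u] by auto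
    qed
    also have "\<dots> = M * (\<Sum>(u, v)\<in>I. v - u)" by (simp add: sum_distrib_left case_prod_unfold)
    also have "\<dots> \<le> M * (e / (M + 1))" using I M by (intro mult_left_mono) auto
    also have "\<dots> < e" using e M by (simp add: field_simps)
    finally show "(\<Sum>(u, v)\<in>I. norm (f v - f u)) < e" .
  qed
qed

lemma lipschitz_on_has_vector_derivative:
  fixes f :: "real \<Rightarrow> 'a::real_normed_vector"
  assumes "\<And>t. t \<in> {a..b} \<Longrightarrow> (f has_vector_derivative f' t) (at t within {a..b})"
    and "\<And>t. t \<in> {a..b} \<Longrightarrow> norm (f' t) \<le> M" and "M \<ge> 0"
  shows "M-lipschitz_on {a..b} f"
proof (rule lipschitz_onI[OF _ \<open>M \<ge> 0\<close>])
  fix x y assume xy: "x \<in> {a..b}" "y \<in> {a..b}"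
  have "norm (f x - f y) \<le> M * norm (x - y)"
  proof (rule differentiable_bound[of "{a..b}" f "\<lambda>t h. h *\<^sub>R f' t"])
    show "onorm (\<lambda>h. h *\<^sub>R f' t) \<le> M" if "t \<in> {a..b}" for t
      using assms(2)[OF that] by (intro onorm_le) (simp add: mult.commute[of M] mult_left_mono)
  qed (use assms xy in \<open>auto simp: has_vector_derivative_def\<close>)
  then show "dist (f x) (f y) \<le> M * dist x y" by (simp add: dist_norm)
qed

text \<open>A classical solution for a frozen parameter becomes an instance of the Caratheodory
  evolution, to which the pathwise stability hypothesis refers.\<close>

lemma evolves_constI:
  fixes Q :: "real^'d \<Rightarrow> real^'n^'n"
  assumes T: "0 \<le> T"
    and \<xi>: "\<And>t. 0 \<le> t \<Longrightarrow> (\<xi> has_vector_derivative transpose (Q \<theta>) *v \<xi> t) (at t within {0..})"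
  shows "evolves Q 1 (\<lambda>_. \<theta>) 0 T (\<xi> 0) (\<xi> T)"
  unfolding evolves_def
proof (intro exI[of _ \<xi>] conjI refl)
  have d: "(\<xi> has_vector_derivative transpose (Q \<theta>) *v \<xi> t) (at t within {0..T})" if "t \<in> {0..T}" for t
    using \<xi>[of t] that by (auto intro: has_vector_derivative_within_subset)
  then have "continuous_on {0..T} \<xi>"
    by (meson continuous_on_eq_continuous_within has_vector_derivative_continuous)
  then have "compact ((\<lambda>t. transpose (Q \<theta>) *v \<xi> t) ` {0..T})"
    by (intro compact_continuous_image continuous_intros
        continuous_on_compose2[OF matrix_vector_mult_linear_continuous_on]) auto
  then obtain M where "M > 0" "\<And>t. t \<in> {0..T} \<Longrightarrow> norm (transpose (Q \<theta>) *v \<xi> t) \<le> M"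
    using compact_imp_bounded bounded_pos by (metis imageI)
  then show "absolutely_cont 0 T \<xi>"
    by (intro absolutely_cont_lipschitz[where M = M] lipschitz_on_has_vector_derivative[OF d]) auto
  \<comment> \<open>\<open>evolves\<close> asks for a two-sided derivative, which may fail at the
    two end points; they form a null set.\<close>
  have "(\<xi> has_vector_derivative transpose (Q \<theta>) *v \<xi> u) (at u)" if "u \<in> {0..T} - {0, T}" for u
    using d[of u] that at_within_interior[of u "{0..T}"] by auto
  moreover have "{0, T} \<in> null_sets (lebesgue_on {0..T})"
    using T by (subst null_sets_restrict_space)
      (auto simp: negligible_iff_null_sets[symmetric] intro: negligible_finite)
  ultimately show "AE u in lebesgue_on {0..T}. \<exists>\<xi>'. (\<xi> has_vector_derivative \<xi>') (at u) \<and>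
      1 *\<^sub>R \<xi>' = transpose (Q \<theta>) *v \<xi> u"
    by (intro AE_I'[of "{0, T}"]) auto
qed

text \<open>The factor \<open>D(\<theta>)\<close> vanishes on the faces of the cube, so small Euler steps stay inside.\<close>

lemma Theta_step:
  assumes \<theta>: "\<theta> \<in> Theta R" and h: "0 \<le> h" "h * (2 * R * (1 + norm (actor_G_tilde \<tau> r \<psi> \<phi> \<theta> w \<mu>))) \<le> 1"
  shows "\<theta> + h *\<^sub>R actor_G R \<tau> r \<psi> \<phi> \<theta> w \<mu> \<in> Theta R"
  unfolding Theta_def
proof (rule CollectI, rule allI)
  fix j
  define t where "t = \<theta> $ j"
  define g where "g = actor_G_tilde \<tau> r \<psi> \<phi> \<theta> w \<mu> $ j"
  have t: "- R \<le> t" "t \<le> R" using \<theta> by (auto simp: Theta_def t_def)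
  have le: "\<bar>h * s * g\<bar> \<le> 1" if "0 \<le> s" "s \<le> 2 * R" for s
  proof -
    have "\<bar>h * s * g\<bar> = h * (s * \<bar>g\<bar>)" using that h by (simp add: abs_mult)
    also have "\<dots> \<le> h * ((2 * R) * (1 + norm (actor_G_tilde \<tau> r \<psi> \<phi> \<theta> w \<mu>)))"
      using that h component_le_norm_cart[of "actor_G_tilde \<tau> r \<psi> \<phi> \<theta> w \<mu>" j]
      by (intro mult_left_mono mult_mono) (auto simp: g_def)
    finally show ?thesis using h by simp
  qed
  \<comment> \<open>Since \<open>R\<^sup>2 - t\<^sup>2\<close> is the product of the distances
    \<open>R - t\<close> and \<open>R + t\<close> to the two faces, a step multiplies either
    distance by a factor that remains nonnegative for small \<open>h\<close>.\<close>
  have "0 \<le> (R - t) * (1 - h * (R + t) * g)" "0 \<le> (R + t) * (1 + h * (R - t) * g)"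
    using le[of "R + t"] le[of "R - t"] t by (auto intro!: mult_nonneg_nonneg)
  moreover have "(\<theta> + h *\<^sub>R actor_G R \<tau> r \<psi> \<phi> \<theta> w \<mu>) $ j = t + h * ((R\<^sup>2 - t\<^sup>2) * g)"
    by (simp add: actor_G_nth t_def g_def)
  moreover have "(R - t) * (1 - h * (R + t) * g) = R - (t + h * ((R\<^sup>2 - t\<^sup>2) * g))"
    "(R + t) * (1 + h * (R - t) * g) = R + (t + h * ((R\<^sup>2 - t\<^sup>2) * g))"
    by (simp_all add: algebra_simps power2_eq_square)
  ultimately have "0 \<le> R - (\<theta> + h *\<^sub>R actor_G R \<tau> r \<psi> \<phi> \<theta> w \<mu>) $ j"
    "0 \<le> R + (\<theta> + h *\<^sub>R actor_G R \<tau> r \<psi> \<phi> \<theta> w \<mu>) $ j"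
    by simp_all
  then show "- R \<le> (\<theta> + h *\<^sub>R actor_G R \<tau> r \<psi> \<phi> \<theta> w \<mu>) $ j \<and>
      (\<theta> + h *\<^sub>R actor_G R \<tau> r \<psi> \<phi> \<theta> w \<mu>) $ j \<le> R"
    by linarith
qed

text \<open>This is the constant \<open>B_b\<close> that is local to
  \<open>radius_w\<close>.\<close>

definition reward_feature_bound :: "('n::finite \<Rightarrow> 'k::finite \<Rightarrow> real) \<Rightarrow> ('n \<Rightarrow> 'k \<Rightarrow> real^'m) \<Rightarrow> real" where
  "reward_feature_bound r \<phi> = (MAX (i, a)\<in>UNIV. \<bar>r i a\<bar>) * (MAX (i, a)\<in>UNIV. norm (\<phi> i a))"

lemma radius_w_eq: "radius_w lam r \<phi> = max 1 (2 * reward_feature_bound r \<phi> / lam)"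
  by (simp add: radius_w_def reward_feature_bound_def Let_def)

lemma reward_feature_bound: "\<bar>r i a\<bar> * norm (\<phi> i a) \<le> reward_feature_bound r \<phi>"
proof -
  have "\<bar>r i a\<bar> \<le> (MAX (i, a)\<in>UNIV. \<bar>r i a\<bar>)" "norm (\<phi> i a) \<le> (MAX (i, a)\<in>UNIV. norm (\<phi> i a))"
    by (rule Max_ge; force)+
  then show ?thesis unfolding reward_feature_bound_def
    by (intro mult_mono) (auto intro: order_trans[OF abs_ge_zero])
qed

lemma reward_feature_bound_nonneg: "0 \<le> reward_feature_bound r \<phi>"
  using reward_feature_bound[of r undefined undefined \<phi>]
  by (meson abs_ge_zero mult_nonneg_nonneg norm_ge_zero order_trans)

text \<open>Strictness comes from the factor 2 in the radius, and from the lower bound 1 when the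
  reward bound vanishes.\<close>

lemma radius_w_gt: "lam > 0 \<Longrightarrow> reward_feature_bound r \<phi> / lam < radius_w lam r \<phi>"
  using reward_feature_bound_nonneg[of r \<phi>] unfolding radius_w_eq
  by (cases "reward_feature_bound r \<phi> = 0") (auto simp: max_def field_simps)

section \<open>Dissipativity of the critic\<close>

lemma occ_nonneg: "\<mu> \<in> prob_simplex \<Longrightarrow> 0 \<le> occ \<tau> \<psi> \<theta> \<mu> i a"
  using policy_pos[of \<tau> \<psi> \<theta> i a] by (simp add: occ_def prob_simplex_def)

lemma sum_occ: "\<mu> \<in> prob_simplex \<Longrightarrow> (\<Sum>i\<in>UNIV. \<Sum>a\<in>UNIV. occ \<tau> \<psi> \<theta> \<mu> i a) = 1"
  by (simp add: occ_def prob_simplex_def sum_distrib_left[symmetric] sum_policy)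

text \<open>The weights \<open>occ\<close> form a probability distribution, so the reward part is an
  average of terms at most \<open>reward_feature_bound r \<phi> * norm w\<close>. The feature part
  of the matrix is positive semidefinite, which leaves the regularisation \<open>lam\<close> as
  damping.\<close>

lemma critic_dissipative:
  assumes \<mu>: "\<mu> \<in> prob_simplex"
  shows "w \<bullet> (critic_b \<tau> r \<psi> \<phi> \<theta> \<mu> - critic_A \<tau> lam \<psi> \<phi> \<theta> \<mu> *v w)
    \<le> reward_feature_bound r \<phi> * norm w - lam * (norm w)\<^sup>2"
proof -
  have "w \<bullet> critic_b \<tau> r \<psi> \<phi> \<theta> \<mu> = (\<Sum>i\<in>UNIV. \<Sum>a\<in>UNIV. occ \<tau> \<psi> \<theta> \<mu> i a * (r i a * (w \<bullet> \<phi> i a)))"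
    by (simp add: critic_b_def inner_sum_right mult_ac)
  also have "\<dots> \<le> (\<Sum>i\<in>UNIV. \<Sum>a\<in>UNIV. occ \<tau> \<psi> \<theta> \<mu> i a * (reward_feature_bound r \<phi> * norm w))"
  proof (intro sum_mono mult_left_mono occ_nonneg \<mu>)
    fix i a
    have "r i a * (w \<bullet> \<phi> i a) \<le> \<bar>r i a\<bar> * (norm w * norm (\<phi> i a))"
      using mult_left_mono[OF Cauchy_Schwarz_ineq2[of w "\<phi> i a"], of "\<bar>r i a\<bar>"]
        abs_ge_self[of "r i a * (w \<bullet> \<phi> i a)"] by (simp add: abs_mult)
    then show "r i a * (w \<bullet> \<phi> i a) \<le> reward_feature_bound r \<phi> * norm w"
      using mult_right_mono[OF reward_feature_bound[of r i a \<phi>] norm_ge_zero[of w]] by (simp add: mult_ac)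
  qed
  also have "\<dots> = reward_feature_bound r \<phi> * norm w"
    by (simp add: sum_distrib_right[symmetric] sum_occ[OF \<mu>])
  finally have b: "w \<bullet> critic_b \<tau> r \<psi> \<phi> \<theta> \<mu> \<le> reward_feature_bound r \<phi> * norm w" .
  have "\<phi> i a \<bullet> w = w \<bullet> \<phi> i a" for i a by (rule inner_commute)
  then have "w \<bullet> (critic_A \<tau> lam \<psi> \<phi> \<theta> \<mu> *v w)
      = lam * (norm w)\<^sup>2 + (\<Sum>i\<in>UNIV. \<Sum>a\<in>UNIV. occ \<tau> \<psi> \<theta> \<mu> i a * (w \<bullet> \<phi> i a)\<^sup>2)"
    by (simp add: critic_A_mult inner_add_right inner_sum_right dot_square_norm
        power2_eq_square mult_ac)
  moreover have "0 \<le> (\<Sum>i\<in>UNIV. \<Sum>a\<in>UNIV. occ \<tau> \<psi> \<theta> \<mu> i a * (w \<bullet> \<phi> i a)\<^sup>2)"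
    by (intro sum_nonneg mult_nonneg_nonneg occ_nonneg \<mu>) auto
  ultimately show ?thesis using b by (simp add: inner_diff_right)
qed

section \<open>The generator and its stationary distributions\<close>

locale actor_critic =
  fixes R\<theta> \<tau> lam :: real
    and r :: "'n::finite \<Rightarrow> 'k::finite \<Rightarrow> real"
    and \<psi> :: "'n \<Rightarrow> 'k \<Rightarrow> real^'d"
    and \<phi> :: "'n \<Rightarrow> 'k \<Rightarrow> real^'m"
    and Q :: "real^'d \<Rightarrow> real^'n^'n"
  assumes pos: "R\<theta> > 0" "\<tau> > 0" "lam > 0"
    and generator_offdiag: "\<And>\<theta> i j. \<theta> \<in> Theta R\<theta> \<Longrightarrow> i \<noteq> j \<Longrightarrow> Q \<theta> $ i $ j \<ge> 0"
    and generator_diag: "\<And>\<theta> i. \<theta> \<in> Theta R\<theta> \<Longrightarrow> Q \<theta> $ i $ i = - (\<Sum>j\<in>UNIV - {i}. Q \<theta> $ i $ j)"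
    and generator_lipschitz: "\<exists>L_Q>0. \<forall>\<theta>\<in>Theta R\<theta>. \<forall>\<theta>'\<in>Theta R\<theta>.
          opnorm1 (transpose (Q \<theta>) - transpose (Q \<theta>')) \<le> L_Q * norm (\<theta> - \<theta>')"
    and pathwise_stability: "\<exists>C_path\<ge>1. \<exists>\<gamma>_path>0. \<forall>\<delta>>0. \<forall>\<eta>::real \<Rightarrow> real^'d.
          \<eta> \<in> borel_measurable (lebesgue_on {0..}) \<and> (\<forall>t\<ge>0. \<eta> t \<in> Theta R\<theta>) \<longrightarrow>
          (\<forall>s t \<xi>s \<xi>t. 0 \<le> s \<and> s \<le> t \<and> \<xi>s \<in> zero_sum \<and> evolves Q \<delta> \<eta> s t \<xi>s \<xi>t \<longrightarrow>
             norm1 \<xi>t \<le> C_path * exp (- \<gamma>_path * (t - s) / \<delta>) * norm1 \<xi>s)"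
begin

abbreviation \<Theta> :: "(real^'d) set" where "\<Theta> \<equiv> Theta R\<theta>"

lemma transpose_Q_nth: "(transpose (Q \<theta>) *v \<mu>) $ i = (\<Sum>j\<in>UNIV. Q \<theta> $ j $ i * \<mu> $ j)"
  by (simp only: matrix_vector_mult_def transpose_def vec_lambda_beta)

lemma bounded_lipschitz_Q_mult:
  assumes \<theta>: "bounded_lipschitz S \<theta>" "\<theta> ` S \<subseteq> \<Theta>" and \<mu>: "bounded_lipschitz S \<mu>"
  shows "bounded_lipschitz S (\<lambda>x. transpose (Q (\<theta> x)) *v \<mu> x)"
proof (rule bounded_lipschitz_vec)
  obtain L where L: "L > 0" and LQ: "\<And>\<theta> \<theta>'. \<theta> \<in> \<Theta> \<Longrightarrow> \<theta>' \<in> \<Theta> \<Longrightarrow>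
      opnorm1 (transpose (Q \<theta>) - transpose (Q \<theta>')) \<le> L * norm (\<theta> - \<theta>')"
    using generator_lipschitz by blast
  have "L-lipschitz_on (\<Theta>) (\<lambda>\<theta>. Q \<theta> $ j $ i)" for i j
  proof (rule lipschitz_onI)
    fix \<theta> \<theta>' assume "\<theta> \<in> \<Theta>" "\<theta>' \<in> \<Theta>"
    then show "dist (Q \<theta> $ j $ i) (Q \<theta>' $ j $ i) \<le> L * dist \<theta> \<theta>'"
      using LQ[of \<theta> \<theta>'] abs_nth_le_opnorm1[of "transpose (Q \<theta>) - transpose (Q \<theta>')" i j]
      by (simp add: dist_norm transpose_def)
  qed (use L in simp)
  then have "bounded_lipschitz (\<Theta>) (\<lambda>\<theta>. Q \<theta> $ j $ i)" for i j
    using compact_Theta compact_imp_bounded bounded_lipschitz_of_bounded by blast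
  then have Qji: "bounded_lipschitz S (\<lambda>x. Q (\<theta> x) $ j $ i)" for i j
    using bounded_lipschitz_compose[OF _ \<theta>] by blast
  show "bounded_lipschitz S (\<lambda>x. (transpose (Q (\<theta> x)) *v \<mu> x) $ i)" for i
    unfolding transpose_Q_nth
    by (intro bounded_lipschitz_sum bounded_lipschitz_mult Qji bounded_lipschitz_vec_nth[OF \<mu>])
qed

text \<open>Pathwise stability is applied to constant paths with \<open>\<delta> = 1\<close>. Its
  constants do not depend on the path, so a single time \<open>S\<close> serves all
  \<open>\<theta>\<close>.\<close>

lemma frozen_decay:
  assumes e: "e > 0"
  shows "\<exists>S>0. \<forall>\<theta>\<in>\<Theta>. \<forall>\<xi>. \<xi> 0 \<in> zero_sum \<and>
    (\<forall>t\<ge>0. (\<xi> has_vector_derivative transpose (Q \<theta>) *v \<xi> t) (at t within {0..})) \<longrightarrow>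
    norm1 (\<xi> S) \<le> e * norm1 (\<xi> 0)"
proof -
  obtain C g where C: "C \<ge> 1" and g: "g > 0" and
    path: "\<And>\<delta> \<eta> s t \<xi>s \<xi>t. \<delta> > 0 \<Longrightarrow> \<eta> \<in> borel_measurable (lebesgue_on {0..}) \<Longrightarrow>
      (\<And>t. t \<ge> 0 \<Longrightarrow> \<eta> t \<in> \<Theta>) \<Longrightarrow> 0 \<le> s \<Longrightarrow> s \<le> t \<Longrightarrow> \<xi>s \<in> zero_sum \<Longrightarrow>
      evolves Q \<delta> \<eta> s t \<xi>s \<xi>t \<Longrightarrow> norm1 \<xi>t \<le> C * exp (- g * (t - s) / \<delta>) * norm1 \<xi>s"
    using pathwise_stability by metis
  \<comment> \<open>The second entry solves \<open>C * exp (- g * S) = e\<close>; the maximum keeps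
    \<open>S\<close> positive when \<open>e\<close> is large.\<close>
  define S where "S = max 1 (ln (C / e) / g)"
  have S: "S > 0" by (simp add: S_def)
  have "ln (C / e) / g \<le> S" by (simp add: S_def)
  then have "- g * S \<le> - ln (C / e)" using g by (simp add: field_simps)
  then have "C * exp (- g * S) \<le> C * exp (- ln (C / e))" using C by (intro mult_left_mono) auto
  also have "\<dots> = e" using C e by (simp add: exp_minus)
  finally have le: "C * exp (- g * S) \<le> e" .
  have "norm1 (\<xi> S) \<le> e * norm1 (\<xi> 0)"
    if "\<theta> \<in> \<Theta>" "\<xi> 0 \<in> zero_sum"
      and "\<And>t. t \<ge> 0 \<Longrightarrow> (\<xi> has_vector_derivative transpose (Q \<theta>) *v \<xi> t) (at t within {0..})"
    for \<theta> \<xi>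
  proof -
    have "norm1 (\<xi> S) \<le> C * exp (- g * (S - 0) / 1) * norm1 (\<xi> 0)"
    proof (rule path)
      show "evolves Q 1 (\<lambda>_. \<theta>) 0 S (\<xi> 0) (\<xi> S)"
        by (rule evolves_constI) (use that S in \<open>simp_all only: less_imp_le\<close>)
    qed (use that S in simp_all)
    also have "\<dots> \<le> e * norm1 (\<xi> 0)"
      using le by (intro mult_right_mono) (auto simp: norm1_def sum_nonneg)
    finally show ?thesis .
  qed
  then show ?thesis using S by blast
qed

lemma Q_kernel_zero_sum:
  assumes "\<theta> \<in> \<Theta>" "\<xi> \<in> zero_sum" "transpose (Q \<theta>) *v \<xi> = 0"
  shows "\<xi> = 0"
proof -
  obtain S where S: "\<And>\<zeta>. \<zeta> 0 \<in> zero_sum \<Longrightarrow>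
    (\<And>t. t\<ge>0 \<Longrightarrow> (\<zeta> has_vector_derivative transpose (Q \<theta>) *v \<zeta> t) (at t within {0..})) \<Longrightarrow>
    norm1 (\<zeta> S) \<le> 1 / 2 * norm1 (\<zeta> 0)"
    using frozen_decay[of "1 / 2"] assms(1) by auto
  have "norm1 \<xi> \<le> 1 / 2 * norm1 \<xi>"
    by (rule S[of "\<lambda>_. \<xi>"]) (use assms(2,3) has_vector_derivative_const in metis)+
  then have "norm \<xi> \<le> 0" using norm_le_norm1[of \<xi>] by linarith
  then show ?thesis by simp
qed

text \<open>For small \<open>h\<close> the identity plus \<open>h\<close> times the generator is a
  stochastic matrix: off-diagonal entries only add mass, the diagonal removes at most all of it, and
  the rows of the generator sum to 0. This serves both the subtangent condition and the existence of
  a stationary distribution.\<close>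

lemma prob_simplex_step:
  assumes \<theta>: "\<theta> \<in> \<Theta>" and \<mu>: "\<mu> \<in> prob_simplex"
    and h: "0 \<le> h" "h * (1 + (\<Sum>i\<in>UNIV. \<bar>Q \<theta> $ i $ i\<bar>)) \<le> 1"
  shows "\<mu> + h *\<^sub>R (transpose (Q \<theta>) *v \<mu>) \<in> prob_simplex"
  unfolding prob_simplex_def
proof (intro CollectI conjI allI)
  fix i
  have m: "\<mu> $ j \<ge> 0" for j using \<mu> by (simp add: prob_simplex_def)
  have "\<bar>Q \<theta> $ i $ i\<bar> \<le> (\<Sum>i\<in>UNIV. \<bar>Q \<theta> $ i $ i\<bar>)" by (rule member_le_sum) auto
  then have "h * \<bar>Q \<theta> $ i $ i\<bar> \<le> 1"
    using h mult_left_mono[of "\<bar>Q \<theta> $ i $ i\<bar>" "1 + (\<Sum>i\<in>UNIV. \<bar>Q \<theta> $ i $ i\<bar>)" h] by linarith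
  moreover have "- (h * \<bar>Q \<theta> $ i $ i\<bar>) \<le> h * Q \<theta> $ i $ i"
    using h mult_left_mono[of "- \<bar>Q \<theta> $ i $ i\<bar>" "Q \<theta> $ i $ i" h] by simp
  ultimately have "0 \<le> \<mu> $ i * (1 + h * Q \<theta> $ i $ i)" using m by simp
  moreover have "0 \<le> h * (\<Sum>j\<in>UNIV - {i}. Q \<theta> $ j $ i * \<mu> $ j)"
    using h m generator_offdiag[OF \<theta>] by (intro mult_nonneg_nonneg sum_nonneg) auto
  moreover have "(transpose (Q \<theta>) *v \<mu>) $ i
      = Q \<theta> $ i $ i * \<mu> $ i + (\<Sum>j\<in>UNIV - {i}. Q \<theta> $ j $ i * \<mu> $ j)"
    unfolding transpose_Q_nth by (rule sum.remove) auto
  ultimately show "0 \<le> (\<mu> + h *\<^sub>R (transpose (Q \<theta>) *v \<mu>)) $ i"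
    by (simp only: vector_add_component vector_scaleR_component real_scaleR_def) (simp add: algebra_simps)
next
  have row: "(\<Sum>i\<in>UNIV. Q \<theta> $ j $ i) = 0" for j
    using generator_diag[OF \<theta>, of j] sum.remove[of UNIV j "\<lambda>i. Q \<theta> $ j $ i"] by simp
  have "(\<Sum>i\<in>UNIV. (transpose (Q \<theta>) *v \<mu>) $ i) = (\<Sum>j\<in>UNIV. \<Sum>i\<in>UNIV. Q \<theta> $ j $ i * \<mu> $ j)"
    unfolding transpose_Q_nth by (rule sum.swap)
  also have "\<dots> = 0" by (simp add: sum_distrib_right[symmetric] row)
  finally show "(\<Sum>i\<in>UNIV. (\<mu> + h *\<^sub>R (transpose (Q \<theta>) *v \<mu>)) $ i) = 1"
    using \<mu> by (simp only: vector_add_component vector_scaleR_component real_scaleR_def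
        sum.distrib sum_distrib_left[symmetric]) (simp add: prob_simplex_def)
qed

text \<open>Existence is Brouwer's theorem for the stochastic step on the simplex, whose fixed
  points are kernel vectors. For uniqueness, the difference of two candidates is a kernel vector in
  \<open>zero_sum\<close>.\<close>

lemma stationary:
  assumes \<theta>: "\<theta> \<in> \<Theta>"
  shows "stationary Q \<theta> \<in> prob_simplex" "transpose (Q \<theta>) *v stationary Q \<theta> = 0"
proof -
  define H where "H = 1 + (\<Sum>i\<in>UNIV. \<bar>Q \<theta> $ i $ i\<bar>)"
  have H: "H > 0" unfolding H_def by (intro add_pos_nonneg sum_nonneg) auto
  have "(\<lambda>\<mu>. \<mu> + (1 / H) *\<^sub>R (transpose (Q \<theta>) *v \<mu>)) \<in> prob_simplex \<rightarrow> prob_simplex"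
    using prob_simplex_step[OF \<theta>, of _ "1 / H"] H unfolding H_def[symmetric] by auto
  moreover have "continuous_on prob_simplex (\<lambda>\<mu>. \<mu> + (1 / H) *\<^sub>R (transpose (Q \<theta>) *v \<mu>))"
    by (intro continuous_on_add continuous_on_id continuous_on_scaleR continuous_on_const
        matrix_vector_mult_linear_continuous_on)
  ultimately obtain \<mu> where "\<mu> \<in> prob_simplex" "\<mu> + (1 / H) *\<^sub>R (transpose (Q \<theta>) *v \<mu>) = \<mu>"
    using brouwer[OF compact_prob_simplex convex_prob_simplex prob_simplex_nonempty,
        of "\<lambda>\<mu>. \<mu> + (1 / H) *\<^sub>R (transpose (Q \<theta>) *v \<mu>)"] by blast
  then have \<mu>: "\<mu> \<in> prob_simplex" "transpose (Q \<theta>) *v \<mu> = 0" using H by auto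
  have "\<exists>!\<mu>. \<mu> \<in> prob_simplex \<and> transpose (Q \<theta>) *v \<mu> = 0"
  proof (rule ex1I[of _ \<mu>])
    fix \<nu> assume \<nu>: "\<nu> \<in> prob_simplex \<and> transpose (Q \<theta>) *v \<nu> = 0"
    then have "transpose (Q \<theta>) *v (\<nu> - \<mu>) = 0" using \<mu> by (simp only: matrix_vector_mult_diff_distrib) simp
    then have "\<nu> - \<mu> = 0"
      using Q_kernel_zero_sum[OF \<theta>] diff_prob_simplex(1) \<nu> \<mu> by blast
    then show "\<nu> = \<mu>" by simp
  qed (use \<mu> in blast)
  from theI'[OF this] show "stationary Q \<theta> \<in> prob_simplex" "transpose (Q \<theta>) *v stationary Q \<theta> = 0"
    unfolding stationary_def by auto
qed

lemma bounded_lipschitz_Q_mult_Times: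
  assumes "bounded M"
  shows "bounded_lipschitz (\<Theta> \<times> M) (\<lambda>(\<theta>, \<mu>). transpose (Q \<theta>) *v \<mu>)"
proof -
  have b: "bounded (\<Theta> \<times> M)"
    using assms compact_imp_bounded[OF compact_Theta] by (intro bounded_Times)
  show ?thesis unfolding split_beta
    by (rule bounded_lipschitz_Q_mult) (use bounded_lipschitz_fst_snd[OF b] in auto)
qed

text \<open>By compactness of the set of pairs \<open>(\<theta>, \<xi>)\<close> with \<open>\<parallel>\<xi>\<parallel> = 1\<close>, on which \<open>Q\<^sub>\<theta>\<^sup>* \<xi>\<close> does not vanish.\<close>

lemma zero_sum_norm_bound:
  "\<exists>c>0. \<forall>\<theta>\<in>\<Theta>. \<forall>\<xi>\<in>zero_sum. norm \<xi> \<le> c * norm (transpose (Q \<theta>) *v \<xi>)"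
proof -
  define Z where "Z = \<Theta> \<times> (zero_sum \<inter> sphere (0::real^'n) 1)"
  have cl: "closed (zero_sum :: (real^'n) set)"
    unfolding zero_sum_def by (intro closed_Collect_eq continuous_intros)
  have Z: "compact Z"
    unfolding Z_def using compact_Int_closed[OF compact_sphere cl, of 0 1]
    by (intro compact_Times compact_Theta) (simp add: Int_commute)
  have cont: "continuous_on Z (\<lambda>x. norm (case x of (\<theta>, \<xi>) \<Rightarrow> transpose (Q \<theta>) *v \<xi>))"
    unfolding Z_def
    by (intro continuous_on_norm bounded_lipschitz_continuous_on bounded_lipschitz_Q_mult_Times
        bounded_Int) auto
  have "\<exists>m>0. \<forall>(\<theta>, \<xi>)\<in>Z. m \<le> norm (transpose (Q \<theta>) *v \<xi>)"
  \<comment> \<open>With a single state \<open>zero_sum\<close> contains only 0 and \<open>Z\<close>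
    is empty, so there is no minimum to take.\<close>
  proof (cases "Z = {}")
    case False
    then obtain z where z: "z \<in> Z" "\<And>y. y \<in> Z \<Longrightarrow>
        norm (case z of (\<theta>, \<xi>) \<Rightarrow> transpose (Q \<theta>) *v \<xi>) \<le> norm (case y of (\<theta>, \<xi>) \<Rightarrow> transpose (Q \<theta>) *v \<xi>)"
      using continuous_attains_inf[OF Z _ cont] by metis
    have "norm (case z of (\<theta>, \<xi>) \<Rightarrow> transpose (Q \<theta>) *v \<xi>) > 0"
      using z(1) Q_kernel_zero_sum unfolding Z_def zero_less_norm_iff by fastforce
    then show ?thesis using z(2) by (intro exI[of _ "norm (case z of (\<theta>, \<xi>) \<Rightarrow> transpose (Q \<theta>) *v \<xi>)"]) fastforce
  qed (use zero_less_one in blast)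
  then obtain m where m: "m > 0" "\<And>\<theta> \<xi>. (\<theta>, \<xi>) \<in> Z \<Longrightarrow> m \<le> norm (transpose (Q \<theta>) *v \<xi>)" by auto
  have "norm \<xi> \<le> 1 / m * norm (transpose (Q \<theta>) *v \<xi>)"
    if "\<theta> \<in> \<Theta>" "\<xi> \<in> zero_sum" for \<theta> \<xi>
  proof (cases "\<xi> = 0")
    case False
    have "(1 / norm \<xi>) *\<^sub>R \<xi> \<in> zero_sum \<inter> sphere 0 1"
      using that False by (simp add: zero_sum_def sum_divide_distrib[symmetric])
    then have "m \<le> norm (transpose (Q \<theta>) *v ((1 / norm \<xi>) *\<^sub>R \<xi>))"
      using that m unfolding Z_def by blast
    also have "\<dots> = norm (transpose (Q \<theta>) *v \<xi>) / norm \<xi>"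
      by (simp only: matrix_vector_mult_scaleR norm_scaleR) simp
    finally show ?thesis using False m by (simp add: field_simps)
  qed simp
  then show ?thesis using m(1) by (intro exI[of _ "1 / m"]) auto
qed

text \<open>Applying the generator at \<open>\<theta>\<close> to the difference of the two
  stationary distributions leaves only the difference of the generators applied to the second one,
  which is at most \<open>L * dist \<theta> \<theta>'\<close>. The inverse bound on
  \<open>zero_sum\<close> converts this into a bound on the difference itself.\<close>

lemma bounded_lipschitz_stationary: "bounded_lipschitz (\<Theta>) (stationary Q)"
proof -
  obtain c where c: "c > 0" "\<And>\<theta> \<xi>. \<theta> \<in> \<Theta> \<Longrightarrow> \<xi> \<in> zero_sum \<Longrightarrow>
      norm \<xi> \<le> c * norm (transpose (Q \<theta>) *v \<xi>)"
    using zero_sum_norm_bound by blast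
  obtain L where L: "L-lipschitz_on (\<Theta> \<times> prob_simplex) (\<lambda>(\<theta>, \<mu>). transpose (Q \<theta>) *v \<mu>)"
    using bounded_lipschitz_Q_mult_Times[OF compact_imp_bounded[OF compact_prob_simplex]]
      bounded_lipschitz_lipschitz by blast
  have "(c * L)-lipschitz_on (\<Theta>) (stationary Q)"
  proof (rule lipschitz_onI)
    fix \<theta> \<theta>' assume \<theta>: "\<theta> \<in> \<Theta>" "\<theta>' \<in> \<Theta>"
    note s = stationary[OF \<theta>(1)] stationary[OF \<theta>(2)]
    have "transpose (Q \<theta>) *v (stationary Q \<theta> - stationary Q \<theta>')
        = transpose (Q \<theta>') *v stationary Q \<theta>' - transpose (Q \<theta>) *v stationary Q \<theta>'"
      by (simp only: matrix_vector_mult_diff_distrib s)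
    also have "norm \<dots> \<le> L * norm ((\<theta>', stationary Q \<theta>') - (\<theta>, stationary Q \<theta>'))"
      using lipschitz_on_normD[OF L, of "(\<theta>', stationary Q \<theta>')" "(\<theta>, stationary Q \<theta>')"] \<theta> s by simp
    finally have "norm (transpose (Q \<theta>) *v (stationary Q \<theta> - stationary Q \<theta>')) \<le> L * dist \<theta> \<theta>'"
      by (simp add: dist_norm norm_minus_commute)
    then show "dist (stationary Q \<theta>) (stationary Q \<theta>') \<le> c * L * dist \<theta> \<theta>'"
      using c(2)[OF \<theta>(1) diff_prob_simplex(1)[OF s(1,3)]] c(1)
      by (simp add: dist_norm mult.assoc) (meson less_imp_le mult_left_mono order_trans)
  qed (use c lipschitz_on_nonneg[OF L] in simp)
  then show ?thesis using compact_Theta compact_imp_bounded bounded_lipschitz_of_bounded by blast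
qed

section \<open>The exact and the reduced field\<close>

abbreviation R0 :: real where "R0 \<equiv> radius_w lam r \<phi>"

abbreviation X :: "((real^'d) \<times> (real^'m) \<times> (real^'n)) set" where "X \<equiv> state_space R\<theta>"

text \<open>The part of the exact field that does not involve \<open>\<delta>\<close>, so its bounds
  and Lipschitz constants on \<open>K\<close> hold for all \<open>\<delta>\<close> at once. The
  reduced field is \<open>slow\<close> restricted to the range of \<open>lift\<close>, the critical
  manifold of the fast equation.\<close>

definition slow :: "(real^'d) \<times> (real^'m) \<times> (real^'n) \<Rightarrow> (real^'d) \<times> (real^'m)" where
  "slow x = (actor_G R\<theta> \<tau> r \<psi> \<phi> (fst x) (fst (snd x)) (snd (snd x)),
     critic_b \<tau> r \<psi> \<phi> (fst x) (snd (snd x)) - critic_A \<tau> lam \<psi> \<phi> (fst x) (snd (snd x)) *v fst (snd x))"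

definition lift :: "(real^'d) \<times> (real^'m) \<Rightarrow> (real^'d) \<times> (real^'m) \<times> (real^'n)" where
  "lift y = (fst y, snd y, stationary Q (fst y))"

lemma exact_field_eq: "exact_field R\<theta> \<tau> lam r \<psi> \<phi> Q \<delta> x
    = (fst (slow x), snd (slow x), (1 / \<delta>) *\<^sub>R (transpose (Q (fst x)) *v snd (snd x)))"
  by (simp add: exact_field_def slow_def split_beta)

lemma reduced_field_eq: "reduced_field R\<theta> \<tau> lam r \<psi> \<phi> Q y = slow (lift y)"
  by (simp add: reduced_field_def slow_def lift_def split_beta)

lemma bounded_lipschitz_components:
  assumes "bounded S"
  shows "bounded_lipschitz S (\<lambda>x. fst x)" "bounded_lipschitz S (\<lambda>x. fst (snd x))"
    "bounded_lipschitz S (\<lambda>x. snd (snd x))"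
  using bounded_lipschitz_fst_snd[OF assms]
  by (auto intro: bounded_lipschitz_linear[OF bounded_linear_fst] bounded_lipschitz_linear[OF bounded_linear_snd])

lemma bounded_lipschitz_slow: "bounded S \<Longrightarrow> bounded_lipschitz S slow"
  unfolding slow_def[abs_def]
  by (intro bounded_lipschitz_Pair bounded_lipschitz_actor_G bounded_lipschitz_critic
      bounded_lipschitz_components)

lemma bounded_lipschitz_exact_field:
  assumes "bounded S" "fst ` S \<subseteq> \<Theta>"
  shows "bounded_lipschitz S (exact_field R\<theta> \<tau> lam r \<psi> \<phi> Q \<delta>)"
  unfolding exact_field_eq[abs_def]
  by (intro bounded_lipschitz_Pair bounded_lipschitz_linear[OF bounded_linear_fst]
      bounded_lipschitz_linear[OF bounded_linear_snd] bounded_lipschitz_slow assms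
      bounded_lipschitz_linear[OF bounded_linear_scaleR_right] bounded_lipschitz_Q_mult
      bounded_lipschitz_components)

lemma bounded_lipschitz_lift:
  assumes "bounded S" "fst ` S \<subseteq> \<Theta>"
  shows "bounded_lipschitz S lift"
  unfolding lift_def[abs_def]
  by (intro bounded_lipschitz_Pair bounded_lipschitz_fst_snd assms
      bounded_lipschitz_compose[OF bounded_lipschitz_stationary])

lemma bounded_lipschitz_reduced_field:
  assumes "bounded S" "fst ` S \<subseteq> \<Theta>"
  shows "bounded_lipschitz S (reduced_field R\<theta> \<tau> lam r \<psi> \<phi> Q)"
proof -
  have "bounded (lift ` S)" using bounded_lipschitz_lift[OF assms] by (simp add: bounded_lipschitz_def)
  then show ?thesis
    unfolding reduced_field_eq[abs_def]
    by (rule bounded_lipschitz_compose[OF bounded_lipschitz_slow bounded_lipschitz_lift[OF assms] order_refl])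
qed

lemma slow_dissipative:
  "snd (snd x) \<in> prob_simplex \<Longrightarrow> fst (snd x) \<bullet> snd (slow x)
    \<le> reward_feature_bound r \<phi> * norm (fst (snd x)) - lam * (norm (fst (snd x)))\<^sup>2"
  unfolding slow_def snd_conv by (rule critic_dissipative)

lemma Theta_nonempty: "\<Theta> \<noteq> {}"
proof -
  have "0 \<in> \<Theta>" using pos by (simp add: Theta_def)
  then show ?thesis by blast
qed

lemma R0_pos: "0 < R0"
  by (simp add: radius_w_eq)

lemma exact_slice_eq: "{x \<in> X. norm (fst (snd x)) \<le> R} = \<Theta> \<times> cball 0 R \<times> prob_simplex"
  by (auto simp: state_space_def)

lemma bounded_exact_slice: "bounded (\<Theta> \<times> cball (0::real^'m) R \<times> (prob_simplex :: (real^'n) set))"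
  by (intro bounded_Times bounded_cball compact_imp_bounded compact_Theta compact_prob_simplex)

lemma reduced_slice_eq: "{y \<in> \<Theta> \<times> UNIV. norm (snd y) \<le> R} = \<Theta> \<times> cball 0 R"
  by auto

lemma bounded_reduced_slice: "bounded (\<Theta> \<times> cball (0::real^'m) R)"
  by (intro bounded_Times bounded_cball compact_imp_bounded compact_Theta)

lemma slow_Theta_step:
  assumes "fst x \<in> \<Theta>"
  obtains H where "H > 0" "\<And>h. 0 \<le> h \<Longrightarrow> h * H \<le> 1 \<Longrightarrow> fst x + h *\<^sub>R fst (slow x) \<in> \<Theta>"
proof -
  let ?g = "actor_G_tilde \<tau> r \<psi> \<phi> (fst x) (fst (snd x)) (snd (snd x))"
  show ?thesis
  proof (rule that[of "2 * R\<theta> * (1 + norm ?g)"])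
    show "0 < 2 * R\<theta> * (1 + norm ?g)" using pos by (simp add: add_pos_nonneg)
  qed (use Theta_step[OF assms] in \<open>simp add: slow_def\<close>)
qed

lemma exact_dissipative_field:
  assumes \<delta>: "\<delta> > 0"
  shows "dissipative_field X (exact_field R\<theta> \<tau> lam r \<psi> \<phi> Q \<delta>) (\<lambda>x. fst (snd x))
    (reward_feature_bound r \<phi>) lam R0"
proof (rule dissipative_field.intro)
  show "closed X" "convex X"
    unfolding state_space_def
    by (intro closed_Times convex_Times compact_imp_closed compact_Theta compact_prob_simplex
        convex_Theta convex_prob_simplex closed_UNIV convex_UNIV)+
  show "bounded_linear (\<lambda>x::(real^'d) \<times> (real^'m) \<times> (real^'n). fst (snd x))"
    by (rule bounded_linear_compose[OF bounded_linear_fst bounded_linear_snd])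
  show "bounded {x \<in> X. norm (fst (snd x)) \<le> R}" for R
    unfolding exact_slice_eq by (rule bounded_exact_slice)
  show "\<exists>L. L-lipschitz_on {x \<in> X. norm (fst (snd x)) \<le> R} (exact_field R\<theta> \<tau> lam r \<psi> \<phi> Q \<delta>)" for R
    unfolding exact_slice_eq
    by (intro bounded_lipschitz_lipschitz bounded_lipschitz_exact_field bounded_exact_slice) auto
  show "lam > 0" by (rule pos)
  show "0 \<le> reward_feature_bound r \<phi>" by (rule reward_feature_bound_nonneg)
  show "reward_feature_bound r \<phi> / lam < R0" using radius_w_gt pos by blast
  show "{x \<in> X. norm (fst (snd x)) \<le> R0} \<noteq> {}"
    unfolding exact_slice_eq using Theta_nonempty prob_simplex_nonempty R0_pos by auto
  fix x assume x: "x \<in> X"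
  then have x': "fst x \<in> \<Theta>" "snd (snd x) \<in> prob_simplex" by (auto simp: state_space_def)
  show "fst (snd x) \<bullet> fst (snd (exact_field R\<theta> \<tau> lam r \<psi> \<phi> Q \<delta> x))
      \<le> reward_feature_bound r \<phi> * norm (fst (snd x)) - lam * (norm (fst (snd x)))\<^sup>2"
    using slow_dissipative[OF x'(2)] by (simp add: exact_field_eq)
  obtain H where H: "H > 0" "\<And>h. 0 \<le> h \<Longrightarrow> h * H \<le> 1 \<Longrightarrow> fst x + h *\<^sub>R fst (slow x) \<in> \<Theta>"
    using slow_Theta_step[OF x'(1)] by blast
  define H' where "H' = 1 + (\<Sum>i\<in>UNIV. \<bar>Q (fst x) $ i $ i\<bar>)"
  have H': "H' > 0" unfolding H'_def by (intro add_pos_nonneg sum_nonneg) auto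
  \<comment> \<open>The simplex component moves at speed \<open>1 / \<delta>\<close>, so its
    admissible step shrinks to \<open>\<delta> / H'\<close>.\<close>
  define h where "h = min (1 / H) (\<delta> / H')"
  have h: "h > 0" using H H' \<delta> by (simp add: h_def)
  have "h \<le> 1 / H" "h \<le> \<delta> / H'" by (simp_all add: h_def)
  then have "h * H \<le> 1" "(h / \<delta>) * H' \<le> 1" using H H' \<delta> by (simp_all add: field_simps)
  then have "fst x + h *\<^sub>R fst (slow x) \<in> \<Theta>"
    "snd (snd x) + (h / \<delta>) *\<^sub>R (transpose (Q (fst x)) *v snd (snd x)) \<in> prob_simplex"
    using H(2)[of h] prob_simplex_step[OF x', of "h / \<delta>"] h \<delta> by (simp_all only: H'_def[symmetric]) simp_all
  then have "x + h *\<^sub>R exact_field R\<theta> \<tau> lam r \<psi> \<phi> Q \<delta> x \<in> X"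
    by (cases x) (simp add: exact_field_eq state_space_def mem_Times_iff divide_inverse)
  then show "\<exists>h>0. x + h *\<^sub>R exact_field R\<theta> \<tau> lam r \<psi> \<phi> Q \<delta> x \<in> X" using h by blast
qed

lemma reduced_dissipative_field:
  "dissipative_field (\<Theta> \<times> (UNIV :: (real^'m) set)) (reduced_field R\<theta> \<tau> lam r \<psi> \<phi> Q) snd
    (reward_feature_bound r \<phi>) lam R0"
proof (rule dissipative_field.intro)
  show "closed (\<Theta> \<times> (UNIV :: (real^'m) set))" "convex (\<Theta> \<times> (UNIV :: (real^'m) set))"
    by (intro closed_Times convex_Times compact_imp_closed compact_Theta
        convex_Theta closed_UNIV convex_UNIV)+
  show "bounded {y \<in> \<Theta> \<times> (UNIV :: (real^'m) set). norm (snd y) \<le> R}" for R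
    unfolding reduced_slice_eq by (rule bounded_reduced_slice)
  show "\<exists>L. L-lipschitz_on {y \<in> \<Theta> \<times> UNIV. norm (snd y) \<le> R} (reduced_field R\<theta> \<tau> lam r \<psi> \<phi> Q)" for R
    unfolding reduced_slice_eq
    by (intro bounded_lipschitz_lipschitz bounded_lipschitz_reduced_field bounded_reduced_slice) auto
  show "lam > 0" by (rule pos)
  show "0 \<le> reward_feature_bound r \<phi>" by (rule reward_feature_bound_nonneg)
  show "reward_feature_bound r \<phi> / lam < R0" using radius_w_gt pos by blast
  show "{y \<in> \<Theta> \<times> UNIV. norm (snd y :: real^'m) \<le> R0} \<noteq> {}"
    unfolding reduced_slice_eq using Theta_nonempty R0_pos by auto
  fix y :: "(real^'d) \<times> (real^'m)" assume "y \<in> \<Theta> \<times> UNIV"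
  then have y: "fst (lift y) \<in> \<Theta>" "snd (snd (lift y)) \<in> prob_simplex"
    using stationary by (auto simp: lift_def)
  show "snd y \<bullet> snd (reduced_field R\<theta> \<tau> lam r \<psi> \<phi> Q y)
      \<le> reward_feature_bound r \<phi> * norm (snd y) - lam * (norm (snd y))\<^sup>2"
    using slow_dissipative[OF y(2)] by (simp add: reduced_field_eq) (simp add: lift_def)
  obtain H where H: "H > 0" "\<And>h. 0 \<le> h \<Longrightarrow> h * H \<le> 1 \<Longrightarrow> fst y + h *\<^sub>R fst (slow (lift y)) \<in> \<Theta>"
    using slow_Theta_step[OF y(1)] unfolding lift_def fst_conv by blast
  then have "y + (1 / H) *\<^sub>R reduced_field R\<theta> \<tau> lam r \<psi> \<phi> Q y \<in> \<Theta> \<times> UNIV"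
    using H(2)[of "1 / H"] by (simp add: reduced_field_eq mem_Times_iff)
  then show "\<exists>h>0. y + h *\<^sub>R reduced_field R\<theta> \<tau> lam r \<psi> \<phi> Q y \<in> \<Theta> \<times> UNIV"
    using H(1) by (intro exI[of _ "1 / H"]) simp
qed (rule bounded_linear_snd)

section \<open>The two attractors\<close>

abbreviation K :: "((real^'d) \<times> (real^'m) \<times> (real^'n)) set" where "K \<equiv> set_K R\<theta> lam r \<phi>"

definition exact_attractor :: "real \<Rightarrow> ((real^'d) \<times> (real^'m) \<times> (real^'n)) set" where
  "exact_attractor \<delta> = omega_limit (exact_semiflow R\<theta> \<tau> lam r \<psi> \<phi> Q \<delta>) K"

text \<open>The field depends on \<open>\<delta>\<close>, so the dissipative locale is interpreted
  inside the proof and the facts needed later are exported. Solutions remain in \<open>K\<close>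
  because \<open>K\<close> is the slice of radius \<open>R0\<close>.\<close>

lemma exact_attractor:
  assumes \<delta>: "\<delta> > 0"
  shows "compact_global_attractor X dX (exact_semiflow R\<theta> \<tau> lam r \<psi> \<phi> Q \<delta>) (exact_attractor \<delta>)"
    and "exact_attractor \<delta> \<subseteq> K"
    and "0 \<le> t \<Longrightarrow> exact_semiflow R\<theta> \<tau> lam r \<psi> \<phi> Q \<delta> t ` exact_attractor \<delta> = exact_attractor \<delta>"
    and "x \<in> K \<Longrightarrow> solution_in K (exact_field R\<theta> \<tau> lam r \<psi> \<phi> Q \<delta>)
      (\<lambda>t. exact_semiflow R\<theta> \<tau> lam r \<psi> \<phi> Q \<delta> t x) \<and> exact_semiflow R\<theta> \<tau> lam r \<psi> \<phi> Q \<delta> 0 x = x"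
proof -
  interpret E: dissipative_field X "exact_field R\<theta> \<tau> lam r \<psi> \<phi> Q \<delta>" "\<lambda>x. fst (snd x)"
    "reward_feature_bound r \<phi>" lam R0
    by (rule exact_dissipative_field[OF \<delta>])
  have K: "E.slice R0 = K" unfolding E.slice_def exact_slice_eq set_K_def ..
  note defs = exact_attractor_def exact_semiflow_def K[symmetric]
  show "compact_global_attractor X dX (exact_semiflow R\<theta> \<tau> lam r \<psi> \<phi> Q \<delta>) (exact_attractor \<delta>)"
    unfolding defs
    by (rule E.compact_global_attractor_omega_limit[OF Metric_space_dX dX_le_dist mbounded_dX])
  show "exact_attractor \<delta> \<subseteq> K" unfolding defs by (rule E.omega_limit_subset)
  show "exact_semiflow R\<theta> \<tau> lam r \<psi> \<phi> Q \<delta> t ` exact_attractor \<delta> = exact_attractor \<delta>" if "0 \<le> t"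
    unfolding defs by (rule E.omega_limit_invariant[OF that])
  show "solution_in K (exact_field R\<theta> \<tau> lam r \<psi> \<phi> Q \<delta>)
      (\<lambda>t. exact_semiflow R\<theta> \<tau> lam r \<psi> \<phi> Q \<delta> t x) \<and> exact_semiflow R\<theta> \<tau> lam r \<psi> \<phi> Q \<delta> 0 x = x" if "x \<in> K"
  proof -
    have x: "x \<in> E.slice R0" "x \<in> X" using that by (auto simp: K[symmetric] E.slice_def)
    then show ?thesis
      using E.solution_semiflow_of[OF x(2)] E.semiflow_of_slice[OF order_refl x(1)]
      unfolding exact_semiflow_def K[symmetric] solution_in_def by blast
  qed
qed

lemma reduced_attractor:
  assumes e: "e > 0"
  shows "\<exists>T\<ge>0. \<forall>y\<in>\<Theta> \<times> cball 0 R0. \<exists>z\<in>reduced_attractor R\<theta> \<tau> lam r \<psi> \<phi> Q.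
      dist (reduced_semiflow R\<theta> \<tau> lam r \<psi> \<phi> Q T y) z < e"
    and "y \<in> \<Theta> \<times> cball 0 R0 \<Longrightarrow> solution_in (\<Theta> \<times> cball 0 R0) (reduced_field R\<theta> \<tau> lam r \<psi> \<phi> Q)
      (\<lambda>t. reduced_semiflow R\<theta> \<tau> lam r \<psi> \<phi> Q t y) \<and> reduced_semiflow R\<theta> \<tau> lam r \<psi> \<phi> Q 0 y = y"
    and "reduced_attractor R\<theta> \<tau> lam r \<psi> \<phi> Q \<subseteq> \<Theta> \<times> cball 0 R0"
proof -
  interpret E: dissipative_field "\<Theta> \<times> (UNIV :: (real^'m) set)" "reduced_field R\<theta> \<tau> lam r \<psi> \<phi> Q" snd
    "reward_feature_bound r \<phi>" lam R0
    by (rule reduced_dissipative_field)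
  have K: "E.slice R0 = \<Theta> \<times> cball 0 R0" unfolding E.slice_def reduced_slice_eq ..
  note defs = reduced_attractor_def reduced_semiflow_def K[symmetric]
  show "\<exists>T\<ge>0. \<forall>y\<in>\<Theta> \<times> cball 0 R0. \<exists>z\<in>reduced_attractor R\<theta> \<tau> lam r \<psi> \<phi> Q.
      dist (reduced_semiflow R\<theta> \<tau> lam r \<psi> \<phi> Q T y) z < e"
    unfolding defs using E.omega_limit_attracts[OF e] by blast
  show "reduced_attractor R\<theta> \<tau> lam r \<psi> \<phi> Q \<subseteq> \<Theta> \<times> cball 0 R0"
    unfolding defs by (rule E.omega_limit_subset)
  show "solution_in (\<Theta> \<times> cball 0 R0) (reduced_field R\<theta> \<tau> lam r \<psi> \<phi> Q)
      (\<lambda>t. reduced_semiflow R\<theta> \<tau> lam r \<psi> \<phi> Q t y) \<and> reduced_semiflow R\<theta> \<tau> lam r \<psi> \<phi> Q 0 y = y"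
    if "y \<in> \<Theta> \<times> cball 0 R0"
  proof -
    have y: "y \<in> E.slice R0" "y \<in> \<Theta> \<times> UNIV" using that by (auto simp: K[symmetric] E.slice_def)
    then show ?thesis
      using E.solution_semiflow_of[OF y(2)] E.semiflow_of_slice[OF order_refl y(1)]
      unfolding reduced_semiflow_def K[symmetric] solution_in_def by blast
  qed
qed

lemma bounded_K: "bounded K"
  unfolding set_K_def by (rule bounded_exact_slice)

end

section \<open>Convergence of the attractors\<close>

context actor_critic
begin

text \<open>Over the time span \<open>\<delta> S\<close> the slow variable moves by \<open>O(\<delta> S)\<close>, so that \<open>\<mu>\<close> follows the
  evolution with frozen \<open>\<theta>\<close>, which has nearly relaxed to \<open>\<mu>\<^sub>\<theta>\<close> when \<open>S\<close> is large.\<close>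

lemma exact_attractor_near_stationary:
  assumes e: "e > 0"
  shows "\<exists>\<delta>0>0. \<forall>\<delta>. 0 < \<delta> \<and> \<delta> < \<delta>0 \<longrightarrow>
    (\<forall>x\<in>exact_attractor \<delta>. norm (snd (snd x) - stationary Q (fst x)) \<le> e)"
proof -
  \<comment> \<open>Two distributions differ by at most 2 in \<open>norm1\<close>, so the factor
    \<open>e / 6\<close> leaves \<open>e / 3\<close> after relaxation. The remaining
    \<open>2 * e / 3\<close> is the budget for the drift and determines the bound on
    \<open>\<delta>\<close>.\<close>
  obtain S where S: "S > 0" and decay: "\<And>\<theta> \<xi>. \<theta> \<in> \<Theta> \<Longrightarrow> \<xi> 0 \<in> zero_sum \<Longrightarrow>
    (\<And>t. t \<ge> 0 \<Longrightarrow> (\<xi> has_vector_derivative transpose (Q \<theta>) *v \<xi> t) (at t within {0..})) \<Longrightarrow>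
    norm1 (\<xi> S) \<le> e / 6 * norm1 (\<xi> 0)"
    using frozen_decay[of "e / 6"] e by auto
  obtain M where M: "M > 0" "\<And>x. x \<in> K \<Longrightarrow> norm (slow x) \<le> M"
    using bounded_lipschitz_bound[OF bounded_lipschitz_slow[OF bounded_K]] by metis
  obtain L where L: "L-lipschitz_on (\<Theta> \<times> prob_simplex) (\<lambda>(\<theta>, \<mu>). transpose (Q \<theta>) *v \<mu>)"
    using bounded_lipschitz_Q_mult_Times[OF compact_imp_bounded[OF compact_prob_simplex]]
      bounded_lipschitz_lipschitz by blast
  obtain Ls where Ls: "Ls-lipschitz_on \<Theta> (stationary Q)"
    using bounded_lipschitz_lipschitz[OF bounded_lipschitz_stationary] by blast
  have L0: "0 \<le> L" "0 \<le> Ls" using L Ls lipschitz_on_nonneg by blast+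
  define E where "E = exp ((2 * L + 1) * S / 2)"
  define A where "A = E * (L * (M * S)) + Ls * (M * S) + 1"
  have A: "A > 0" using L0 M S by (simp add: A_def E_def add_nonneg_pos)
  have "norm (snd (snd x) - stationary Q (fst x)) \<le> e"
    if \<delta>: "0 < \<delta>" "\<delta> < 2 * e / 3 / A" and x: "x \<in> exact_attractor \<delta>" for \<delta> x
  proof -
    let ?F = "exact_semiflow R\<theta> \<tau> lam r \<psi> \<phi> Q \<delta>"
    let ?f = "exact_field R\<theta> \<tau> lam r \<psi> \<phi> Q \<delta>"
    have "x \<in> ?F (\<delta> * S) ` exact_attractor \<delta>"
      using exact_attractor(3)[OF \<delta>(1), of "\<delta> * S"] x \<delta> S by simp
    then obtain x0 where x0: "x0 \<in> exact_attractor \<delta>" "x = ?F (\<delta> * S) x0" by blast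
    define y where "y s = ?F (\<delta> * s) x0" for s
    have "x0 \<in> K" using exact_attractor(2)[OF \<delta>(1)] x0 by blast
    from exact_attractor(4)[OF \<delta>(1) this] have sol: "solution_in K ?f (\<lambda>t. ?F t x0)" "?F 0 x0 = x0"
      by auto
    have yK: "y s \<in> K" if "0 \<le> s" for s
      using sol(1) that \<delta> unfolding solution_in_def y_def by simp
    then have yc: "fst (y s) \<in> \<Theta>" "snd (snd (y s)) \<in> prob_simplex" if "0 \<le> s" for s
      using that by (force simp: set_K_def)+
    have dy: "(y has_vector_derivative \<delta> *\<^sub>R ?f (y s)) (at s within {0..S})" if "s \<in> {0..S}" for s
    proof -
      have "((\<lambda>t. ?F t x0) has_vector_derivative ?f (y s)) (at (\<delta> * s) within (*) \<delta> ` {0..S})"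
        using sol(1)[unfolded solution_in_def, rule_format, of "\<delta> * s"] that \<delta>
        by (auto simp: y_def intro: has_vector_derivative_within_subset)
      then have "((\<lambda>t. ?F t x0) \<circ> (*) \<delta> has_vector_derivative \<delta> *\<^sub>R ?f (y s)) (at s within {0..S})"
        by (intro vector_diff_chain_within) (auto intro!: derivative_eq_intros)
      then show ?thesis by (simp add: o_def y_def[abs_def])
    qed
    have d\<theta>: "((\<lambda>s. fst (y s)) has_vector_derivative \<delta> *\<^sub>R fst (slow (y s))) (at s within {0..S})"
      if "s \<in> {0..S}" for s
      using bounded_linear.has_vector_derivative[OF bounded_linear_fst dy[OF that]]
      by (simp add: exact_field_eq)
    have d\<mu>: "((\<lambda>s. snd (snd (y s))) has_vector_derivative transpose (Q (fst (y s))) *v snd (snd (y s)))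
        (at s within {0..S})" if "s \<in> {0..S}" for s
      using bounded_linear.has_vector_derivative[OF bounded_linear_compose[OF bounded_linear_snd bounded_linear_snd]
          dy[OF that]] \<delta> by (simp add: exact_field_eq)
    have y_lip: "(\<delta> * M)-lipschitz_on {0..S} (\<lambda>s. fst (y s))"
    proof (rule lipschitz_on_has_vector_derivative[OF d\<theta>])
      fix s assume "s \<in> {0..S}"
      then have "norm (fst (slow (y s))) \<le> M"
        using M(2)[OF yK] norm_fst_le[of "fst (slow (y s))" "snd (slow (y s))"] by (force intro: order_trans)
      then show "norm (\<delta> *\<^sub>R fst (slow (y s))) \<le> \<delta> * M" using \<delta> by (simp add: mult_left_mono)
    qed (use \<delta> M in auto)
    have move: "dist (fst (y s)) (fst (y 0)) \<le> \<delta> * M * S" if "s \<in> {0..S}" for s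
    proof -
      have "dist (fst (y s)) (fst (y 0)) \<le> \<delta> * M * dist s 0"
        using S that by (intro lipschitz_onD[OF y_lip]) auto
      also have "\<dots> \<le> \<delta> * M * S" using \<delta> M that by (intro mult_left_mono) auto
      finally show ?thesis .
    qed
    define \<theta>0 where "\<theta>0 = fst (y 0)"
    have \<theta>0: "\<theta>0 \<in> \<Theta>" using yc by (simp add: \<theta>0_def)
    \<comment> \<open>The comparison flow starts from the same distribution, with the parameter
      frozen at the beginning of the past.\<close>
    obtain \<nu> where \<nu>: "solution_in prob_simplex (\<lambda>\<mu>. transpose (Q \<theta>0) *v \<mu>) \<nu>" "\<nu> 0 = snd (snd (y 0))"
    proof -
      have "\<exists>\<nu>. solution_in prob_simplex (\<lambda>\<mu>. transpose (Q \<theta>0) *v \<mu>) \<nu> \<and> \<nu> 0 = snd (snd (y 0))"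
      proof (rule subtangent_invariant_solution)
        show "L-lipschitz_on prob_simplex (\<lambda>\<mu>. transpose (Q \<theta>0) *v \<mu>)"
        proof (rule lipschitz_onI[OF _ L0(1)])
          fix \<mu> \<mu>' :: "real^'n" assume "\<mu> \<in> prob_simplex" "\<mu>' \<in> prob_simplex"
          then show "dist (transpose (Q \<theta>0) *v \<mu>) (transpose (Q \<theta>0) *v \<mu>') \<le> L * dist \<mu> \<mu>'"
            using lipschitz_onD[OF L, of "(\<theta>0, \<mu>)" "(\<theta>0, \<mu>')"] \<theta>0 by (simp add: dist_Pair_Pair)
        qed
        fix \<mu> :: "real^'n" assume \<mu>: "\<mu> \<in> prob_simplex"
        define H where "H = 1 + (\<Sum>i\<in>UNIV. \<bar>Q \<theta>0 $ i $ i\<bar>)"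
        have H: "H > 0" unfolding H_def by (intro add_pos_nonneg sum_nonneg) auto
        show "\<exists>h>0. \<mu> + h *\<^sub>R (transpose (Q \<theta>0) *v \<mu>) \<in> prob_simplex"
          using prob_simplex_step[OF \<theta>0 \<mu>, of "1 / H"] H unfolding H_def[symmetric]
          by (intro exI[of _ "1 / H"]) simp
      qed (use yc in \<open>auto intro: compact_imp_closed compact_prob_simplex convex_prob_simplex\<close>)
      then show ?thesis using that by blast
    qed
    have \<nu>d: "(\<nu> has_vector_derivative transpose (Q \<theta>0) *v \<nu> s) (at s within {0..})" "\<nu> s \<in> prob_simplex"
      if "0 \<le> s" for s
      using \<nu>(1) that unfolding solution_in_def by auto
    note st = stationary[OF \<theta>0]
    have "norm1 (\<nu> S - stationary Q \<theta>0) \<le> e / 6 * norm1 (\<nu> 0 - stationary Q \<theta>0)"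
    proof (rule decay[OF \<theta>0])
      show "\<nu> 0 - stationary Q \<theta>0 \<in> zero_sum" using diff_prob_simplex(1)[OF \<nu>d(2) st(1), of 0] by simp
      fix t :: real assume "0 \<le> t"
      then show "((\<lambda>t. \<nu> t - stationary Q \<theta>0) has_vector_derivative
          transpose (Q \<theta>0) *v (\<nu> t - stationary Q \<theta>0)) (at t within {0..})"
        unfolding matrix_vector_mult_diff_distrib st(2)
        by (intro has_vector_derivative_diff \<nu>d has_vector_derivative_const)
    qed
    also have "\<dots> \<le> e / 6 * 2"
      using diff_prob_simplex(2)[OF \<nu>d(2) st(1), of 0] e by (intro mult_left_mono) auto
    finally have 1: "norm (\<nu> S - stationary Q \<theta>0) \<le> e / 3"
      using norm_le_norm1[of "\<nu> S - stationary Q \<theta>0"] by simp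
    \<comment> \<open>The freezing error is the source \<open>L * (\<delta> * M * S)\<close> of
      Gronwall's inequality, and the initial difference is 0.\<close>
    have "(norm (snd (snd (y S)) - \<nu> S))\<^sup>2
        \<le> exp ((2 * L + 1) * S) * ((norm (snd (snd (y 0)) - \<nu> 0))\<^sup>2 + (L * (\<delta> * M * S))\<^sup>2)"
    proof (rule gronwall_norm_sq[of S L "\<lambda>s. snd (snd (y s)) - \<nu> s"])
      fix s assume s: "0 \<le> s" "s \<le> S"
      show "((\<lambda>s. snd (snd (y s)) - \<nu> s) has_vector_derivative
          transpose (Q (fst (y s))) *v snd (snd (y s)) - transpose (Q \<theta>0) *v \<nu> s) (at s within {0..S})"
        using s by (intro has_vector_derivative_diff d\<mu> has_vector_derivative_within_subset[OF \<nu>d(1)]) auto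
      have "norm (transpose (Q (fst (y s))) *v snd (snd (y s)) - transpose (Q \<theta>0) *v \<nu> s)
          \<le> L * norm (fst (y s) - \<theta>0, snd (snd (y s)) - \<nu> s)"
        using lipschitz_on_normD[OF L, of "(fst (y s), snd (snd (y s)))" "(\<theta>0, \<nu> s)"] yc[OF s(1)] \<theta>0 \<nu>d(2)[OF s(1)]
        by simp
      also have "\<dots> \<le> L * (\<delta> * M * S + norm (snd (snd (y s)) - \<nu> s))"
        using move[of s] s norm_Pair_le[of "fst (y s) - \<theta>0" "snd (snd (y s)) - \<nu> s"] L0
        by (intro mult_left_mono) (auto simp: dist_norm \<theta>0_def)
      finally show "norm (transpose (Q (fst (y s))) *v snd (snd (y s)) - transpose (Q \<theta>0) *v \<nu> s)
          \<le> L * norm (snd (snd (y s)) - \<nu> s) + L * (\<delta> * M * S)"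
        by (simp add: algebra_simps)
    qed (use S L0 in auto)
    also have "\<dots> = (E * (L * (\<delta> * M * S)))\<^sup>2"
      by (simp add: \<nu>(2) E_def power_mult_distrib exp_double[symmetric])
    finally have 2: "norm (snd (snd (y S)) - \<nu> S) \<le> E * (L * (\<delta> * M * S))"
      by (rule power2_le_imp_le)
        (intro mult_nonneg_nonneg L0 less_imp_le[OF M(1)] less_imp_le[OF S] less_imp_le[OF \<delta>(1)], simp add: E_def)
    have "dist (stationary Q \<theta>0) (stationary Q (fst (y S))) \<le> Ls * dist \<theta>0 (fst (y S))"
      using lipschitz_onD[OF Ls \<theta>0 yc(1)] S by simp
    also have "\<dots> \<le> Ls * (\<delta> * M * S)"
      using move[of S] S L0 by (intro mult_left_mono) (auto simp: \<theta>0_def dist_commute)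
    finally have 3: "norm (stationary Q \<theta>0 - stationary Q (fst (y S))) \<le> Ls * (\<delta> * M * S)"
      by (simp add: dist_norm)
    have "y S = x" using x0 by (simp add: y_def)
    have "norm (snd (snd x) - stationary Q (fst x)) \<le>
        norm (snd (snd (y S)) - \<nu> S) + norm (\<nu> S - stationary Q \<theta>0)
        + norm (stationary Q \<theta>0 - stationary Q (fst (y S)))"
      unfolding \<open>y S = x\<close>
      using norm_triangle_ineq[of "snd (snd x) - \<nu> S" "\<nu> S - stationary Q \<theta>0"]
        norm_triangle_ineq[of "snd (snd x) - stationary Q \<theta>0" "stationary Q \<theta>0 - stationary Q (fst x)"]
      by simp
    also have "\<dots> \<le> E * (L * (\<delta> * M * S)) + e / 3 + Ls * (\<delta> * M * S)"
      using 1 2 3 by linarith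
    also have "\<dots> \<le> \<delta> * A + e / 3" using \<delta> by (simp add: A_def algebra_simps)
    also have "\<dots> \<le> e" using \<delta> A by (simp add: field_simps)
    finally show ?thesis .
  qed
  moreover have "2 * e / 3 / A > 0" using e A by simp
  ultimately show ?thesis by blast
qed

lemma exact_attractor_near_lifted:
  assumes e: "e > 0"
  shows "\<exists>\<delta>0>0. \<forall>\<delta>. 0 < \<delta> \<and> \<delta> < \<delta>0 \<longrightarrow>
    (\<forall>x\<in>exact_attractor \<delta>. \<exists>y\<in>lifted_attractor R\<theta> \<tau> lam r \<psi> \<phi> Q. dX x y \<le> e)"
proof -
  let ?KY = "\<Theta> \<times> cball (0::real^'m) R0"
  let ?g = "reduced_field R\<theta> \<tau> lam r \<psi> \<phi> Q"
  let ?G = "reduced_semiflow R\<theta> \<tau> lam r \<psi> \<phi> Q"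
  obtain L1 where L1: "L1-lipschitz_on K slow"
    using bounded_lipschitz_lipschitz[OF bounded_lipschitz_slow[OF bounded_K]] by blast
  have "fst ` ?KY \<subseteq> \<Theta>" by auto
  then obtain L2 where L2: "L2-lipschitz_on ?KY ?g"
    using bounded_lipschitz_lipschitz[OF bounded_lipschitz_reduced_field[OF bounded_reduced_slice]] by blast
  obtain Ls where Ls: "Ls-lipschitz_on \<Theta> (stationary Q)"
    using bounded_lipschitz_lipschitz[OF bounded_lipschitz_stationary] by blast
  have L0: "0 \<le> L1" "0 \<le> L2" "0 \<le> Ls" using L1 L2 Ls lipschitz_on_nonneg by blast+
  define C where "C = 2 + real CARD('n)"
  \<comment> \<open>In the end \<open>(\<theta>, w)\<close> is off by at most \<open>2 * e1\<close>,
    from Gronwall and from attraction, and \<open>\<mu>\<close> by at most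
    \<open>e1 + Ls * (2 * e1)\<close>. The sum is \<open>e1 * (3 + 2 * Ls)\<close>, and
    \<open>C\<close> converts it to \<open>dX\<close>.\<close>
  define e1 where "e1 = e / (C * (3 + 2 * Ls))"
  have C: "C > 0" by (simp add: C_def)
  have e1: "e1 > 0" using e C L0 by (simp add: e1_def)
  obtain T where T: "T \<ge> 0" "\<And>y. y \<in> ?KY \<Longrightarrow>
      \<exists>z\<in>reduced_attractor R\<theta> \<tau> lam r \<psi> \<phi> Q. dist (?G T y) z < e1"
    using reduced_attractor(1)[OF e1] by blast
  define E where "E = exp ((2 * L2 + 1) * T / 2)"
  \<comment> \<open>With \<open>(E * L1 + 1) * e2 = e1\<close>, both the propagated error
    \<open>E * (L1 * e2)\<close> and \<open>e2\<close> itself are at most \<open>e1\<close>.\<close>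
  define e2 where "e2 = e1 / (E * L1 + 1)"
  have E: "E > 0" by (simp add: E_def)
  have den: "E * L1 + 1 > 0" using E L0 by (simp add: add_nonneg_pos)
  have e2: "e2 > 0" using e1 den by (simp add: e2_def)
  have "(E * L1 + 1) * e2 = e1" using den by (simp add: e2_def)
  then have e2le: "E * (L1 * e2) \<le> e1" "e2 \<le> e1"
    using e2 E L0 by (auto simp: algebra_simps intro!: mult_nonneg_nonneg)
  obtain \<delta>0 where \<delta>0: "\<delta>0 > 0" and near: "\<And>\<delta> x. 0 < \<delta> \<Longrightarrow> \<delta> < \<delta>0 \<Longrightarrow> x \<in> exact_attractor \<delta> \<Longrightarrow>
      norm (snd (snd x) - stationary Q (fst x)) \<le> e2"
    using exact_attractor_near_stationary[OF e2] by blast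
  have "\<exists>y\<in>lifted_attractor R\<theta> \<tau> lam r \<psi> \<phi> Q. dX x y \<le> e"
    if \<delta>: "0 < \<delta>" "\<delta> < \<delta>0" and x: "x \<in> exact_attractor \<delta>" for \<delta> x
  proof -
    let ?F = "exact_semiflow R\<theta> \<tau> lam r \<psi> \<phi> Q \<delta>"
    let ?f = "exact_field R\<theta> \<tau> lam r \<psi> \<phi> Q \<delta>"
    define p where "p x = (fst x, fst (snd x))" for x :: "(real^'d) \<times> (real^'m) \<times> (real^'n)"
    have "x \<in> ?F T ` exact_attractor \<delta>"
      using exact_attractor(3)[OF \<delta>(1) T(1)] x by simp
    then obtain x0 where x0: "x0 \<in> exact_attractor \<delta>" "x = ?F T x0" by blast
    have "x0 \<in> K" using exact_attractor(2)[OF \<delta>(1)] x0 by blast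
    from exact_attractor(4)[OF \<delta>(1) this] have sol: "solution_in K ?f (\<lambda>t. ?F t x0)" "?F 0 x0 = x0"
      by auto
    define y0 where "y0 = p x0"
    have y0: "y0 \<in> ?KY" using \<open>x0 \<in> K\<close> by (auto simp: y0_def p_def set_K_def)
    from reduced_attractor(2)[OF e1 y0]
    have red: "solution_in ?KY ?g (\<lambda>t. ?G t y0)" "?G 0 y0 = y0" by auto
    \<comment> \<open>Closeness to the stationary distribution is known on the attractor only;
      invariance makes it available along the whole trajectory, not just at its end.\<close>
    have inA: "?F t x0 \<in> exact_attractor \<delta>" if "0 \<le> t" for t
      using exact_attractor(3)[OF \<delta>(1) that] x0 by blast
    have p: "bounded_linear p"
      unfolding p_def[abs_def]
      by (intro bounded_linear_Pair bounded_linear_fst bounded_linear_fst_comp bounded_linear_snd)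
    have "(norm (p (?F T x0) - ?G T y0))\<^sup>2
      \<le> exp ((2 * L2 + 1) * T) * ((norm (p (?F 0 x0) - ?G 0 y0))\<^sup>2 + (L1 * e2)\<^sup>2)"
    proof (rule gronwall_norm_sq[of T L2 "\<lambda>t. p (?F t x0) - ?G t y0"])
      fix t assume t: "0 \<le> t" "t \<le> T"
      let ?x = "?F t x0"
      have F: "((\<lambda>t. ?F t x0) has_vector_derivative ?f ?x) (at t within {0..T})"
        using sol(1)[unfolded solution_in_def, rule_format, OF t(1)]
        by (auto intro: has_vector_derivative_within_subset)
      have G: "((\<lambda>t. ?G t y0) has_vector_derivative ?g (?G t y0)) (at t within {0..T})"
        using red(1)[unfolded solution_in_def, rule_format, OF t(1)]
        by (auto intro: has_vector_derivative_within_subset)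
      have pf: "p (?f ?x) = slow ?x" by (simp add: p_def exact_field_eq)
      show "((\<lambda>t. p (?F t x0) - ?G t y0) has_vector_derivative slow ?x - ?g (?G t y0)) (at t within {0..T})"
        using has_vector_derivative_diff[OF bounded_linear.has_vector_derivative[OF p F] G]
        unfolding pf .
      have xK: "?x \<in> K" and GK: "?G t y0 \<in> ?KY"
        using sol(1) red(1) t unfolding solution_in_def by auto
      then have pK: "p ?x \<in> ?KY" "lift (p ?x) \<in> K"
        using stationary by (auto simp: p_def lift_def set_K_def)
      \<comment> \<open>Replacing \<open>\<mu>\<close> by the stationary distribution is the only
        error in the slow equation. It enters as the source \<open>L1 * e2\<close>, where
        \<open>L1\<close> is independent of \<open>\<delta>\<close>.\<close>
      have "norm (slow ?x - slow (lift (p ?x))) \<le> L1 * norm (?x - lift (p ?x))"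
        using lipschitz_on_normD[OF L1 xK pK(2)] .
      also have "norm (?x - lift (p ?x)) = norm (snd (snd ?x) - stationary Q (fst ?x))"
        by (cases ?x) (simp add: p_def lift_def)
      also have "L1 * \<dots> \<le> L1 * e2" using near[OF \<delta> inA[OF t(1)]] L0 by (intro mult_left_mono) auto
      finally have 1: "norm (slow ?x - ?g (p ?x)) \<le> L1 * e2" by (simp add: reduced_field_eq)
      have "norm (?g (p ?x) - ?g (?G t y0)) \<le> L2 * norm (p ?x - ?G t y0)"
        using lipschitz_on_normD[OF L2 pK(1) GK] .
      then show "norm (slow ?x - ?g (?G t y0)) \<le> L2 * norm (p ?x - ?G t y0) + L1 * e2"
        using 1 norm_triangle_ineq[of "slow ?x - ?g (p ?x)" "?g (p ?x) - ?g (?G t y0)"] by simp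
    qed (use T L0 in auto)
    also have "\<dots> = (E * (L1 * e2))\<^sup>2"
      by (simp add: sol(2) red(2) y0_def[symmetric] E_def power_mult_distrib exp_double[symmetric])
    finally have "norm (p x - ?G T y0) \<le> E * (L1 * e2)"
      unfolding x0(2) by (rule power2_le_imp_le) (intro mult_nonneg_nonneg less_imp_le[OF E] less_imp_le[OF e2] L0)
    then have 1: "dist (p x) (?G T y0) \<le> e1" using e2le by (simp add: dist_norm)
    obtain z where z: "z \<in> reduced_attractor R\<theta> \<tau> lam r \<psi> \<phi> Q" "dist (?G T y0) z < e1"
      using T(2)[OF y0] by blast
    have pz: "dist (p x) z \<le> 2 * e1" using 1 z(2) dist_triangle[of "p x" z "?G T y0"] by linarith
    have z\<Theta>: "fst z \<in> \<Theta>" using reduced_attractor(3)[OF e1] z(1) by auto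
    have x\<Theta>: "fst x \<in> \<Theta>" using exact_attractor(2)[OF \<delta>(1)] x by (auto simp: set_K_def)
    have "dist (fst x) (fst z) \<le> 2 * e1" using dist_fst_le[of "p x" z] pz by (simp add: p_def)
    then have "dist (stationary Q (fst x)) (stationary Q (fst z)) \<le> Ls * (2 * e1)"
      using lipschitz_onD[OF Ls x\<Theta> z\<Theta>] L0 by (meson mult_left_mono order_trans)
    then have 2: "dist (snd (snd x)) (stationary Q (fst z)) \<le> e1 + Ls * (2 * e1)"
      using near[OF \<delta> x] e2le(2) dist_triangle[of "snd (snd x)" "stationary Q (fst z)" "stationary Q (fst x)"]
      by (simp add: dist_norm)
    have "dist x (lift z) = sqrt ((dist (p x) z)\<^sup>2 + (dist (snd (snd x)) (stationary Q (fst z)))\<^sup>2)"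
      by (cases x; cases z) (simp add: p_def lift_def dist_Pair_Pair add.assoc)
    also have "\<dots> \<le> dist (p x) z + dist (snd (snd x)) (stationary Q (fst z))"
      by (rule sqrt_sum_squares_le_sum[OF zero_le_dist zero_le_dist])
    also have "\<dots> \<le> e1 * (3 + 2 * Ls)" using pz 2 by (simp add: algebra_simps)
    finally have "C * dist x (lift z) \<le> C * (e1 * (3 + 2 * Ls))" using C by (intro mult_left_mono) auto
    also have "\<dots> = e" using C L0 by (simp add: e1_def)
    finally have "dX x (lift z) \<le> e" using dX_le_dist[of x "lift z"] unfolding C_def by linarith
    moreover have "lift z \<in> lifted_attractor R\<theta> \<tau> lam r \<psi> \<phi> Q"
      using z(1) by (cases z) (auto simp: lifted_attractor_def lift_def)
    ultimately show ?thesis by blast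
  qed
  then show ?thesis using \<delta>0 by blast
qed

lemma semidist_exact_attractor_tendsto:
  "((\<lambda>\<delta>. semidist dX (exact_attractor \<delta>) (lifted_attractor R\<theta> \<tau> lam r \<psi> \<phi> Q)) \<longlongrightarrow> 0) (at_right 0)"
proof (rule tendsto_0_if_le_ennreal)
  fix e :: real assume "e > 0"
  from exact_attractor_near_lifted[OF this] obtain \<delta>0 where \<delta>0: "\<delta>0 > 0"
    and near: "\<And>\<delta> x. 0 < \<delta> \<Longrightarrow> \<delta> < \<delta>0 \<Longrightarrow> x \<in> exact_attractor \<delta> \<Longrightarrow>
      \<exists>y\<in>lifted_attractor R\<theta> \<tau> lam r \<psi> \<phi> Q. dX x y \<le> e"
    by blast
  have "semidist dX (exact_attractor \<delta>) (lifted_attractor R\<theta> \<tau> lam r \<psi> \<phi> Q) \<le> ennreal e"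
    if \<delta>: "0 < \<delta>" "\<delta> < \<delta>0" for \<delta>
    unfolding semidist_def
  proof (rule SUP_least)
    fix x assume "x \<in> exact_attractor \<delta>"
    from near[OF \<delta> this] obtain y where "y \<in> lifted_attractor R\<theta> \<tau> lam r \<psi> \<phi> Q" "dX x y \<le> e" by blast
    then show "(INF y\<in>lifted_attractor R\<theta> \<tau> lam r \<psi> \<phi> Q. ennreal (dX x y)) \<le> ennreal e"
      by (intro INF_lower2) (auto intro: ennreal_leI)
  qed
  then show "\<forall>\<^sub>F \<delta> in at_right 0. semidist dX (exact_attractor \<delta>) (lifted_attractor R\<theta> \<tau> lam r \<psi> \<phi> Q) \<le> ennreal e"
    unfolding eventually_at_right_field using \<delta>0 by blast
qed

end

theorem corollary9:
  fixes R\<theta> \<tau> lam :: real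
    and r :: "'n::finite \<Rightarrow> 'k::finite \<Rightarrow> real"
    and \<psi> :: "'n \<Rightarrow> 'k \<Rightarrow> real^'d"
    and \<phi> :: "'n \<Rightarrow> 'k \<Rightarrow> real^'m"
    and Q :: "real^'d \<Rightarrow> real^'n^'n"
  assumes pos: "R\<theta> > 0" "\<tau> > 0" "lam > 0"
    and generator_offdiag: "\<And>\<theta> i j. \<theta> \<in> Theta R\<theta> \<Longrightarrow> i \<noteq> j \<Longrightarrow> Q \<theta> $ i $ j \<ge> 0"
    and generator_diag: "\<And>\<theta> i. \<theta> \<in> Theta R\<theta> \<Longrightarrow> Q \<theta> $ i $ i = - (\<Sum>j\<in>UNIV - {i}. Q \<theta> $ i $ j)"
    and generator_lipschitz: "\<exists>L_Q>0. \<forall>\<theta>\<in>Theta R\<theta>. \<forall>\<theta>'\<in>Theta R\<theta>.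
          opnorm1 (transpose (Q \<theta>) - transpose (Q \<theta>')) \<le> L_Q * norm (\<theta> - \<theta>')"
    and mixing: "\<exists>C_mix\<ge>1. \<exists>\<gamma>>0. \<forall>\<theta>\<in>Theta R\<theta>. \<forall>\<xi>\<in>zero_sum. \<forall>t\<ge>0.
          norm1 (matrix_exp (t *\<^sub>R transpose (Q \<theta>)) *v \<xi>) \<le> C_mix * exp (- \<gamma> * t) * norm1 \<xi>"
    and pathwise_stability: "\<exists>C_path\<ge>1. \<exists>\<gamma>_path>0. \<forall>\<delta>>0. \<forall>\<eta>::real \<Rightarrow> real^'d.
          \<eta> \<in> borel_measurable (lebesgue_on {0..}) \<and> (\<forall>t\<ge>0. \<eta> t \<in> Theta R\<theta>) \<longrightarrow>
          (\<forall>s t \<xi>s \<xi>t. 0 \<le> s \<and> s \<le> t \<and> \<xi>s \<in> zero_sum \<and> evolves Q \<delta> \<eta> s t \<xi>s \<xi>t \<longrightarrow>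
             norm1 \<xi>t \<le> C_path * exp (- \<gamma>_path * (t - s) / \<delta>) * norm1 \<xi>s)"
  shows "\<exists>\<A>::real \<Rightarrow> ((real^'d) \<times> (real^'m) \<times> (real^'n)) set.
      (\<forall>\<delta>>0. compact_global_attractor (state_space R\<theta>) dX
                (exact_semiflow R\<theta> \<tau> lam r \<psi> \<phi> Q \<delta>) (\<A> \<delta>)
              \<and> \<A> \<delta> \<subseteq> set_K R\<theta> lam r \<phi>) \<and>
      ((\<lambda>\<delta>. semidist dX (\<A> \<delta>) (lifted_attractor R\<theta> \<tau> lam r \<psi> \<phi> Q)) \<longlongrightarrow> 0) (at_right 0)"
proof -
  interpret actor_critic R\<theta> \<tau> lam r \<psi> \<phi> Q
    by (rule actor_critic.intro) fact+
  show ?thesis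
    using exact_attractor(1,2) semidist_exact_attractor_tendsto by blast
qed

end
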